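(* Let $n\ge 1$ and let $w$ be a Kreweras word of length $3n$. Then (a) $W_{\mathrm{pro}(w)}=\mathrm{rot}(W_w)$, and (b) $W_{\mathrm{evac}(w)}=\mathrm{flip}(W_w)$.
   Context: A Kreweras word of length $3n$ is a word $w=(w_1,\dots,w_{3n})$ in letters $\mathsf A,\mathsf B,\mathsf C$ with exactly $n$ of each letter such that every prefix has at least as many $\mathsf A$'s as $\mathsf B$'s and at least as many $\mathsf A$'s as $\mathsf C$'s. Promotion: let $\iota(w)$ be the smallest $\iota\ge1$ such that $(w_1,\dots,w_\iota)$ has as many $\mathsf A$'s as $\mathsf B$'s or as many $\mathsf A$'s as $\mathsf C$'s; $\mathrm{pro}(w)=(w_2,\dots,w_{\iota(w)-1},\mathsf A,w_{\iota(w)+1},\dots,w_{3n},w_{\iota(w)})$. Evacuation: for $1\le i\le 3n-1$ let $\tau_i(w)$ be the word obtained by swapping $w_i$ and $w_{i+1}$ if the result is a Kreweras word, and $\tau_i(w)=w$ otherwise; then $\mathrm{evac}=(\tau_1)\circ(\tau_2\circ\tau_1)\circ\cdots\circ(\tau_{3n-1}\circ\cdots\circ\tau_2\circ\tau_1)$ (maps applied right to left). Kreweras bump diagram: for $\varepsilon\in\{\mathsf B,\mathsf C\}$ let $M^\varepsilon_w$ be the unique noncrossing perfect matching of $\{i: w_i\in\{\mathsf A,\varepsilon\}\}$ by arcs $(i,j)$, $i<j$, with $w_i=\mathsf A$, $w_j=\varepsilon$ (noncrossing: no two arcs $(i,j),(k,l)$ with $i<k<j<l$). Two arcs $(a,b),(c,d)$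 of $M^{\mathsf B}_w\cup M^{\mathsf C}_w$ cross if $a\le c<b<d$ (this happens only for arcs from different matchings). The diagram $D_w$ places $1,\dots,3n$ in order on a horizontal line and draws each arc as a curve in the upper half plane joining its endpoints, such that two arcs meet iff they cross, and then exactly once (arcs $(a,b),(a,d)$ meet at the point $a$). The web $W_w$: replace each meeting point of crossing arcs $(a,b),(c,d)$ with $a<c<b<d$ by a white vertex and a black vertex joined by a new edge, the white vertex being incident to the two arc-segments leading towards $a$ and $c$, the black vertex incident to the two arc-segments leading towards $b$ and $d$; for crossing arcs $(a,b),(a,d)$ sharing the left endpoint $a$, join the point $a$ by a new edge to a new black vertex which is incident to the two arc-segments leading to $b$ and $d$. The points $1,\dots,3n$ become white boundary vertices (with these labels) placed counterclockwise on the boundary of a disk, and the resulting planar bipartite graph embedded in the disk is $W_w$ (an $\mathfrak{sl}_3$-web: planar graph in a disk, boundary vertices of degree one labeled $1,\dots,m$ counterclockwise on the rim, internal vertices of degree three, vertices properly 2-colored black/white). Webs are considered up to isotopy of the disk fixing the labeled boundary. For a web $W$ with $m$ boundary vertices: $\mathrm{rot}(W)$ is obtained by relabeling the boundary vertex labeled $i$ by $i-1$ for $i\ge2$ and the one labeled $1$ by $m$; $\mathrm{flip}(W)$ is obtained by reflecting $W$ across a chord of the disk separating boundary vertices $1$ and $m$ and then relabeling the boundary vertex labeled $i$ by $m+1-i$ (vertex colors unchanged). *)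

theory Defs
  imports Complex_Main
begin

section \<open>Kreweras words, promotion, evacuation\<close>

datatype letter = A | B | C

text \<open>Positions in a word are counted from 1.\<close>

definition letter_at :: "letter list \<Rightarrow> nat \<Rightarrow> letter" where
  "letter_at w i = w ! (i - 1)"

definition kreweras_word :: "nat \<Rightarrow> letter list \<Rightarrow> bool" where
  "kreweras_word n w \<longleftrightarrow>
     length w = 3 * n \<and>
     count_list w A = n \<and> count_list w B = n \<and> count_list w C = n \<and>
     (\<forall>k \<le> length w. count_list (take k w) B \<le> count_list (take k w) A \<and>
                     count_list (take k w) C \<le> count_list (take k w) A)"

definition iota :: "letter list \<Rightarrow> nat" where
  "iota w = (LEAST i. 1 \<le> i \<and>
     (count_list (take i w) A = count_list (take i w) B \<or>
      count_list (take i w) A = count_list (take i w) C))"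

text \<open>For a nonempty Kreweras word \<open>iota w \<ge> 2\<close>, because the first letter is \<open>A\<close>.\<close>

definition pro :: "letter list \<Rightarrow> letter list" where
  "pro w = take (iota w - 2) (drop 1 w) @ [A] @ drop (iota w) w @ [letter_at w (iota w)]"

definition swap_at :: "nat \<Rightarrow> letter list \<Rightarrow> letter list" where
  "swap_at i w = w[i - 1 := letter_at w (i + 1), i := letter_at w i]"

definition tau :: "nat \<Rightarrow> nat \<Rightarrow> letter list \<Rightarrow> letter list" where
  "tau n i w = (if kreweras_word n (swap_at i w) then swap_at i w else w)"

text \<open>\<open>tau_sweep n k\<close> is \<open>\<tau>\<^sub>k \<circ> \<dots> \<circ> \<tau>\<^sub>2 \<circ> \<tau>\<^sub>1\<close>, and \<open>tau_sweeps n k\<close> is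
  \<open>\<tau>\<^sub>1 \<circ> (\<tau>\<^sub>2 \<circ> \<tau>\<^sub>1) \<circ> \<dots> \<circ> (\<tau>\<^sub>k \<circ> \<dots> \<circ> \<tau>\<^sub>1)\<close>.\<close>

primrec tau_sweep :: "nat \<Rightarrow> nat \<Rightarrow> letter list \<Rightarrow> letter list" where
  "tau_sweep n 0 = id"
| "tau_sweep n (Suc k) = tau n (Suc k) \<circ> tau_sweep n k"

primrec tau_sweeps :: "nat \<Rightarrow> nat \<Rightarrow> letter list \<Rightarrow> letter list" where
  "tau_sweeps n 0 = id"
| "tau_sweeps n (Suc k) = tau_sweeps n k \<circ> tau_sweep n (Suc k)"

definition evac :: "nat \<Rightarrow> letter list \<Rightarrow> letter list" where
  "evac n = tau_sweeps n (3 * n - 1)"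


section \<open>Webs up to isotopy\<close>

text \<open>
  A 2-coloured graph embedded in an oriented disk is recorded by its rotation system:
  \<open>(v, e, f) \<in> ccw W\<close> means that \<open>f\<close> is the edge that immediately follows \<open>e\<close> in the
  counterclockwise order of the edges around \<open>v\<close> (for a vertex of degree one, \<open>f = e\<close>).
  \<open>rim W i\<close> is the boundary vertex labelled \<open>i\<close>, for \<open>1 \<le> i \<le> rim_size W\<close>; the labels
  increase counterclockwise along the boundary of the disk.  The values of \<open>rim W\<close> outside
  this range are irrelevant.  Edges are abstract objects, so that parallel edges are possible.
\<close>

record ('v, 'e) web =
  whites :: "'v set"
  blacks :: "'v set"
  edges :: "'e set"
  incid :: "('v \<times> 'e) set"
  ccw :: "('v \<times> 'e \<times> 'e) set"
  rim_size :: nat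
  rim :: "nat \<Rightarrow> 'v"

text \<open>
  Two plane graphs in the disk all of whose components meet the boundary are related by an
  orientation preserving isotopy of the disk fixing the labelled boundary iff there is an
  isomorphism of graphs that preserves colours, rotation system and boundary labels.  The graphs
  \<open>kreweras_web w\<close> below have this property: every internal vertex is joined to the boundary by
  a path of segments that runs to the right.
\<close>

definition web_isotopic :: "('v, 'e) web \<Rightarrow> ('u, 'f) web \<Rightarrow> bool" (infix "\<simeq>" 50) where
  "W \<simeq> W' \<longleftrightarrow> (\<exists>\<phi> \<psi>.
     bij_betw \<phi> (whites W \<union> blacks W) (whites W' \<union> blacks W') \<and>
     \<phi> ` whites W = whites W' \<and> \<phi> ` blacks W = blacks W' \<and>
     bij_betw \<psi> (edges W) (edges W') \<and>
     (\<forall>v \<in> whites W \<union> blacks W. \<forall>e \<in> edges W.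
        (v, e) \<in> incid W \<longleftrightarrow> (\<phi> v, \<psi> e) \<in> incid W') \<and>
     (\<forall>v \<in> whites W \<union> blacks W. \<forall>e \<in> edges W. \<forall>f \<in> edges W.
        (v, e, f) \<in> ccw W \<longleftrightarrow> (\<phi> v, \<psi> e, \<psi> f) \<in> ccw W') \<and>
     rim_size W = rim_size W' \<and>
     (\<forall>i \<in> {1..rim_size W}. \<phi> (rim W i) = rim W' i))"

text \<open>The vertex labelled \<open>i \<ge> 2\<close> gets the label \<open>i - 1\<close>, the one labelled 1 gets
  \<open>rim_size W\<close>.\<close>

definition rot :: "('v, 'e) web \<Rightarrow> ('v, 'e) web" where
  "rot W = W\<lparr>rim := (\<lambda>i. if i = rim_size W then rim W 1 else rim W (i + 1))\<rparr>"

text \<open>The reflection reverses the cyclic order of the edges around every vertex.\<close>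

definition flip :: "('v, 'e) web \<Rightarrow> ('v, 'e) web" where
  "flip W = W\<lparr>ccw := {(v, e, f). (v, f, e) \<in> ccw W},
              rim := (\<lambda>i. rim W (rim_size W + 1 - i))\<rparr>"


section \<open>Kreweras bump diagrams\<close>

type_synonym arc = "nat \<times> nat"

definition noncrossing_matching :: "letter list \<Rightarrow> letter \<Rightarrow> arc set \<Rightarrow> bool" where
  "noncrossing_matching w \<epsilon> M \<longleftrightarrow>
     (\<forall>(i, j) \<in> M. 1 \<le> i \<and> i < j \<and> j \<le> length w \<and> letter_at w i = A \<and> letter_at w j = \<epsilon>) \<and>
     (\<forall>k \<in> {1..length w}. letter_at w k \<in> {A, \<epsilon>} \<longrightarrow> (\<exists>!m. m \<in> M \<and> (k = fst m \<or> k = snd m))) \<and>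
     (\<forall>(i, j) \<in> M. \<forall>(k, l) \<in> M. \<not> (i < k \<and> k < j \<and> j < l))"

definition matching :: "letter list \<Rightarrow> letter \<Rightarrow> arc set" where
  "matching w \<epsilon> = (THE M. noncrossing_matching w \<epsilon> M)"

definition arcs :: "letter list \<Rightarrow> arc set" where
  "arcs w = matching w B \<union> matching w C"

definition crosses :: "arc \<Rightarrow> arc \<Rightarrow> bool" where
  "crosses \<alpha> \<beta> \<longleftrightarrow> fst \<alpha> \<le> fst \<beta> \<and> fst \<beta> < snd \<alpha> \<and> snd \<alpha> < snd \<beta>"

text \<open>The position \<open>i\<close> is the point \<open>i\<close> of the real axis; the arc \<open>(a, b)\<close> is drawn as the
  semicircle over the segment from \<open>a\<close> to \<open>b\<close>.  The lemma \<open>curves_meet\<close> below shows that such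
  curves meet as required.  The disk is the upper half plane, whose boundary is traversed
  counterclockwise from left to right.\<close>

definition curve :: "arc \<Rightarrow> complex set" where
  "curve \<alpha> = {z. 0 \<le> Im z \<and>
     cmod (z - of_real ((real (fst \<alpha>) + real (snd \<alpha>)) / 2)) = (real (snd \<alpha>) - real (fst \<alpha>)) / 2}"

lemma curve_iff:
  assumes "a < b"
  shows "z \<in> curve (a, b) \<longleftrightarrow>
    0 \<le> Im z \<and> (Re z)\<^sup>2 + (Im z)\<^sup>2 = (real a + real b) * Re z - real a * real b"
proof -
  have "cmod (z - of_real ((real a + real b) / 2)) = (real b - real a) / 2 \<longleftrightarrow>
        (cmod (z - of_real ((real a + real b) / 2)))\<^sup>2 = ((real b - real a) / 2)\<^sup>2"
    using assms by (subst power2_eq_iff_nonneg) auto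
  also have "\<dots> \<longleftrightarrow> (Re z)\<^sup>2 + (Im z)\<^sup>2 = (real a + real b) * Re z - real a * real b"
    by (simp add: cmod_power2) (auto simp: power2_eq_square field_simps)
  finally show ?thesis by (simp add: curve_def)
qed

lemma curves_meet:
  assumes "fst \<alpha> < snd \<alpha>" "fst \<beta> < snd \<beta>"
    and "snd \<alpha> \<noteq> fst \<beta>" "snd \<beta> \<noteq> fst \<alpha>" "snd \<alpha> \<noteq> snd \<beta>"
  shows "(\<exists>z. z \<in> curve \<alpha> \<inter> curve \<beta>) \<longleftrightarrow> crosses \<alpha> \<beta> \<or> crosses \<beta> \<alpha>"
    and "z \<in> curve \<alpha> \<inter> curve \<beta> \<Longrightarrow> z' \<in> curve \<alpha> \<inter> curve \<beta> \<Longrightarrow> z = z'"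
proof -
  obtain a b c d where [simp]: "\<alpha> = (a, b)" "\<beta> = (c, d)" by (cases \<alpha>, cases \<beta>) auto
  have lt: "a < b" "c < d" and ne: "b \<noteq> c" "d \<noteq> a" "b \<noteq> d" using assms by auto
  have ex: "\<exists>z. z \<in> curve (a, b) \<inter> curve (c, d)"
    if h: "a < b" "c < d" "a \<le> c" "c < b" "b < d" for a b c d :: nat
  proof -
    define s where "s = real c + real d - real a - real b"
    define x where "x = (real c * real d - real a * real b) / s"
    have s: "s > 0" using h by (simp add: s_def)
    have sx: "s * x = real c * real d - real a * real b" using s by (simp add: x_def)
    have "((real a + real b) * x - real a * real b - x\<^sup>2) * s\<^sup>2 =
        (real a + real b) * (s * x) * s - real a * real b * s\<^sup>2 - (s * x)\<^sup>2"
      by (simp add: power2_eq_square algebra_simps)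
    also have "\<dots> = (real c - real a) * (real d - real a) * (real b - real c) * (real d - real b)"
      unfolding sx unfolding s_def by algebra
    finally have "((real a + real b) * x - real a * real b - x\<^sup>2) * s\<^sup>2 =
        (real c - real a) * (real d - real a) * (real b - real c) * (real d - real b)" .
    moreover have "\<dots> \<ge> 0" using h by (intro mult_nonneg_nonneg) auto
    ultimately have nn: "0 \<le> (real a + real b) * x - real a * real b - x\<^sup>2"
      using s by (smt (verit) mult_neg_pos zero_less_power)
    from sx have eq: "(real a + real b) * x - real a * real b = (real c + real d) * x - real c * real d"
      by (simp add: s_def algebra_simps)
    show ?thesis
      by (intro exI[of _ "Complex x (sqrt ((real a + real b) * x - real a * real b - x\<^sup>2))"])
        (use h nn eq in \<open>simp add: curve_iff\<close>)
  qed
  have bounds: "real a \<le> Re z \<and> Re z \<le> real b" if "a < b" "z \<in> curve (a, b)" for a b z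
  proof -
    have "(Re z - real a) * (real b - Re z) = (Im z)\<^sup>2"
      using that by (simp add: curve_iff power2_eq_square algebra_simps)
    then have "(Re z - real a) * (real b - Re z) \<ge> 0" by simp
    then show ?thesis using that(1) by (auto simp: zero_le_mult_iff)
  qed
  have nested: False if "a < c" "d < b" "c < d" "z \<in> curve (a, b)" "z \<in> curve (c, d)"
    for a b c d z
  proof -
    have e: "(Re z - real a) * (real b - Re z) = (Re z - real c) * (real d - Re z)"
      using that by (simp add: curve_iff power2_eq_square algebra_simps)
    have "real c \<le> Re z" "Re z \<le> real d" using bounds that by auto
    then have "(Re z - real c) * (real d - Re z) \<le> (Re z - real c) * (real b - Re z)"
      and "(Re z - real c) * (real b - Re z) < (Re z - real a) * (real b - Re z)"
      using that by (auto intro!: mult_left_mono mult_strict_right_mono)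
    with e show False by linarith
  qed
  show "(\<exists>z. z \<in> curve \<alpha> \<inter> curve \<beta>) \<longleftrightarrow> crosses \<alpha> \<beta> \<or> crosses \<beta> \<alpha>"
  proof
    assume "\<exists>z. z \<in> curve \<alpha> \<inter> curve \<beta>"
    then obtain z where z: "z \<in> curve (a, b)" "z \<in> curve (c, d)" by auto
    have "real a \<le> Re z" "Re z \<le> real b" "real c \<le> Re z" "Re z \<le> real d"
      using bounds z lt by auto
    then have "a \<le> d" "c \<le> b" by linarith+
    moreover have "\<not> (a < c \<and> d < b)" "\<not> (c < a \<and> b < d)" using nested z lt by blast+
    ultimately show "crosses \<alpha> \<beta> \<or> crosses \<beta> \<alpha>" using ne lt by (auto simp: crosses_def)
  next
    assume "crosses \<alpha> \<beta> \<or> crosses \<beta> \<alpha>"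
    then show "\<exists>z. z \<in> curve \<alpha> \<inter> curve \<beta>"
      using ex[of a b c d] ex[of c d a b] lt by (auto simp: crosses_def)
  qed
  show "z = z'" if "z \<in> curve \<alpha> \<inter> curve \<beta>" "z' \<in> curve \<alpha> \<inter> curve \<beta>"
  proof -
    have "crosses \<alpha> \<beta> \<or> crosses \<beta> \<alpha>"
      using that \<open>(\<exists>z. z \<in> curve \<alpha> \<inter> curve \<beta>) \<longleftrightarrow> _\<close> by blast
    then have s: "real c + real d - real a - real b \<noteq> 0" by (auto simp: crosses_def)
    have x: "(real c + real d - real a - real b) * Re u = real c * real d - real a * real b"
      if "u \<in> curve \<alpha> \<inter> curve \<beta>" for u
      using that lt by (simp add: curve_iff algebra_simps)
    have re: "Re z = Re z'" using x[OF that(1)] x[OF that(2)] s by (metis mult_left_cancel)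
    have "0 \<le> Im z" "0 \<le> Im z'"
      "(Re z)\<^sup>2 + (Im z)\<^sup>2 = (real a + real b) * Re z - real a * real b"
      "(Re z')\<^sup>2 + (Im z')\<^sup>2 = (real a + real b) * Re z' - real a * real b"
      using that lt by (simp_all add: curve_iff)
    moreover from calculation re have "(Im z)\<^sup>2 = (Im z')\<^sup>2" by (metis add_left_cancel)
    ultimately have "Im z = Im z'" by (intro power2_eq_imp_eq[of "Im z"])
    with re show ?thesis by (simp add: complex_eq_iff)
  qed
qed

definition meetings :: "letter list \<Rightarrow> complex set" where
  "meetings w = {z. \<exists>\<alpha> \<in> arcs w. \<exists>\<beta> \<in> arcs w. crosses \<alpha> \<beta> \<and> z \<in> curve \<alpha> \<inter> curve \<beta>}"

definition positions :: "letter list \<Rightarrow> complex set" where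
  "positions w = of_nat ` {1..length w}"

text \<open>The marked points cut the arc \<open>\<alpha>\<close> into segments; \<open>segment w \<alpha> y z\<close> says that one of
  them runs from \<open>y\<close> rightwards to \<open>z\<close>.\<close>

definition marks :: "letter list \<Rightarrow> arc \<Rightarrow> complex set" where
  "marks w \<alpha> = curve \<alpha> \<inter> (meetings w \<union> positions w)"

definition segment :: "letter list \<Rightarrow> arc \<Rightarrow> complex \<Rightarrow> complex \<Rightarrow> bool" where
  "segment w \<alpha> y z \<longleftrightarrow> \<alpha> \<in> arcs w \<and> y \<in> marks w \<alpha> \<and> z \<in> marks w \<alpha> \<and> Re y < Re z \<and>
     \<not> (\<exists>x \<in> marks w \<alpha>. Re y < Re x \<and> Re x < Re z)"


section \<open>The web of a Kreweras word\<close>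

text \<open>
  A meeting point \<open>z\<close> is replaced by the white vertex \<open>White z\<close> and the black vertex \<open>Black z\<close>,
  joined by the edge \<open>Join z\<close>.  The boundary vertex labelled \<open>i\<close> is \<open>White i\<close>; in particular, if
  the arcs meeting at \<open>z\<close> share their left endpoint \<open>a\<close>, so that \<open>z = a\<close>, the white end of
  \<open>Join z\<close> is the boundary vertex \<open>a\<close>, as it should be.  \<open>Seg \<alpha> y\<close> is the segment of \<open>\<alpha>\<close> that
  starts at \<open>y\<close>.  Every arc starts at a position \<open>a\<close> with letter \<open>A\<close>, which is a meeting point;
  hence every segment runs from a meeting point to a meeting point or to a position.
\<close>

datatype web_vertex = White complex | Black complex
datatype web_edge = Join complex | Seg arc complex

inductive_set web_incid :: "letter list \<Rightarrow> (web_vertex \<times> web_edge) set" for w where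
  "z \<in> meetings w \<Longrightarrow> (White z, Join z) \<in> web_incid w"
| "z \<in> meetings w \<Longrightarrow> (Black z, Join z) \<in> web_incid w"
| "segment w \<alpha> y z \<Longrightarrow> (Black y, Seg \<alpha> y) \<in> web_incid w"
| "segment w \<alpha> y z \<Longrightarrow> (White z, Seg \<alpha> y) \<in> web_incid w"

text \<open>
  If \<open>crosses \<alpha> \<beta>\<close>, then to the left of their meeting point \<open>\<alpha>\<close> runs above \<open>\<beta>\<close>, and to the right
  of it \<open>\<beta>\<close> runs above \<open>\<alpha>\<close>.  Hence the counterclockwise order around the white vertex is \<open>\<alpha>\<close>
  (upper left), \<open>\<beta>\<close> (lower left), new edge (right), and around the black vertex it is new edge
  (left, or below if the meeting point is a common left endpoint), \<open>\<alpha>\<close> (lower right), \<open>\<beta>\<close> (upper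
  right).
\<close>

inductive_set web_ccw :: "letter list \<Rightarrow> (web_vertex \<times> web_edge \<times> web_edge) set" for w where
  "\<lbrakk>\<alpha> \<in> arcs w; \<beta> \<in> arcs w; crosses \<alpha> \<beta>; z \<in> curve \<alpha> \<inter> curve \<beta>;
    (e, f) \<in> {(Join z, Seg \<alpha> z), (Seg \<alpha> z, Seg \<beta> z), (Seg \<beta> z, Join z)}\<rbrakk>
   \<Longrightarrow> (Black z, e, f) \<in> web_ccw w"
| "\<lbrakk>crosses \<alpha> \<beta>; fst \<alpha> < fst \<beta>; z \<in> curve \<alpha> \<inter> curve \<beta>; segment w \<alpha> x z; segment w \<beta> y z;
    (e, f) \<in> {(Seg \<alpha> x, Seg \<beta> y), (Seg \<beta> y, Join z), (Join z, Seg \<alpha> x)}\<rbrakk>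
   \<Longrightarrow> (White z, e, f) \<in> web_ccw w"
| "\<lbrakk>z \<in> positions w; (White z, e) \<in> web_incid w\<rbrakk> \<Longrightarrow> (White z, e, e) \<in> web_ccw w"

definition kreweras_web :: "letter list \<Rightarrow> (web_vertex, web_edge) web" where
  "kreweras_web w =
     \<lparr>whites = White ` (meetings w \<union> positions w),
      blacks = Black ` meetings w,
      edges = Join ` meetings w \<union> {Seg \<alpha> y |\<alpha> y. \<exists>z. segment w \<alpha> y z},
      incid = web_incid w,
      ccw = web_ccw w,
      rim_size = length w,
      rim = (\<lambda>i. White (of_nat i))\<rparr>"

end

theory Submission
  imports Defs "HOL-Library.Multiset"
begin

text \<open>
  Cut the bump diagram by vertical lines.  Processing a word letter by letter acts on the stack of
  open strands: \<open>A\<close> creates two strands at the bottom, and \<open>B\<close> or \<open>C\<close> lets the lowest strand of its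
  kind descend, crossing strands of the other kind only, and leave at the bottom.  Reflecting the
  picture gives the same operations at the top of the stack.  A bottom operation commutes with a
  top operation, except that a letter \<open>B\<close> or \<open>C\<close> at the bottom may consume the pair of strands just
  created at the top; then the two operations exchange their letters, because sliding a fork of two
  strands past parallel strands gives the same ladder of trivalent vertices.  This is the local rule
  of promotion.  Hence the web of \<open>w\<close> is that of the promoted prefix followed by one operation at
  the top.  At the end of the word that operation moves the boundary vertex 1 to the last place, which gives (a); iterating, \<open>w\<close> is built from
  operations at the top only, performed in the order of the letters of \<open>evac w\<close>, which gives (b).

  A trivalent bipartite plane web is encoded by its edges and two successor relations, one for the
  black and one for the white ends of the edges, so that the local rule becomes an equality.
\<close>

section \<open>Diagrams with open strands\<close>

text \<open>Every edge has exactly one black end, so the triples of edges at the black vertices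
  partition the edges. A run carries the list of these triples: their entries, as a multiset, form
  the edge set, which no slide may alter, and word and list together determine the diagram. Two webs
  built by the same word with distinct names therefore differ only by a bijection of edges, and no
  vertex has to be followed through a slide. The slide can start because an \<open>A\<close> acting
  on an empty stack is a bottom and a top operation at once. Whether an exchange takes place depends
  on letter counts alone: some strand can close with \<open>x\<close> exactly if fewer letters
  \<open>x\<close> than \<open>A\<close> have been read. A top operation puts its boundary edge at
  the left end of the boundary, and one that empties the stack differs from a bottom operation in
  nothing else. What remains is geometry: a run draws all crossings of a closing arc with arcs
  starting under it at one moment, whereas the semicircles meet elsewhere; both pictures agree
  because the meeting points on an arc come in the order of the endpoints lying under it.\<close>

text \<open>A diagram lists the two successor relations, the boundary edges from left to right and the
  open strands from bottom to top; \<open>Two l u\<close> is a pair born at an \<open>A\<close> with both arcs still open, its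
  labels being determined by the first closing letter.\<close>

datatype 'e strand = One letter 'e | Two 'e 'e

type_synonym 'e diagram = "('e \<times> 'e) set \<times> ('e \<times> 'e) set \<times> 'e list \<times> 'e strand list"

definition cyc :: "'e \<Rightarrow> 'e \<Rightarrow> 'e \<Rightarrow> ('e \<times> 'e) set" where
  "cyc a b c = {(a, b), (b, c), (c, a)}"

lemma cyc_rotate: "cyc a b c = cyc b c a" by (auto simp: cyc_def)
lemma cyc_converse: "(cyc a b c)\<inverse> = cyc a c b" by (auto simp: cyc_def)

fun opp :: "letter \<Rightarrow> letter" where
  "opp A = A" | "opp B = C" | "opp C = B"

lemma opp_opp [simp]: "opp (opp x) = x" by (cases x) auto
lemma opp_A_iff [simp]: "opp x = A \<longleftrightarrow> x = A" by (cases x) auto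
lemma opp_neq [simp]: "x \<noteq> A \<Longrightarrow> opp x \<noteq> x" "x \<noteq> A \<Longrightarrow> x \<noteq> opp x" by (cases x; simp)+
lemma neq_opp: "x \<noteq> A \<Longrightarrow> y \<noteq> A \<Longrightarrow> y \<noteq> x \<Longrightarrow> y = opp x" by (cases x; cases y) auto

text \<open>Each triple lists the edges at one black vertex: the stem or joining edge
  \<open>j\<close>, the lower right edge \<open>l\<close>, the upper right edge \<open>u\<close>.
  Slides permute the entries, so only the multiset of this list is invariant.\<close>

definition names :: "('e \<times> 'e \<times> 'e) list \<Rightarrow> 'e list" where
  "names ts = concat (map (\<lambda>(j, l, u). [j, l, u]) ts)"

lemma names_simps [simp]:
  "names [] = []" "names ((j, l, u) # ts) = j # l # u # names ts" "names (ts @ ts') = names ts @ names ts'"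
  by (auto simp: names_def)

text \<open>Strands are listed from bottom to top while the descent starts at the top, so the head
  \<open>c\<close> is crossed last, by the strand that has arrived as \<open>e'\<close>. There
  \<open>e'\<close> lies upper left and \<open>c\<close> lower left, hence the white cycle
  \<open>e'\<close>, \<open>c\<close>, \<open>j\<close>; on the right the descending strand goes on
  as \<open>l\<close> and the crossed one as \<open>u\<close>.\<close>

inductive desc :: "'e list \<Rightarrow> ('e \<times> 'e \<times> 'e) list \<Rightarrow> 'e \<Rightarrow> 'e \<Rightarrow> 'e list \<Rightarrow>
    ('e \<times> 'e) set \<Rightarrow> ('e \<times> 'e) set \<Rightarrow> bool" where
  desc_Nil: "desc [] [] e e [] {} {}"
| desc_Cons: "desc cs ts e e' cs' b w \<Longrightarrow>
    desc (c # cs) ((j, l, u) # ts) e l (u # cs') (b \<union> cyc j l u) (w \<union> cyc e' c j)"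

text \<open>Here the head \<open>c\<close> is crossed first. The moving strand arrives from the
  lower left and leaves as \<open>u\<close>, but both cycles are oriented as for a descent, so a
  crossing is encoded in the same way whichever of its two strands is regarded as moving.\<close>

inductive asc :: "'e list \<Rightarrow> ('e \<times> 'e \<times> 'e) list \<Rightarrow> 'e \<Rightarrow> 'e \<Rightarrow> 'e list \<Rightarrow>
    ('e \<times> 'e) set \<Rightarrow> ('e \<times> 'e) set \<Rightarrow> bool" where
  asc_Nil: "asc [] [] e e [] {} {}"
| asc_Cons: "asc cs ts u e' cs' b w \<Longrightarrow>
    asc (c # cs) ((j, l, u) # ts) e e' (l # cs') (cyc j l u \<union> b) (cyc c e j \<union> w)"

text \<open>Of two arcs leaving a common point the one that ends earlier runs below the other, so a
  closing letter coming from the bottom takes the lower strand of an open pair.\<close>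

inductive takes :: "letter \<Rightarrow> 'e strand \<Rightarrow> 'e \<Rightarrow> 'e strand list \<Rightarrow> bool" where
  takes_One: "takes x (One x e) e []"
| takes_Two: "takes x (Two l u) l [One (opp x) u]"

inductive takes_top :: "letter \<Rightarrow> 'e strand \<Rightarrow> 'e \<Rightarrow> 'e strand list \<Rightarrow> bool" where
  takes_top_One: "takes_top x (One x e) e []"
| takes_top_Two: "takes_top x (Two l u) u [One (opp x) l]"

text \<open>All strands below \<open>t\<close> carry the label \<open>opp x\<close>, which makes
  \<open>t\<close> the lowest strand that \<open>x\<close> can close. The loop at a new boundary
  edge is the cyclic order at a boundary vertex of degree one.\<close>

inductive step :: "letter \<Rightarrow> ('e \<times> 'e \<times> 'e) list \<Rightarrow> 'e diagram \<Rightarrow> 'e diagram \<Rightarrow> bool" where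
  step_fork: "step A [(j, l, u)] (b, w, rs, ss) (b \<union> cyc j l u, w \<union> {(j, j)}, rs @ [j], Two l u # ss)"
| step_close: "x \<noteq> A \<Longrightarrow> desc cs ts e e' cs' b' w' \<Longrightarrow> takes x t e t' \<Longrightarrow>
    step x ts (b, w, rs, map (One (opp x)) cs @ t # ss)
      (b \<union> b', w \<union> w' \<union> {(e', e')}, rs @ [e'], map (One (opp x)) cs' @ t' @ ss)"

text \<open>The top of the stack is next to the left end of the boundary, so the new boundary edge
  goes to the front of \<open>rs\<close>.\<close>

inductive tstep :: "letter \<Rightarrow> ('e \<times> 'e \<times> 'e) list \<Rightarrow> 'e diagram \<Rightarrow> 'e diagram \<Rightarrow> bool" where
  tstep_fork: "tstep A [(j, l, u)] (b, w, rs, ss) (b \<union> cyc j l u, w \<union> {(j, j)}, j # rs, ss @ [Two l u])"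
| tstep_close: "x \<noteq> A \<Longrightarrow> asc cs ts e e' cs' b' w' \<Longrightarrow> takes_top x t e t' \<Longrightarrow>
    tstep x ts (b, w, rs, ss @ t # map (One (opp x)) cs)
      (b \<union> b', w \<union> w' \<union> {(e', e')}, e' # rs, ss @ t' @ map (One (opp x)) cs')"

lemma step_forkI:
  assumes "b2 = b \<union> cyc j l u" "w2 = w \<union> {(j, j)}" "rs2 = rs @ [j]" "ss2 = Two l u # ss"
  shows "step A [(j, l, u)] (b, w, rs, ss) (b2, w2, rs2, ss2)"
  unfolding assms by (rule step_fork)

lemma step_closeI:
  assumes "x \<noteq> A" "desc cs ts e e' cs' b' w'" "takes x t e t'"
    "ss1 = map (One (opp x)) cs @ t # ss" "b2 = b \<union> b'" "w2 = w \<union> w' \<union> {(e', e')}" "rs2 = rs @ [e']"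
    "ss2 = map (One (opp x)) cs' @ t' @ ss"
  shows "step x ts (b, w, rs, ss1) (b2, w2, rs2, ss2)"
  unfolding assms(4-8) by (rule step_close) fact+

lemma tstep_forkI:
  assumes "b2 = b \<union> cyc j l u" "w2 = w \<union> {(j, j)}" "rs2 = j # rs" "ss2 = ss @ [Two l u]"
  shows "tstep A [(j, l, u)] (b, w, rs, ss) (b2, w2, rs2, ss2)"
  unfolding assms by (rule tstep_fork)

lemma tstep_closeI:
  assumes "x \<noteq> A" "asc cs ts e e' cs' b' w'" "takes_top x t e t'"
    "ss1 = ss @ t # map (One (opp x)) cs" "b2 = b \<union> b'" "w2 = w \<union> w' \<union> {(e', e')}" "rs2 = e' # rs"
    "ss2 = ss @ t' @ map (One (opp x)) cs'"
  shows "tstep x ts (b, w, rs, ss1) (b2, w2, rs2, ss2)"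
  unfolding assms(4-8) by (rule tstep_close) fact+

section \<open>Reflection exchanges bottom and top operations\<close>

fun mirror_strand :: "'e strand \<Rightarrow> 'e strand" where
  "mirror_strand (One x e) = One x e"
| "mirror_strand (Two l u) = Two u l"

fun mirror :: "'e diagram \<Rightarrow> 'e diagram" where
  "mirror (b, w, rs, ss) = (b\<inverse>, w\<inverse>, rev rs, rev (map mirror_strand ss))"

definition swap_names :: "('e \<times> 'e \<times> 'e) list \<Rightarrow> ('e \<times> 'e \<times> 'e) list" where
  "swap_names ts = rev (map (\<lambda>(j, l, u). (j, u, l)) ts)"

lemma mset_swap_names [simp]: "mset (names (swap_names ts)) = mset (names ts)"
  by (induction ts) (auto simp: swap_names_def)

text \<open>The constructor of \<open>desc\<close> adds a crossing after all others; this adds one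
  before all others. It is needed because reversing an ascent moves its first crossing to the end of
  the list, and because a descending strand may take over a crossing that an ascending one had
  made.\<close>

lemma desc_snoc:
  assumes "desc cs ts l e' cs' b w"
  shows "desc (cs @ [c]) (ts @ [(j, l, u)]) e e' (cs' @ [u]) (b \<union> cyc j l u) (w \<union> cyc e c j)"
  using assms
proof (induction cs ts l e' cs' b w rule: desc.induct)
  case (desc_Nil l)
  then show ?case using desc.desc_Cons[OF desc.desc_Nil, of c j l u e] by simp
next
  case (desc_Cons cs ts l e' cs' b w c' j' l' u')
  from desc.desc_Cons[OF desc_Cons.IH, of c' j' l' u'] show ?case
    by (simp add: Un_ac)
qed

lemma asc_mirror:
  assumes "asc cs ts e e' cs' b w"
  shows "desc (rev cs) (swap_names ts) e e' (rev cs') (b\<inverse>) (w\<inverse>)"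
  using assms
proof (induction rule: asc.induct)
  case (asc_Nil e)
  then show ?case by (simp add: swap_names_def desc.desc_Nil)
next
  case (asc_Cons cs ts u e' cs' b w c j l e)
  from desc_snoc[OF asc_Cons.IH, of c j l e] show ?case
    by (simp add: swap_names_def converse_Un cyc_converse Un_commute cyc_rotate[of c j e] cyc_rotate[of e c j])
qed

lemma mirror_strand_One [simp]: "mirror_strand \<circ> One x = One x" by auto

lemma takes_top_mirror:
  "takes_top x t e t' \<Longrightarrow> takes x (mirror_strand t) e (rev (map mirror_strand t'))"
  by (induction rule: takes_top.induct) (auto intro: takes.intros)

lemma tstep_mirror:
  assumes "tstep x ts P Q"
  shows "step x (swap_names ts) (mirror P) (mirror Q)"
  using assms
proof cases
  case (tstep_fork j l u b w rs ss)
  then show ?thesis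
    by (auto simp: swap_names_def converse_Un cyc_converse intro!: step_forkI)
next
  case (tstep_close cs e e' cs' b' w' t t' b w rs ss)
  show ?thesis unfolding tstep_close(1,2) mirror.simps
    by (rule step_closeI[OF tstep_close(3) asc_mirror[OF tstep_close(4)] takes_top_mirror[OF tstep_close(5)]])
      (auto simp: converse_Un rev_map)
qed

text \<open>Sliding the new strand pair from one side of parallel strands to the other: the vertices of
  the resulting ladder are the same, only the roles of their three edges rotate.\<close>

lemma ladder:
  assumes "desc cs ts l e' cs' b w"
  shows "\<exists>l2 u2 ts2 cs2 b2. asc cs ts2 u2 j cs2 b2 w \<and> l2 # cs2 = cs' @ [u] \<and>
    b \<union> cyc j l u = cyc e' l2 u2 \<union> b2 \<and>
    mset (names ((j, l, u) # ts)) = mset (names ((e', l2, u2) # ts2))"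
  using assms
proof (induction rule: desc.induct)
  case (desc_Nil l)
  \<comment> \<open>Without strands to pass the fork just turns by one third: \<open>l\<close>
    becomes the stem, \<open>u\<close> the lower and \<open>j\<close> the upper branch.\<close>
  show ?case by (intro exI[of _ u] exI[of _ j] exI[of _ "[]"] exI[of _ "{}"] conjI asc_Nil)
     (auto simp: cyc_rotate[of j l u])
next
  case (desc_Cons cs ts l e' cs' b w c j1 l1 u1)
  then obtain l2 u2 ts2 cs2 b2 where IH: "asc cs ts2 u2 j cs2 b2 w" "l2 # cs2 = cs' @ [u]"
    "b \<union> cyc j l u = cyc e' l2 u2 \<union> b2"
    "mset (names ((j, l, u) # ts)) = mset (names ((e', l2, u2) # ts2))" by blast
  \<comment> \<open>The last crossing of the descent turns into the fork with stem \<open>l1\<close>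
    and branches \<open>u1\<close> and \<open>j1\<close>, while the fork found for the shorter
    ladder, with stem \<open>e'\<close>, turns into the first crossing of the ascent.\<close>
  from asc_Cons[OF IH(1), of c e' l2 j1]
  have "asc (c # cs) ((e', l2, u2) # ts2) j1 j (l2 # cs2) (cyc e' l2 u2 \<union> b2) (w \<union> cyc e' c j1)"
    by (simp add: cyc_rotate[of e' c j1] Un_commute)
  moreover have "b \<union> cyc j1 l1 u1 \<union> cyc j l u = cyc l1 u1 j1 \<union> (cyc e' l2 u2 \<union> b2)"
    using IH(3) unfolding cyc_rotate[of j1 l1 u1] by blast
  ultimately show ?case using IH(2,4)
    by (intro exI[of _ u1] exI[of _ j1] exI[of _ "(e', l2, u2) # ts2"] exI[of _ "l2 # cs2"] exI[of _ "cyc e' l2 u2 \<union> b2"] conjI) simp_all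
qed

section \<open>Commutation of bottom and top operations\<close>

fun capable :: "letter \<Rightarrow> 'e strand \<Rightarrow> bool" where
  "capable x (One y e) \<longleftrightarrow> y = x"
| "capable x (Two l u) \<longleftrightarrow> True"

lemma takes_capable: "takes x t e t' \<Longrightarrow> capable x t" by (cases rule: takes.cases) auto

lemma map_One_prefix:
  assumes "map (One y) cs @ t # ss = p @ q" "\<not> (\<exists>r. p = map (One y) cs @ t # r)"
  shows "\<exists>cs1 cs2. cs = cs1 @ cs2 \<and> p = map (One y) cs1 \<and> q = map (One y) cs2 @ t # ss"
  using assms by (auto simp: append_eq_append_conv2 append_eq_map_conv map_eq_append_conv Cons_eq_append_conv)

text \<open>For use with \<open>p\<close> the part of the stack that a top operation has left alone
  and \<open>q\<close> the part it has changed: the strand taken by a following bottom operation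
  lies in \<open>p\<close>, or all of \<open>p\<close> is merely passed.\<close>

lemma split_at_first:
  assumes "map (One y) cs @ t # ss = p @ q"
  obtains r where "p = map (One y) cs @ t # r" "ss = r @ q"
  | cs1 cs2 where "cs = cs1 @ cs2" "p = map (One y) cs1" "q = map (One y) cs2 @ t # ss"
proof (cases "\<exists>r. p = map (One y) cs @ t # r")
  case True then show ?thesis using assms that(1) by auto
next
  case False then show ?thesis using map_One_prefix[OF assms] that(2) by blast
qed

text \<open>An operation at the bottom commutes with one at the top, except that a closing operation at
  the bottom may consume the very strand pair that was created at the top; then the two exchange
  their letters.\<close>

lemma square:
  assumes "tstep v tv P Q" "step x tx Q R"
  shows "\<exists>tx' tv' P'. mset (names tx') + mset (names tv') = mset (names tx) + mset (names tv) \<and>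
    (if v = A \<and> x \<noteq> A \<and> \<not> (\<exists>t \<in> set (snd (snd (snd P))). capable x t)
     then step A tx' P P' \<and> tstep x tv' P' R else step x tx' P P' \<and> tstep v tv' P' R)"
    (is "?goal")
proof -
  define swaps where "swaps \<longleftrightarrow> v = A \<and> x \<noteq> A \<and> \<not> (\<exists>t \<in> set (snd (snd (snd P))). capable x t)"
  have commute: ?goal if "step x tx' P P'" "tstep v tv' P' R" "\<not> swaps"
    "mset (names tx') + mset (names tv') = mset (names tx) + mset (names tv)" for tx' tv' P'
    unfolding swaps_def[symmetric]
    by (intro exI[of _ tx'] exI[of _ tv'] exI[of _ P']) (simp only: that if_False simp_thms)
  have swap: ?goal if "step A tx' P P'" "tstep x tv' P' R" "swaps"
    "mset (names tx') + mset (names tv') = mset (names tx) + mset (names tv)" for tx' tv' P'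
    unfolding swaps_def[symmetric]
    by (intro exI[of _ tx'] exI[of _ tv'] exI[of _ P']) (simp only: that if_True simp_thms)
  show ?goal
  using assms(1)
proof cases
  case tv: (tstep_fork j l u b w rs ss)
  note P = tv(3) and Q = tv(4)
  show ?thesis
    using assms(2)
  proof cases
    case tx: (step_fork j' l' u' b1 w1 rs1 ss1)
    have Q': "b1 = b \<union> cyc j l u" "w1 = w \<union> {(j, j)}" "rs1 = j # rs" "ss1 = ss @ [Two l u]"
      using tx Q by auto
    have "step x tx P (b \<union> cyc j' l' u', w \<union> {(j', j')}, rs @ [j'], Two l' u' # ss)"
      unfolding P tx(1,2) by (rule step.step_fork)
    moreover have "tstep v tv (b \<union> cyc j' l' u', w \<union> {(j', j')}, rs @ [j'], Two l' u' # ss) R"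
      unfolding tx(4) tv(1,2) Q' by (rule tstep_forkI) auto
    ultimately show ?thesis by (rule commute) (use tx in \<open>auto simp: swaps_def\<close>)
  next
    case tx: (step_close cs e e' cs' b' w' t t' b1 w1 rs1 ss1)
    have eq: "map (One (opp x)) cs @ t # ss1 = ss @ [Two l u]" using Q tx(1) by simp
    have Q': "b1 = b \<union> cyc j l u" "w1 = w \<union> {(j, j)}" "rs1 = j # rs" using tx(1) Q by auto
    show ?thesis
    proof (cases rule: split_at_first[OF eq])
      case (1 r)
      have cap: "\<exists>t \<in> set (snd (snd (snd P))). capable x t"
        using takes_capable[OF tx(5)] 1 P by auto
      have "step x tx P (b \<union> b', w \<union> w' \<union> {(e', e')}, rs @ [e'], map (One (opp x)) cs' @ t' @ r)"
        unfolding P by (rule step_closeI[OF tx(3-5)]) (use 1 in auto)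
      moreover have "tstep v tv (b \<union> b', w \<union> w' \<union> {(e', e')}, rs @ [e'], map (One (opp x)) cs' @ t' @ r) R"
        unfolding tx(2) tv(1,2) Q' by (rule tstep_forkI) (use 1 in auto)
      ultimately show ?thesis by (rule commute) (use cap in \<open>auto simp: swaps_def\<close>)
    next
      \<comment> \<open>All older strands have the label \<open>opp x\<close>, so the letter reaches
        the new pair. A fork whose lower branch descends past all other strands is one side of the
        ladder.\<close>
      case (2 cs1 cs2)
      have cs: "cs2 = []" "t = Two l u" "ss1 = []" "cs1 = cs" using 2 by (cases cs2; simp)+
      from tx(5) cs have t': "e = l" "t' = [One (opp x) u]" by (auto elim: takes.cases)
      have ss: "ss = map (One (opp x)) cs" using 2(2) unfolding cs .
      have ncap: "\<not> (\<exists>t \<in> set (snd (snd (snd P))). capable x t)" unfolding P ss using tx(3) by auto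
      obtain l2 u2 ts2 cs2 b2 where L: "asc cs ts2 u2 j cs2 b2 w'" "l2 # cs2 = cs' @ [u]"
        "b' \<union> cyc j l u = cyc e' l2 u2 \<union> b2"
        "mset (names ((j, l, u) # tx)) = mset (names ((e', l2, u2) # ts2))"
        using ladder[OF tx(4)[unfolded t'], of j u] by blast
      have s1: "step A [(e', l2, u2)] P (b \<union> cyc e' l2 u2, w \<union> {(e', e')}, rs @ [e'], Two l2 u2 # ss)"
        unfolding P by (rule step.step_fork)
      have m: "map (One (opp x)) cs' @ [One (opp x) u] = One (opp x) l2 # map (One (opp x)) cs2"
        using arg_cong[OF L(2), of "map (One (opp x))"] by simp
      have b: "b \<union> cyc j l u \<union> b' = b \<union> cyc e' l2 u2 \<union> b2" using L(3) by blast
      \<comment> \<open>After the exchange the fork stands at the bottom; its upper branch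
        \<open>u2\<close> closes at the top and ends in \<open>j\<close>, the boundary edge that the
        top fork had produced.\<close>
      have "tstep x ts2 (b \<union> cyc e' l2 u2, w \<union> {(e', e')}, rs @ [e'], Two l2 u2 # ss) R"
        unfolding tx(2) Q' b
        by (rule tstep_closeI[OF tx(3) L(1) takes_top_Two, where ss = "[]" and l1 = l2]) (simp_all add: m ss cs t' insert_commute)
      with s1 show ?thesis
        by (rule swap) (use L(4) ncap tv(1,2) tx(3) in \<open>auto simp: swaps_def\<close>)
    qed
  qed
next
  case tv: (tstep_close ds e e' ds' b' w' t t' b w rs p)
  note P = tv(1) and Q = tv(2)
  from assms(2) show ?thesis unfolding Q
  proof cases
    case tx: (step_fork j l u)
    have "step x tx P (b \<union> cyc j l u, w \<union> {(j, j)}, rs @ [j], Two l u # p @ t # map (One (opp v)) ds)"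
      unfolding P tx(1,2) by (rule step.step_fork)
    moreover have "tstep v tv (b \<union> cyc j l u, w \<union> {(j, j)}, rs @ [j], Two l u # p @ t # map (One (opp v)) ds) R"
      unfolding tx by (rule tstep_closeI[OF tv(3-5), where ss = "Two l u # p"]) auto
    ultimately show ?thesis by (rule commute) (use tv(3) in \<open>auto simp: swaps_def\<close>)
  next
    case tx: (step_close cs d d' cs' b1 w1 s s' ss1)
    have eq: "map (One (opp x)) cs @ s # ss1 = p @ t' @ map (One (opp v)) ds'" using tx(1) by simp
    show ?thesis
    proof (cases rule: split_at_first[OF eq])
      case (1 r)
      have "step x tx P (b \<union> b1, w \<union> w1 \<union> {(d', d')}, rs @ [d'],
          map (One (opp x)) cs' @ s' @ r @ t # map (One (opp v)) ds)"
        unfolding P by (rule step_closeI[OF tx(3-5)]) (use 1 in auto)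
      moreover have "tstep v tv (b \<union> b1, w \<union> w1 \<union> {(d', d')}, rs @ [d'],
          map (One (opp x)) cs' @ s' @ r @ t # map (One (opp v)) ds) R"
        unfolding tx(2) by (rule tstep_closeI[OF tv(3-5), where ss = "map (One (opp x)) cs' @ s' @ r"]) (use 1 in auto)
      ultimately show ?thesis by (rule commute) (use tv(3) in \<open>auto simp: swaps_def\<close>)
    next
      case (2 cs1 cs2)
      \<comment> \<open>The part of the stack changed by the top operation holds only strands
        labelled \<open>opp v\<close>, so \<open>x\<close> can find its strand there only if it is
        that letter.\<close>
      have vx: "x = opp v"
      proof (rule ccontr)
        assume "x \<noteq> opp v"
        then have "x = v" using tx(3) tv(3) neq_opp[of v x] by auto
        have "s \<in> set (t' @ map (One (opp v)) ds')" using 2 by auto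
        then have "\<not> capable x s" using \<open>x = v\<close> tv(3,5) by (auto elim: takes_top.cases)
        then show False using takes_capable[OF tx(5)] by simp
      qed
      have cs2: "cs2 = []"
      proof (rule ccontr)
        assume "cs2 \<noteq> []"
        then have "One (opp x) (hd cs2) \<in> set (t' @ map (One (opp v)) ds')" using 2 by (cases cs2) auto
        then show False using vx tv(3,5) by (auto elim: takes_top.cases)
      qed
      have q: "t' @ map (One x) ds' = s # ss1" and p: "p = map (One v) cs" using 2 cs2 vx by auto
      from tv(5) show ?thesis
      proof cases
        \<comment> \<open>The two letters close the two strands of one pair. Whichever acts first
          settles the labels, and both orders give \<open>x\<close> to the lower and
          \<open>v\<close> to the upper strand.\<close>
        case (takes_top_Two l)
        then have s: "s = One x l" and ss1: "ss1 = map (One x) ds'" using q vx by auto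
        from tx(5) s have ds: "d = l" "s' = []" by (auto elim: takes.cases)
        have "step x tx P (b \<union> b1, w \<union> w1 \<union> {(d', d')}, rs @ [d'],
          map (One (opp x)) cs' @ One v e # map (One x) ds)"
          unfolding P by (rule step_closeI[OF tx(3,4)[unfolded ds] takes_Two[of x l e]])
             (use p vx takes_top_Two in auto)
        moreover have "tstep v tv (b \<union> b1, w \<union> w1 \<union> {(d', d')}, rs @ [d'],
          map (One (opp x)) cs' @ One v e # map (One x) ds) R"
          unfolding tx(2) by (rule tstep_closeI[OF tv(3,4) takes_top_One]) (use ds ss1 vx in auto)
        ultimately show ?thesis by (rule commute) (use tv(3) in \<open>auto simp: swaps_def\<close>)
      next
        case takes_top_One
        then have t: "t = One v e" "t' = []" by auto
        from tv(4) show ?thesis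
        proof cases
          case asc_Nil
          then show ?thesis using q t by simp
        next
          \<comment> \<open>The strand taken by \<open>x\<close> is the first one that the ascending
            strand has crossed. In the other order this crossing, with the same vertices and edges,
            is the first one of the descent, so its triple moves from one operation to the
            other.\<close>
          case (asc_Cons es ts u es' b2 w2 c j l)
          have s: "s = One x l" and ss1: "ss1 = map (One x) es'" using q t asc_Cons by auto
          from tx(5) s have ds: "d = l" "s' = []" by (auto elim: takes.cases)
          have s1: "step x (tx @ [(j, l, u)]) P (b \<union> (b1 \<union> cyc j l u), w \<union> (w1 \<union> cyc c e j) \<union> {(d', d')}, rs @ [d'],
              map (One (opp x)) (cs' @ [u]) @ [] @ map (One x) es)"
            unfolding P
            by (rule step_closeI[OF tx(3) desc_snoc[OF tx(4)[unfolded ds], of e j u c] takes_One])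
              (use p t vx asc_Cons(1) in auto)
          have "tstep v ts (b \<union> (b1 \<union> cyc j l u), w \<union> (w1 \<union> cyc c e j) \<union> {(d', d')}, rs @ [d'],
              map (One (opp x)) (cs' @ [u]) @ [] @ map (One x) es) R"
            unfolding tx(2)
            by (rule tstep_closeI[OF tv(3) asc_Cons(6) takes_top.takes_top_One]) (use ds ss1 vx asc_Cons(4,5) in auto)
          with s1 show ?thesis
            by (rule commute) (use tv(3) asc_Cons(2) in \<open>auto simp: swaps_def\<close>)
        qed
      qed
    qed
  qed
qed
qed

section \<open>Runs, strips and renaming\<close>

inductive runs :: "letter list \<Rightarrow> ('e \<times> 'e \<times> 'e) list \<Rightarrow> 'e diagram \<Rightarrow> 'e diagram \<Rightarrow> bool" where
  runs_Nil: "runs [] [] P P"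
| runs_Cons: "step x t P Q \<Longrightarrow> runs xs ts Q R \<Longrightarrow> runs (x # xs) (t @ ts) P R"

lemma runs_append:
  "runs xs ts P Q \<Longrightarrow> runs ys us Q R \<Longrightarrow> runs (xs @ ys) (ts @ us) P R"
proof (induction rule: runs.induct)
  case (runs_Cons x t P Q xs ts Q')
  then show ?case using runs.runs_Cons[of x t P Q "xs @ ys" "ts @ us" R] by simp
qed simp

lemma runs_single: "step x t P Q \<Longrightarrow> runs [x] t P Q"
  using runs_Cons[OF _ runs_Nil, of x t P Q] by simp

lemma runs_snoc: "runs xs ts P Q \<Longrightarrow> step x t Q R \<Longrightarrow> runs (xs @ [x]) (ts @ t) P R"
  by (rule runs_append[OF _ runs_single])

abbreviation blank :: "'e diagram" where
  "blank \<equiv> ({}, {}, [], [])"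

section \<open>Counting the strands that a letter can close\<close>

definition cap_count :: "letter \<Rightarrow> 'e diagram \<Rightarrow> nat" where
  "cap_count x P = length (filter (capable x) (snd (snd (snd P))))"

lemma filter_capable_map_One:
  "filter (capable x) (map (One y) cs) = (if x = y then map (One y) cs else [])"
  by (induction cs) auto

lemma desc_length: "desc cs ts e e' cs' b w \<Longrightarrow> length ts = length cs \<and> length cs' = length cs"
  by (induction rule: desc.induct) auto

lemma asc_length: "asc cs ts e e' cs' b w \<Longrightarrow> length ts = length cs \<and> length cs' = length cs"
  by (induction rule: asc.induct) auto

text \<open>A pair counts once for each of the two letters. Closing the other letter does not change
  the count for \<open>x\<close>: if it breaks up a pair, the strand left over is labelled
  \<open>x\<close>.\<close>

lemma step_cap_count:
  assumes "step y ts P Q" "x \<noteq> A"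
  shows "cap_count x Q + (if y = x then 1 else 0) = cap_count x P + (if y = A then 1 else 0)"
  using assms(1)
proof cases
  case (step_fork j l u b w rs ss)
  then show ?thesis using assms(2) by (simp add: cap_count_def)
next
  case (step_close cs e e' cs' b' w' t t' b w rs ss)
  have "length cs' = length cs" using desc_length[OF step_close(4)] by simp
  note * = this step_close(1-3) assms(2) neq_opp[of y x]
  from step_close(5) show ?thesis
    by cases (use * in \<open>auto simp: cap_count_def filter_capable_map_One\<close>)
qed

text \<open>Starting from \<open>blank\<close> this turns the condition of the local rule, which
  speaks of strands, into an equality of letter counts.\<close>

lemma runs_cap_count:
  "runs ys ts P Q \<Longrightarrow> x \<noteq> A \<Longrightarrow> cap_count x Q + count_list ys x = cap_count x P + count_list ys A"
proof (induction rule: runs.induct)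
  case (runs_Cons y t P Q xs ts R)
  then show ?case using step_cap_count[OF runs_Cons(1), of x] by (auto split: if_splits)
qed simp

text \<open>The trace on letters of moving one top operation \<open>v\<close> past bottom
  operations; \<open>p\<close> collects the letters that now act at the bottom before it. The test
  says that no strand present after \<open>p\<close> can close with \<open>x\<close>, so that
  \<open>x\<close> hits the pair made by \<open>v\<close>.\<close>

fun slide :: "letter list \<Rightarrow> letter \<Rightarrow> letter list \<Rightarrow> letter list \<times> letter" where
  "slide p v [] = (p, v)"
| "slide p v (x # xs) =
    (if v = A \<and> x \<noteq> A \<and> count_list p x = count_list p A then slide (p @ [A]) x xs
     else slide (p @ [x]) v xs)"

lemma slide_runs:
  assumes "runs p ts blank P" "tstep v tv P Q" "runs xs tx Q R" "slide p v xs = (p', v')"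
  shows "\<exists>ts' tv' P'. runs p' ts' blank P' \<and> tstep v' tv' P' R \<and>
    mset (names ts') + mset (names tv') = mset (names ts) + mset (names tv) + mset (names tx)"
  using assms
proof (induction xs arbitrary: p ts P v tv Q tx)
  case Nil
  from Nil.prems(3) have "R = Q" "tx = []" by (auto elim: runs.cases)
  then show ?case using Nil.prems by (intro exI[of _ ts] exI[of _ tv] exI[of _ P]) simp
next
  case (Cons x xs)
  from Cons.prems(3) obtain t tx' Q' where Q': "step x t Q Q'" "runs xs tx' Q' R" "tx = t @ tx'"
    by (cases rule: runs.cases) auto
  have cap: "(\<exists>t \<in> set (snd (snd (snd P))). capable x t) \<longleftrightarrow> count_list p x \<noteq> count_list p A" if "x \<noteq> A"
  proof -
    have "(\<exists>t \<in> set (snd (snd (snd P))). capable x t) \<longleftrightarrow> cap_count x P \<noteq> 0"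
      by (auto simp: cap_count_def filter_empty_conv)
    then show ?thesis using runs_cap_count[OF Cons.prems(1) that] by (auto simp: cap_count_def)
  qed
  obtain tx1 tv1 P1 where sq: "mset (names tx1) + mset (names tv1) = mset (names t) + mset (names tv)"
    "(if v = A \<and> x \<noteq> A \<and> count_list p x = count_list p A
     then step A tx1 P P1 \<and> tstep x tv1 P1 Q' else step x tx1 P P1 \<and> tstep v tv1 P1 Q')"
    using square[OF Cons.prems(2) Q'(1)] cap by metis
  have mset_eq: "mset (names (ts @ tx1)) + mset (names tv1) + mset (names tx') =
      mset (names ts) + mset (names tv) + mset (names tx)"
    using arg_cong[OF sq(1), of "\<lambda>m. m + mset (names ts) + mset (names tx')"] Q'(3) by (simp add: ac_simps)
  show ?case
  proof (cases "v = A \<and> x \<noteq> A \<and> count_list p x = count_list p A")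
    case True
    then have s: "step A tx1 P P1" "tstep x tv1 P1 Q'" using sq(2) by simp_all
    have "slide (p @ [A]) x xs = (p', v')" using True Cons.prems(4) by simp
    from Cons.IH[OF runs_snoc[OF Cons.prems(1) s(1)] s(2) Q'(2) this] show ?thesis unfolding mset_eq .
  next
    case False
    then have s: "step x tx1 P P1" "tstep v tv1 P1 Q'" using sq(2) by simp_all
    have "slide (p @ [x]) v xs = (p', v')" using False Cons.prems(4) by (auto split: if_splits)
    from Cons.IH[OF runs_snoc[OF Cons.prems(1) s(1)] s(2) Q'(2) this] show ?thesis unfolding mset_eq .
  qed
qed

text \<open>On the blank diagram a fork at the bottom is also a fork at the top, so the first letter
  may be read as a top operation and moved past all the others.\<close>

lemma runs_strip:
  assumes "runs (a # xs) ts blank R" "slide [] A xs = (p, v)"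
  shows "\<exists>ts' tv P. runs p ts' blank P \<and> tstep v tv P R \<and>
    mset (names ts') + mset (names tv) = mset (names ts)"
proof -
  from assms(1) obtain t ts2 Q where Q: "step a t blank Q" "runs xs ts2 Q R" "ts = t @ ts2"
    by (cases rule: runs.cases) auto
  from Q(1) obtain j l u where "t = [(j, l, u)]" "Q = (cyc j l u, {(j, j)}, [j], [Two l u])"
    by (cases rule: step.cases) auto
  then have "tstep A t blank Q" using tstep_fork[of j l u "{}" "{}" "[]" "[]"] by simp
  from slide_runs[OF runs_Nil this Q(2) assms(2)] Q(3) show ?thesis by simp
qed

lemma slide_length: "slide p v xs = (p', v') \<Longrightarrow> length p' = length p + length xs"
  by (induction xs arbitrary: p v) (auto split: if_splits)

text \<open>The top operations come off the picture from the last one to the first, so the letter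
  carried away in each round stands to the right of everything found later.\<close>

function evacuate :: "letter list \<Rightarrow> letter list" where
  "evacuate [] = []"
| "evacuate (a # xs) = evacuate (fst (slide [] A xs)) @ [snd (slide [] A xs)]"
  by pat_completeness auto
termination
  by (relation "measure length") (auto simp: slide_length[OF surjective_pairing])

text \<open>The split-off top operation becomes, after reflection, a last bottom operation; the
  picture under it belongs to the shorter word \<open>p\<close>, to which the induction
  applies.\<close>

lemma runs_evacuate:
  assumes "runs w ts blank R"
  shows "\<exists>ts'. runs (evacuate w) ts' blank (mirror R) \<and> mset (names ts') = mset (names ts)"
  using assms
proof (induction w arbitrary: ts R rule: evacuate.induct)
  case 1
  then have "R = blank" "ts = []" by (auto elim: runs.cases)
  then show ?case by (auto intro!: exI[of _ "[]"] runs_Nil)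
next
  case (2 a xs)
  obtain p v where pv: "slide [] A xs = (p, v)" by fastforce
  from runs_strip[OF "2.prems" pv] obtain ts1 tv P where P: "runs p ts1 blank P" "tstep v tv P R"
    "mset (names ts1) + mset (names tv) = mset (names ts)" by blast
  from "2.IH"[of ts1 P] P(1) pv obtain ts2 where ts2: "runs (evacuate p) ts2 blank (mirror P)"
    "mset (names ts2) = mset (names ts1)" by (auto simp del: mirror.simps)
  show ?case
    using runs_snoc[OF ts2(1) tstep_mirror[OF P(2)]] ts2(2) P(3) pv
    by (intro exI[of _ "ts2 @ swap_names tv"]) simp
qed

text \<open>No strand remains at the end, so the final top operation closes a single strand that has
  nothing to cross. A bottom closing of this strand yields the same relations and differs only in
  the end of the boundary list that receives the edge.\<close>

lemma runs_promote:
  assumes "runs (a # xs) ts blank (b, w, rs, [])" "slide [] A xs = (p, v)"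
  shows "\<exists>ts' r rs'. rs = r # rs' \<and> runs (p @ [v]) ts' blank (b, w, rs' @ [r], []) \<and>
    mset (names ts') = mset (names ts)"
proof -
  from runs_strip[OF assms] obtain ts' tv P where P: "runs p ts' blank P"
    "tstep v tv P (b, w, rs, [])" "mset (names ts') + mset (names tv) = mset (names ts)" by blast
  from P(2) show ?thesis
  proof cases
    case (tstep_close cs e e' cs' b' w' t t' b1 w1 rs1 ss)
    have e: "cs = []" "cs' = []" "ss = []" "t' = []"
      using tstep_close asc_length[OF tstep_close(7)] by auto
    then have "tv = []" "e' = e" "b' = {}" "w' = {}" using tstep_close(7) by (auto elim: asc.cases)
    moreover have "t = One v e" using tstep_close(8) e by (auto elim: takes_top.cases)
    ultimately have P': "P = (b, w1, rs1, [One v e])" "rs = e # rs1" "w = w1 \<union> {(e, e)}" "tv = []"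
      using tstep_close e by auto
    have "step v [] P (b, w, rs1 @ [e], [])"
      unfolding P' by (rule step_closeI[OF tstep_close(6) desc_Nil takes_One]) auto
    from runs_snoc[OF P(1) this] P' P(3) show ?thesis by auto
  qed auto
qed

section \<open>Renaming edges; a word and distinct names determine the diagram\<close>

fun map_diagram :: "('e \<Rightarrow> 'f) \<Rightarrow> 'e diagram \<Rightarrow> 'f diagram" where
  "map_diagram f (b, w, rs, ss) = (map_prod f f ` b, map_prod f f ` w, map f rs, map (map_strand f) ss)"

abbreviation map_names :: "('e \<Rightarrow> 'f) \<Rightarrow> ('e \<times> 'e \<times> 'e) list \<Rightarrow> ('f \<times> 'f \<times> 'f) list" where
  "map_names f \<equiv> map (map_prod f (map_prod f f))"

lemma map_cyc: "map_prod f f ` cyc a b c = cyc (f a) (f b) (f c)"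
  by (auto simp: cyc_def)

lemma desc_map:
  "desc cs ts e e' cs' b w \<Longrightarrow>
    desc (map f cs) (map_names f ts) (f e) (f e') (map f cs') (map_prod f f ` b) (map_prod f f ` w)"
  by (induction rule: desc.induct) (auto simp: image_Un map_cyc intro: desc.intros)

lemma takes_map: "takes x t e t' \<Longrightarrow> takes x (map_strand f t) (f e) (map (map_strand f) t')"
  by (induction rule: takes.induct) (auto intro: takes.intros)

lemma step_map: "step x ts P Q \<Longrightarrow> step x (map_names f ts) (map_diagram f P) (map_diagram f Q)"
proof (induction rule: step.induct)
  case (step_fork j l u b w rs ss)
  show ?case by (auto simp: map_cyc image_Un intro!: step_forkI)
next
  case (step_close x cs ts e e' cs' b' w' t t' b w rs ss)
  show ?case unfolding map_diagram.simps
    by (rule step_closeI[OF step_close(1) desc_map[OF step_close(2)] takes_map[OF step_close(3)]])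
      (auto simp: image_Un)
qed

lemma runs_map: "runs w ts P Q \<Longrightarrow> runs w (map_names f ts) (map_diagram f P) (map_diagram f Q)"
  by (induction rule: runs.induct) (auto simp del: map_diagram.simps intro: runs.intros step_map)

text \<open>The strand to be taken is the first one capable of \<open>x\<close>, which depends on
  labels and not on names. With \<open>f\<close> and \<open>g\<close> the identity this serves
  determinism, with constant maps it compares stacks up to the names of their edges.\<close>

lemma split_unique:
  assumes "map (map_strand f) (map (One (opp x)) cs @ t # ss) =
      map (map_strand g) (map (One (opp x)) cs2 @ t2 # ss2)" "x \<noteq> A" "capable x t" "capable x t2"
  shows "map f cs = map g cs2 \<and> map_strand f t = map_strand g t2 \<and> map (map_strand f) ss = map (map_strand g) ss2"
  using assms
proof (induction cs arbitrary: cs2)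
  case Nil
  then show ?case by (cases cs2; cases t) auto
next
  case (Cons c cs)
  show ?case
  proof (cases cs2)
    case Nil
    then show ?thesis using Cons.prems by (cases t2) auto
  next
    case (Cons d ds)
    show ?thesis using Cons.IH[of ds] Cons.prems unfolding Cons by simp
  qed
qed

lemma desc_det:
  "desc cs ts e e1 cs1 b1 w1 \<Longrightarrow> desc cs ts e e2 cs2 b2 w2 \<Longrightarrow> e1 = e2 \<and> cs1 = cs2 \<and> b1 = b2 \<and> w1 = w2"
proof (induction arbitrary: e2 cs2 b2 w2 rule: desc.induct)
  case (desc_Nil e)
  then show ?case by (auto elim: desc.cases)
next
  case (desc_Cons cs ts e e' cs' b w c j l u)
  from desc_Cons.prems show ?case by cases (use desc_Cons.IH in blast)
qed

lemma step_det:
  assumes "step x ts P Q" "step x ts P Q'"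
  shows "Q = Q'"
  using assms(1)
proof cases
  case 1: (step_fork j l u b w rs ss)
  from assms(2) show ?thesis by cases (use 1 in auto)
next
  case 1: (step_close cs e e' cs' b' w' t t' b w rs ss)
  from assms(2) show ?thesis
  proof cases
    case step_fork
    then show ?thesis using 1 by simp
  next
    case 2: (step_close cs2 e2 e2' cs2' b2' w2' t2 t2' b2 w2 rs2 ss2)
    have "cs2 = cs \<and> t2 = t \<and> ss2 = ss"
      using split_unique[of "id" x cs2 t2 ss2 "id" cs t ss] 1 2 takes_capable[OF 1(5)] takes_capable[OF 2(5)]
      by (simp add: strand.map_id0)
    moreover from this have "e2 = e \<and> t2' = t'" using 1(5) 2(5) by (auto elim!: takes.cases)
    ultimately show ?thesis using desc_det[OF 1(4), of e2' cs2' b2' w2'] 1 2 by simp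
  qed
qed

text \<open>What is left of the stack when the names are erased; it already fixes the number of
  crossings that the next letter makes.\<close>

definition shape :: "'e diagram \<Rightarrow> unit strand list" where
  "shape P = map (map_strand (\<lambda>_. ())) (snd (snd (snd P)))"

lemma step_shape:
  assumes "step x ts P Q" "step x ts' P' Q'" "shape P = shape P'"
  shows "length ts = length ts' \<and> shape Q = shape Q'"
  using assms(1)
proof cases
  case 1: (step_fork j l u b w rs ss)
  from assms(2) show ?thesis by cases (use 1 assms(3) in \<open>auto simp: shape_def\<close>)
next
  case 1: (step_close cs e e' cs' b' w' t t' b w rs ss)
  from assms(2) show ?thesis
  proof cases
    case step_fork
    then show ?thesis using 1 by simp
  next
    case 2: (step_close cs2 e2 e2' cs2' b2' w2' t2 t2' b2 w2 rs2 ss2)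
    have *: "map (map_strand (\<lambda>_. ())) (map (One (opp x)) cs @ t # ss) = map (map_strand (\<lambda>_. ())) (map (One (opp x)) cs2 @ t2 # ss2)"
      using assms(3) unfolding shape_def 1(1) 2(1) by (simp add: comp_def)
    have "map (\<lambda>_. ()) cs = map (\<lambda>_. ()) cs2" and t: "map_strand (\<lambda>_. ()) t = map_strand (\<lambda>_. ()) t2"
      and ss: "map (map_strand (\<lambda>_. ())) ss = map (map_strand (\<lambda>_. ())) ss2" 
      using split_unique[OF * 1(3)] takes_capable[OF 1(5)] takes_capable[OF 2(5)] by auto
    then have l: "length cs = length cs2" by (metis length_map)
    have t': "map (map_strand (\<lambda>_. ())) t' = map (map_strand (\<lambda>_. ())) t2'"
      using t 1(5) 2(5) by (auto elim!: takes.cases)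
    have "length ts = length ts' \<and> length cs' = length cs2'"
      using desc_length[OF 1(4)] desc_length[OF 2(4)] l by simp
    then show ?thesis unfolding shape_def 1(2) 2(2) using ss t' by (simp add: comp_def map_replicate_const)
  qed
qed

lemma names_inj: "names ts = names ts' \<Longrightarrow> ts = ts'"
proof (induction ts arbitrary: ts')
  case Nil
  then show ?case by (cases ts') (auto simp: names_def)
next
  case (Cons t ts)
  then show ?case by (cases t; cases ts') (auto simp: names_def)
qed

lemma length_names: "length (names ts) = 3 * length ts"
  by (induction ts) auto

lemma names_map: "names (map_names f ts) = map f (names ts)"
  by (induction ts) auto

lemma runs_length:
  "runs w ts P Q \<Longrightarrow> runs w ts' P' Q' \<Longrightarrow> shape P = shape P' \<Longrightarrow> length ts = length ts'"
proof (induction arbitrary: ts' P' rule: runs.induct)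
  case runs_Nil
  then show ?case by (auto elim: runs.cases)
next
  case (runs_Cons x t P Q xs ts R)
  from runs_Cons.prems(1) obtain t2 ts2 Q2 where 2: "step x t2 P' Q2" "runs xs ts2 Q2 Q'" "ts' = t2 @ ts2"
    by (cases rule: runs.cases) auto
  from step_shape[OF runs_Cons.hyps(1) 2(1) runs_Cons.prems(2)] runs_Cons.IH[OF 2(2)] 2(3) show ?case by simp
qed

lemma runs_det: "runs w ts P Q \<Longrightarrow> runs w ts P Q' \<Longrightarrow> Q = Q'"
proof (induction arbitrary: Q' rule: runs.induct)
  case runs_Nil
  then show ?case by (auto elim: runs.cases)
next
  case (runs_Cons x t P Q xs ts R)
  from runs_Cons.prems(1) obtain t2 ts2 Q2 where 2: "step x t2 P Q2" "runs xs ts2 Q2 Q'" "t @ ts = t2 @ ts2"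
    by (cases rule: runs.cases) auto
  have "t = t2" "ts = ts2" using step_shape[OF runs_Cons.hyps(1) 2(1)] 2(3) by auto
  with 2 step_det[OF runs_Cons.hyps(1)] runs_Cons.IH show ?case by blast
qed

text \<open>Runs of one word use equally many triples, so the two name lists can be matched position
  by position. Mapping the first run along this matching gives a run with the names of the second,
  hence the second by determinism.\<close>

lemma runs_rename:
  assumes "runs w ts blank R" "runs w ts' blank R'" "distinct (names ts)" "distinct (names ts')"
  shows "\<exists>f. bij_betw f (set (names ts)) (set (names ts')) \<and> R' = map_diagram f R"
proof -
  have len: "length ts = length ts'" using runs_length[OF assms(1,2)] by (simp add: shape_def)
  then have len': "length (names ts) = length (names ts')" by (simp add: length_names)
  define f where "f x = the (map_of (zip (names ts) (names ts')) x)" for x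
  have f: "map f (names ts) = names ts'"
    by (rule nth_equalityI) (use len' assms(3) in \<open>auto simp: f_def map_of_zip_nth\<close>)
  then have "map_names f ts = ts'" by (intro names_inj) (simp add: names_map)
  with runs_map[OF assms(1), of f] have "runs w ts' blank (map_diagram f R)" by simp
  then have "R' = map_diagram f R" using runs_det[OF assms(2)] by blast
  moreover have "bij_betw f (set (names ts)) (set (names ts'))"
    using f assms(4) by (metis bij_betw_def distinct_map set_map)
  ultimately show ?thesis by blast
qed

section \<open>Promotion and evacuation of words\<close>

definition dominated :: "letter list \<Rightarrow> bool" where
  "dominated p \<longleftrightarrow> count_list p B \<le> count_list p A \<and> count_list p C \<le> count_list p A"

text \<open>Only those prefixes of \<open>p @ xs\<close> are tested that contain \<open>p\<close>.
  By the accumulator the tail of a word can be kept while letters in front of it are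
  permuted.\<close>

primrec ballot :: "letter list \<Rightarrow> letter list \<Rightarrow> bool" where
  "ballot p [] \<longleftrightarrow> dominated p"
| "ballot p (x # xs) \<longleftrightarrow> dominated p \<and> ballot (p @ [x]) xs"

lemma ballot_iff: "ballot p xs \<longleftrightarrow> (\<forall>k \<le> length xs. dominated (p @ take k xs))"
proof (induction xs arbitrary: p)
  case (Cons x xs)
  have "(\<forall>k \<le> length (x # xs). dominated (p @ take k (x # xs))) \<longleftrightarrow>
      dominated p \<and> (\<forall>k \<le> length xs. dominated (p @ take (Suc k) (x # xs)))"
    unfolding less_Suc_eq_le[symmetric] by (simp add: All_less_Suc2)
  then show ?case using Cons by simp
qed auto

lemma ballot_append: "ballot p (xs @ ys) \<longleftrightarrow> ballot p xs \<and> ballot (p @ xs) ys"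
proof (induction xs arbitrary: p)
  case Nil
  then show ?case by (cases ys) auto
qed auto

lemma ballot_cong:
  "count_list p A = count_list q A \<Longrightarrow> count_list p B = count_list q B \<Longrightarrow> count_list p C = count_list q C \<Longrightarrow>
    ballot p xs = ballot q xs"
proof (induction xs arbitrary: p q)
  case (Cons x xs)
  from Cons.IH[of "p @ [x]" "q @ [x]"] Cons.prems show ?case by (auto simp: dominated_def)
qed (auto simp: dominated_def)

lemma kreweras_word_iff:
  "kreweras_word n w \<longleftrightarrow> length w = 3 * n \<and> count_list w A = n \<and> count_list w B = n \<and> count_list w C = n \<and>
    ballot [] w"
  by (auto simp: kreweras_word_def ballot_iff dominated_def)

section \<open>Sweeps of adjacent swaps as slides\<close>

lemma swap_at_append: "swap_at (Suc (length p)) (p @ v # x # r) = p @ x # v # r"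
  by (simp add: swap_at_def letter_at_def nth_append list_update_append)

text \<open>An exchange of neighbours changes the content of one prefix only, the one that ends
  between them.\<close>

lemma kreweras_word_swap:
  assumes "kreweras_word n (p @ v # x # r)"
  shows "kreweras_word n (p @ x # v # r) \<longleftrightarrow> dominated (p @ [x])"
proof -
  have "ballot (p @ [x, v]) r = ballot (p @ [v, x]) r" by (rule ballot_cong) auto
  moreover have "ballot [] (p @ y # z # r) \<longleftrightarrow> ballot [] p \<and> dominated p \<and> dominated (p @ [y]) \<and> ballot (p @ [y, z]) r" for y z
    by (simp add: ballot_append)
  moreover have "count_list (p @ x # v # r) y = count_list (p @ v # x # r) y" for y by simp
  moreover have "length (p @ x # v # r) = length (p @ v # x # r)" by simp
  ultimately show ?thesis using assms unfolding kreweras_word_iff by metis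
qed

text \<open>The carried letter \<open>v\<close> moves right as long as swaps are allowed. A refused
  swap means that \<open>p @ [x]\<close> violates the prefix condition while \<open>p\<close> and
  \<open>p @ [v, x]\<close> satisfy it; so \<open>v\<close> is \<open>A\<close>, and
  \<open>x\<close> is another letter that occurs in \<open>p\<close> as often as \<open>A\<close>.
  Then \<open>v\<close> stays in place and \<open>x\<close> is carried on, which is the rule of
  \<open>slide\<close>. The tail \<open>z\<close> is out of reach of this sweep.\<close>

lemma tau_sweep_slide:
  assumes "kreweras_word n (p @ v # xs @ z)" "slide p v xs = (p', v')"
  shows "fold (tau n) [Suc (length p)..<Suc (length p + length xs)] (p @ v # xs @ z) = p' @ v' # z \<and>
    kreweras_word n (p' @ v' # z)"
  using assms
proof (induction xs arbitrary: p v)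
  case (Cons x xs)
  have tau: "tau n (Suc (length p)) (p @ v # x # xs @ z) =
      (if dominated (p @ [x]) then p @ x # v # xs @ z else p @ v # x # xs @ z)"
    using kreweras_word_swap[of n p v x "xs @ z"] Cons.prems by (simp add: tau_def swap_at_append)
  have dom: "dominated p" "dominated (p @ [v])" "dominated (p @ [v, x])"
    using Cons.prems(1) by (cases "xs @ z"; auto simp: kreweras_word_iff ballot_append)+
  have upt: "[Suc (length p)..<Suc (length p + length (x # xs))] =
      Suc (length p) # [Suc (length (p @ [y]))..<Suc (length (p @ [y]) + length xs)]" for y :: letter
    by (simp add: upt_rec[of "Suc (length p)"] del: upt_Suc)
  show ?case
  proof (cases "v = A \<and> x \<noteq> A \<and> count_list p x = count_list p A")
    case True
    then have "\<not> dominated (p @ [x])" by (cases x) (auto simp: dominated_def)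
    then show ?thesis
      using Cons.IH[of "p @ [A]" x] Cons.prems True tau unfolding upt[of A] by simp
  next
    case False
    then have x: "dominated (p @ [x])" using dom by (cases x; cases v) (auto simp: dominated_def)
    moreover have "kreweras_word n (p @ x # v # xs @ z)"
      using kreweras_word_swap[of n p v x "xs @ z"] Cons.prems x by simp
    moreover have "slide (p @ [x]) v xs = (p', v')" using False Cons.prems(2) by (auto split: if_splits)
    ultimately show ?thesis
      using Cons.IH[of "p @ [x]" v] tau unfolding upt[of x] by simp
  qed
qed simp

lemma tau_sweep_fold: "tau_sweep n k = fold (tau n) [Suc 0..<Suc k]"
  by (induction k) (auto simp: fun_eq_iff)

lemma kreweras_word_hd:
  assumes "kreweras_word n (a # xs)"
  shows "a = A"
  using assms by (cases a; cases xs) (auto simp: kreweras_word_iff dominated_def)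

lemma tau_sweep_word:
  assumes "kreweras_word n (a # xs @ z)" "slide [] A xs = (p, v)"
  shows "tau_sweep n (length xs) (a # xs @ z) = p @ v # z" "kreweras_word n (p @ v # z)"
  using tau_sweep_slide[of n "[]" a xs z p v] kreweras_word_hd[OF assms(1)] assms
  by (simp_all add: tau_sweep_fold)

text \<open>Each sweep settles the last letter of its window, and the next sweep has a window
  shorter by one; the settled letters collect in \<open>z\<close>.\<close>

lemma tau_sweeps_evacuate:
  assumes "kreweras_word n (u @ z)" "length u = Suc k"
  shows "tau_sweeps n k (u @ z) = evacuate u @ z \<and> kreweras_word n (evacuate u @ z)"
  using assms
proof (induction k arbitrary: u z)
  case 0
  then obtain a where "u = [a]" by (cases u) auto
  then show ?case using 0 kreweras_word_hd[of n a z] by simp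
next
  case (Suc k)
  then obtain a xs where u: "u = a # xs" "length xs = Suc k" by (cases u) auto
  obtain p v where pv: "slide [] A xs = (p, v)" by fastforce
  have "tau_sweep n (Suc k) (u @ z) = p @ v # z" "kreweras_word n (p @ v # z)"
    using tau_sweep_word[of n a xs z p v] pv u Suc.prems(1) by auto
  moreover have "length p = Suc k" using slide_length[OF pv] u by simp
  ultimately show ?case using Suc.IH[of p "v # z"] u pv by simp
qed

section \<open>Promotion as a single slide\<close>

lemma slide_no_swap:
  assumes "\<And>ys x zs. xs = ys @ x # zs \<Longrightarrow> x \<noteq> A \<Longrightarrow> count_list (p @ ys) x \<noteq> count_list (p @ ys) A"
  shows "slide p A (xs @ rest) = slide (p @ xs) A rest"
  using assms
proof (induction xs arbitrary: p)
  case (Cons y xs)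
  have "y = A \<or> count_list p y \<noteq> count_list p A" using Cons.prems[of "[]" y xs] by auto
  moreover have "slide (p @ [y]) A (xs @ rest) = slide ((p @ [y]) @ xs) A rest"
  proof (rule Cons.IH)
    fix ys x zs assume "xs = ys @ x # zs" "x \<noteq> A"
    then show "count_list ((p @ [y]) @ ys) x \<noteq> count_list ((p @ [y]) @ ys) A"
      using Cons.prems[of "y # ys" x zs] by simp
  qed
  ultimately show ?case by auto
qed simp

lemma slide_swapped: "v \<noteq> A \<Longrightarrow> slide p v xs = (p @ xs, v)"
  by (induction xs arbitrary: p) auto

text \<open>With the initial \<open>A\<close> put back, the test of \<open>slide\<close> says that
  the prefix ending in \<open>x\<close> contains as many \<open>x\<close> as \<open>A\<close>, so
  the exchange happens at position \<open>iota w\<close>. Up to there the letters just move one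
  place to the left; then \<open>A\<close> is put down and \<open>x\<close> carried away, and a
  carried letter other than \<open>A\<close> is never exchanged again.\<close>

lemma pro_slide:
  assumes "kreweras_word n (a # xs)" "slide [] A xs = (p, v)"
  shows "pro (a # xs) = p @ [v]"
proof -
  define w where "w = a # xs"
  have a: "a = A" using kreweras_word_hd assms(1) by blast
  have kw: "kreweras_word n w" using assms(1) w_def by simp
  define hit where "hit i \<longleftrightarrow> 1 \<le> i \<and> (count_list (take i w) A = count_list (take i w) B \<or>
      count_list (take i w) A = count_list (take i w) C)" for i
  define i where "i = iota w"
  have i_Least: "i = (LEAST i. hit i)" by (simp add: i_def iota_def hit_def)
  have len: "length w = 3 * n" "n \<ge> 1" using kw w_def by (auto simp: kreweras_word_def)
  have "hit (length w)" using kw len by (simp add: hit_def kreweras_word_def)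
  then have hit_i: "hit i" and i_le: "i \<le> length w" unfolding i_Least by (auto intro: LeastI Least_le)
  have min: "\<not> hit k" if "k < i" for k using that not_less_Least unfolding i_Least by blast
  have dominated: "dominated (take k w)" if "k \<le> length w" for k
    using kw that by (simp add: kreweras_word_def dominated_def)
  have "\<not> hit 1" using a by (simp add: hit_def w_def)
  then have i2: "2 \<le> i" using hit_i by (metis One_nat_def Suc_1 hit_def not_less_eq_eq le_antisym)
  \<comment> \<open>\<open>m\<close> is the number of letters strictly between the initial
    \<open>A\<close> and position \<open>i\<close>, and thus the index in \<open>xs\<close> of the
    letter at position \<open>i\<close>.\<close>
  then obtain m where i: "i = Suc (Suc m)" by (metis add_2_eq_Suc le_Suc_ex)
  define ys where "ys = take m xs"
  define x where "x = xs ! m"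
  define zs where "zs = drop (Suc m) xs"
  have lx: "m < length xs" using i_le w_def i by simp
  have xs: "xs = ys @ x # zs" unfolding ys_def x_def zs_def
    by (rule id_take_nth_drop[OF lx])
  have take_k: "take (Suc k) w = A # take k xs" for k by (simp add: w_def a)
  have ti: "take i w = A # ys @ [x]"
    using take_k[of "Suc m"] lx unfolding ys_def x_def i by (simp add: take_Suc_conv_app_nth)
  have ti1: "take (i - 1) w = A # ys"
    using take_k[of m] unfolding ys_def i by simp
  have "dominated (A # ys)" "\<not> hit (i - 1)" using dominated[of "i - 1"] ti1 i_le min[of "i - 1"] i2 by auto
  then have x: "x \<noteq> A" "count_list ys x = count_list ys A"
    using hit_i ti ti1 i2 by (cases x; auto simp: hit_def dominated_def)+
  have "slide [] A (ys @ x # zs) = slide ([] @ ys) A (x # zs)"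
  proof (rule slide_no_swap)
    fix us y vs assume ys: "ys = us @ y # vs" and y: "y \<noteq> A"
    define k where "k = length us + 2"
    have "length ys = m" using lx by (simp add: ys_def)
    then have ki: "k < i" using ys i by (simp add: k_def)
    have "take k w = A # us @ [y]" unfolding k_def w_def xs ys a by simp
    then show "count_list ([] @ us) y \<noteq> count_list ([] @ us) A"
      using min[OF ki] y by (cases y) (auto simp: hit_def k_def)
  qed
  also have "\<dots> = (ys @ A # zs, x)" using x by (simp add: slide_swapped)
  finally have pv: "p = ys @ A # zs" "v = x" using assms(2) xs by auto
  have "pro w = take m xs @ [A] @ drop i w @ [letter_at w i]"
    using i by (simp add: pro_def i_def w_def)
  moreover have "drop i w = zs" by (simp add: w_def zs_def i)
  moreover have "letter_at w i = x" by (simp add: letter_at_def w_def x_def i)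
  ultimately show ?thesis using pv by (simp add: ys_def w_def)
qed

section \<open>Noncrossing matchings\<close>

text \<open>The state of bracket matching after \<open>k\<close> letters, with \<open>S\<close> the
  \<open>A\<close>'s still unmatched. No arc encloses an element of \<open>S\<close>, which keeps
  each of them open to a noncrossing arc; the last conjunct makes \<open>S\<close> nonempty whenever
  a letter \<open>x\<close> has to be matched.\<close>

definition partial_matching :: "letter list \<Rightarrow> letter \<Rightarrow> nat \<Rightarrow> arc set \<Rightarrow> nat set \<Rightarrow> bool" where
  "partial_matching w x k M S \<longleftrightarrow>
     (\<forall>(i, j) \<in> M. 1 \<le> i \<and> i < j \<and> j \<le> k \<and> letter_at w i = A \<and> letter_at w j = x) \<and>
     S \<subseteq> {i \<in> {1..k}. letter_at w i = A} \<and>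
     (\<forall>p \<in> {1..k}. letter_at w p \<in> {A, x} \<longrightarrow>
       (if p \<in> S then \<not> (\<exists>m \<in> M. p = fst m \<or> p = snd m) else \<exists>!m. m \<in> M \<and> (p = fst m \<or> p = snd m))) \<and>
     (\<forall>(i, j) \<in> M. \<forall>(k, l) \<in> M. \<not> (i < k \<and> k < j \<and> j < l)) \<and>
     (\<forall>(i, j) \<in> M. \<forall>s \<in> S. \<not> (i < s \<and> s < j)) \<and>
     card S + count_list (take k w) x = count_list (take k w) A"

lemma take_Suc_letter_at: "k < length w \<Longrightarrow> take (Suc k) w = take k w @ [letter_at w (Suc k)]"
  by (simp add: letter_at_def take_Suc_conv_app_nth)

lemma partial_matching_exists:
  assumes "x \<noteq> A" "\<And>k. k \<le> length w \<Longrightarrow> count_list (take k w) x \<le> count_list (take k w) A"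
  shows "k \<le> length w \<Longrightarrow> \<exists>M S. partial_matching w x k M S"
proof (induction k)
  case 0
  then show ?case by (intro exI[of _ "{}"]) (simp add: partial_matching_def)
next
  case (Suc k)
  then obtain M S where MS: "partial_matching w x k M S" by auto
  have arc: "1 \<le> i \<and> i < j \<and> j \<le> k \<and> letter_at w i = A \<and> letter_at w j = x" if "(i, j) \<in> M" for i j
    using MS that unfolding partial_matching_def by fast
  have S: "1 \<le> s \<and> s \<le> k \<and> letter_at w s = A" if "s \<in> S" for s
    using MS that unfolding partial_matching_def by auto
  have cov: "if p \<in> S then \<not> (\<exists>m \<in> M. p = fst m \<or> p = snd m) else \<exists>!m. m \<in> M \<and> (p = fst m \<or> p = snd m)"
    if "p \<in> {1..k}" "letter_at w p \<in> {A, x}" for p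
  proof -
    have "\<forall>p \<in> {1..k}. letter_at w p \<in> {A, x} \<longrightarrow>
      (if p \<in> S then \<not> (\<exists>m \<in> M. p = fst m \<or> p = snd m) else \<exists>!m. m \<in> M \<and> (p = fst m \<or> p = snd m))"
      using MS unfolding partial_matching_def by (elim conjE)
    from this[THEN bspec, THEN mp, OF that] show ?thesis .
  qed
  have open_pos: "p \<noteq> fst m \<and> p \<noteq> snd m" if "p \<in> S" "m \<in> M" for p m
    using cov[of p] S[of p] that by auto
  have matched: "\<exists>!m. m \<in> M \<and> (p = fst m \<or> p = snd m)"
    if "p \<in> {1..k}" "letter_at w p \<in> {A, x}" "p \<notin> S" for p
    using cov[of p] that by simp
  have nc: False if "(i, j) \<in> M" "(k, l) \<in> M" "i < k" "k < j" "j < l" for i j k l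
    using MS that unfolding partial_matching_def by fast
  have ncS: False if "(i, j) \<in> M" "s \<in> S" "i < s" "s < j" for i j s
    using MS that unfolding partial_matching_def by fast
  have card: "card S + count_list (take k w) x = count_list (take k w) A"
    using MS unfolding partial_matching_def by (elim conjE)
  have finS: "finite S" using S by (meson atLeastAtMost_iff finite_atLeastAtMost finite_subset subsetI)
  have fresh: "fst m \<noteq> Suc k \<and> snd m \<noteq> Suc k" if "m \<in> M" for m using arc[of "fst m" "snd m"] that by auto
  have take: "take (Suc k) w = take k w @ [letter_at w (Suc k)]" using Suc.prems by (simp add: take_Suc_letter_at)
  show ?case
  proof (cases "letter_at w (Suc k) = x")
    case True
    have "count_list (take (Suc k) w) x \<le> count_list (take (Suc k) w) A" using assms(2) Suc.prems by blast
    then have "card S > 0" using card take True assms(1) by simp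
    then have "S \<noteq> {}" by auto
    \<comment> \<open>The last open \<open>A\<close> is the right partner: the new arc then encloses
      no other open letter, and an older arc crossing it would have to enclose
      \<open>i\<close>.\<close>
    define i where "i = Max S"
    have iS: "i \<in> S" unfolding i_def using finS \<open>S \<noteq> {}\<close> by simp
    have i_max: "s \<le> i" if "s \<in> S" for s unfolding i_def using finS that by simp
    have "partial_matching w x (Suc k) (insert (i, Suc k) M) (S - {i})"
      unfolding partial_matching_def
    proof (intro conjI)
      show "\<forall>(i, j) \<in> insert (i, Suc k) M. 1 \<le> i \<and> i < j \<and> j \<le> Suc k \<and> letter_at w i = A \<and> letter_at w j = x"
        using arc S[OF iS] True by fastforce
      show "S - {i} \<subseteq> {i \<in> {1..Suc k}. letter_at w i = A}" using S by fastforce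
      show "\<forall>p \<in> {1..Suc k}. letter_at w p \<in> {A, x} \<longrightarrow>
       (if p \<in> S - {i} then \<not> (\<exists>m \<in> insert (i, Suc k) M. p = fst m \<or> p = snd m)
        else \<exists>!m. m \<in> insert (i, Suc k) M \<and> (p = fst m \<or> p = snd m))"
      proof (intro ballI impI)
        fix p assume p: "p \<in> {1..Suc k}" "letter_at w p \<in> {A, x}"
        show "if p \<in> S - {i} then \<not> (\<exists>m \<in> insert (i, Suc k) M. p = fst m \<or> p = snd m)
          else \<exists>!m. m \<in> insert (i, Suc k) M \<and> (p = fst m \<or> p = snd m)"
        proof (cases "p \<in> S - {i}")
          case True
          have "p \<noteq> fst m \<and> p \<noteq> snd m" if "m \<in> insert (i, Suc k) M" for m
            using True that open_pos[of p m] S[of p] by auto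
          then show ?thesis using True by (simp only: if_True) blast
        next
          case False
          show ?thesis
          proof (cases "p = i \<or> p = Suc k")
            case True
            have "m = (i, Suc k)" if "m \<in> insert (i, Suc k) M" "p = fst m \<or> p = snd m" for m
              using True that open_pos[OF iS, of m] fresh[of m] by auto
            moreover have "p = fst (i, Suc k) \<or> p = snd (i, Suc k)" using True by simp
            ultimately have "\<exists>!m. m \<in> insert (i, Suc k) M \<and> (p = fst m \<or> p = snd m)"
              by (intro ex1I[of _ "(i, Suc k)"]) blast+
            then show ?thesis using False by (simp only: if_False)
          next
            case n: False
            then have "\<exists>!m. m \<in> M \<and> (p = fst m \<or> p = snd m)" using matched[of p] p False by (auto simp: le_Suc_eq)
            moreover have "m \<in> insert (i, Suc k) M \<and> (p = fst m \<or> p = snd m) \<longleftrightarrow> m \<in> M \<and> (p = fst m \<or> p = snd m)" for m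
              using n by auto
            ultimately show ?thesis using False by (simp only: if_False)
          qed
        qed
      qed
      show "\<forall>(a, b) \<in> insert (i, Suc k) M. \<forall>(c, d) \<in> insert (i, Suc k) M. \<not> (a < c \<and> c < b \<and> b < d)"
      proof -
        have False if "(a, b) \<in> insert (i, Suc k) M" "(c, d) \<in> insert (i, Suc k) M" "a < c" "c < b" "b < d" for a b c d
          using that nc[of a b c d] arc[of a b] arc[of c d] ncS[of a b i] iS by auto
        then show ?thesis by blast
      qed
      show "\<forall>(i', j) \<in> insert (i, Suc k) M. \<forall>s \<in> S - {i}. \<not> (i' < s \<and> s < j)"
        using ncS i_max by fastforce
      have "card (S - {i}) + 1 = card S" using iS finS by (simp add: card_gt_0_iff) (metis \<open>0 < card S\<close> Suc_pred)
      then show "card (S - {i}) + count_list (take (Suc k) w) x = count_list (take (Suc k) w) A"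
        using card take True assms(1) by simp
    qed
    then show ?thesis by blast
  next
    case False
    define S' where "S' = S \<union> {p. p = Suc k \<and> letter_at w p = A}"
    have "partial_matching w x (Suc k) M S'"
      unfolding partial_matching_def
    proof (intro conjI)
      show "\<forall>(i, j) \<in> M. 1 \<le> i \<and> i < j \<and> j \<le> Suc k \<and> letter_at w i = A \<and> letter_at w j = x"
        using arc by fastforce
      show "S' \<subseteq> {i \<in> {1..Suc k}. letter_at w i = A}" using S unfolding S'_def by fastforce
      show "\<forall>p \<in> {1..Suc k}. letter_at w p \<in> {A, x} \<longrightarrow>
       (if p \<in> S' then \<not> (\<exists>m \<in> M. p = fst m \<or> p = snd m) else \<exists>!m. m \<in> M \<and> (p = fst m \<or> p = snd m))"
      proof (intro ballI impI)
        fix p assume p: "p \<in> {1..Suc k}" "letter_at w p \<in> {A, x}"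
        show "if p \<in> S' then \<not> (\<exists>m \<in> M. p = fst m \<or> p = snd m) else \<exists>!m. m \<in> M \<and> (p = fst m \<or> p = snd m)"
        proof (cases "p \<in> S'")
          case True
          have "p \<noteq> fst m \<and> p \<noteq> snd m" if "m \<in> M" for m
            using True fresh[OF that] open_pos[OF _ that, of p] unfolding S'_def by auto
          then show ?thesis using True by (simp only: if_True) blast
        next
          case notin: False
          then have in_k: "p \<in> {1..k}" "p \<notin> S" using p False unfolding S'_def by (auto simp: le_Suc_eq)
          then show ?thesis using matched[OF in_k(1) p(2) in_k(2)] notin by (simp only: if_False)
        qed
      qed
      show "\<forall>(i, j) \<in> M. \<forall>(k, l) \<in> M. \<not> (i < k \<and> k < j \<and> j < l)" using nc by blast
      show "\<forall>(i, j) \<in> M. \<forall>s \<in> S'. \<not> (i < s \<and> s < j)" using ncS arc unfolding S'_def by fastforce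
      have "Suc k \<notin> S" using S[of "Suc k"] by auto
      moreover have "S' = (if letter_at w (Suc k) = A then insert (Suc k) S else S)" unfolding S'_def by auto
      ultimately show "card S' + count_list (take (Suc k) w) x = count_list (take (Suc k) w) A"
        using card finS take False assms(1) by simp
    qed
    then show ?thesis by blast
  qed
qed

lemma noncrossing_matchingD:
  assumes "noncrossing_matching w x M"
  shows "(i, j) \<in> M \<Longrightarrow> 1 \<le> i \<and> i < j \<and> j \<le> length w \<and> letter_at w i = A \<and> letter_at w j = x"
    "1 \<le> k \<Longrightarrow> k \<le> length w \<Longrightarrow> letter_at w k = A \<or> letter_at w k = x \<Longrightarrow>
      \<exists>!m. m \<in> M \<and> (k = fst m \<or> k = snd m)"
    "(i, j) \<in> M \<Longrightarrow> (k, l) \<in> M \<Longrightarrow> i < k \<Longrightarrow> k < j \<Longrightarrow> j < l \<Longrightarrow> False"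
proof -
  have D: "\<forall>(i, j) \<in> M. 1 \<le> i \<and> i < j \<and> j \<le> length w \<and> letter_at w i = A \<and> letter_at w j = x"
    "\<forall>k \<in> {1..length w}. letter_at w k \<in> {A, x} \<longrightarrow> (\<exists>!m. m \<in> M \<and> (k = fst m \<or> k = snd m))"
    "\<forall>(i, j) \<in> M. \<forall>(k, l) \<in> M. \<not> (i < k \<and> k < j \<and> j < l)"
    using assms unfolding noncrossing_matching_def by - (elim conjE; assumption)+
  show "\<exists>!m. m \<in> M \<and> (k = fst m \<or> k = snd m)"
    if "1 \<le> k" "k \<le> length w" "letter_at w k = A \<or> letter_at w k = x"
    using D(2)[THEN bspec, THEN mp, of k] that by simp
  show "(i, j) \<in> M \<Longrightarrow> 1 \<le> i \<and> i < j \<and> j \<le> length w \<and> letter_at w i = A \<and> letter_at w j = x" using D(1) by fast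
  show "(i, j) \<in> M \<Longrightarrow> (k, l) \<in> M \<Longrightarrow> i < k \<Longrightarrow> k < j \<Longrightarrow> j < l \<Longrightarrow> False" using D(3) by fast
qed

text \<open>Induction on the length of the arc. Suppose that \<open>M'\<close> joins
  \<open>j\<close> to \<open>i'\<close> instead of \<open>i\<close>. If \<open>i' > i\<close>, the
  arc of \<open>M\<close> from \<open>i'\<close> is shorter, hence in \<open>M'\<close>, and gives
  \<open>i'\<close> two partners there. If \<open>i' < i\<close>, the partner \<open>l\<close> of
  \<open>i\<close> in \<open>M'\<close> lies before \<open>j\<close>, and the arc of
  \<open>M\<close> ending in \<open>l\<close> is shorter, hence in \<open>M'\<close>; it must start
  in \<open>i\<close>, which then has two partners in \<open>M\<close>.\<close>

lemma noncrossing_matching_subset: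
  assumes x: "x \<noteq> A" and M: "noncrossing_matching w x M" and M': "noncrossing_matching w x M'"
  shows "(i, j) \<in> M \<Longrightarrow> (i, j) \<in> M'"
proof (induction "j - i" arbitrary: i j rule: less_induct)
  case less
  note arc = noncrossing_matchingD(1) and cov = noncrossing_matchingD(2) and nc = noncrossing_matchingD(3)
  have to: "\<exists>i. (i, j) \<in> N" if "1 \<le> j" "j \<le> length w" "letter_at w j = x" "noncrossing_matching w x N" for j N
  proof -
    note h = that
    obtain m where m: "m \<in> N" "j = fst m \<or> j = snd m" using cov[OF h(4,1,2)] h(3) by blast
    then have "j \<noteq> fst m" using arc[OF h(4), of "fst m" "snd m"] h x by auto
    then show ?thesis using m by (metis prod.collapse)
  qed
  have from': "\<exists>j. (i, j) \<in> N" if "1 \<le> i" "i \<le> length w" "letter_at w i = A" "noncrossing_matching w x N" for i N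
  proof -
    note h = that
    obtain m where m: "m \<in> N" "i = fst m \<or> i = snd m" using cov[OF h(4,1,2)] h(3) by blast
    then have "i \<noteq> snd m" using arc[OF h(4), of "fst m" "snd m"] h x by auto
    then show ?thesis using m by (metis prod.collapse)
  qed
  have uniq1: "j = j'" if "(i, j) \<in> N" "(i, j') \<in> N" "noncrossing_matching w x N" for i j j' N
  proof -
    have "\<exists>!m. m \<in> N \<and> (i = fst m \<or> i = snd m)" by (rule cov[OF that(3)]) (use arc[OF that(3,1)] in auto)
    then have "(i, j) = (i, j')" using that(1,2) by (metis fst_conv)
    then show ?thesis by simp
  qed
  have uniq2: "i = i'" if "(i, j) \<in> N" "(i', j) \<in> N" "noncrossing_matching w x N" for i i' j N
  proof -
    have "\<exists>!m. m \<in> N \<and> (j = fst m \<or> j = snd m)" by (rule cov[OF that(3)]) (use arc[OF that(3,1)] in auto)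
    then have "(i, j) = (i', j)" using that(1,2) by (metis snd_conv)
    then show ?thesis by simp
  qed
  note ij = arc[OF M less.prems]
  obtain i' where i': "(i', j) \<in> M'" using to[of j M'] ij M' by auto
  note ij' = arc[OF M' i']
  consider "i' = i" | "i < i'" | "i' < i" by linarith
  then show ?case
  proof cases
    case 1
    then show ?thesis using i' by simp
  next
    case 2
    obtain l where l: "(i', l) \<in> M" using from'[of i' M] ij' M by auto
    have "l \<le> j" using nc[OF M less.prems l] 2 ij' by (meson not_le)
    moreover have "l \<noteq> j" using uniq2[OF less.prems, of i'] l 2 M by auto
    ultimately have "(i', l) \<in> M'" using less.hyps[of l i'] l 2 ij' by auto
    then show ?thesis using uniq1[OF i'] \<open>l \<noteq> j\<close> M' by blast
  next
    case 3
    obtain l where l: "(i, l) \<in> M'" using from'[of i M'] ij M' by auto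
    have "l \<le> j" using nc[OF M' i' l] 3 ij by (meson not_le)
    moreover have "l \<noteq> j" using uniq2[OF i', of i] l 3 M' by auto
    ultimately have lj: "l < j" by simp
    obtain k where k: "(k, l) \<in> M" using to[of l M] arc[OF M' l] M by auto
    have "i \<le> k" using nc[OF M k less.prems] lj arc[OF M' l] by (meson not_le)
    then have "l - k < j - i" using lj arc[OF M k] by linarith
    then have "(k, l) \<in> M'" using less.hyps k by blast
    then have "k = i" using uniq2[OF l _ M'] by auto
    then show ?thesis using uniq1[OF k[unfolded \<open>k = i\<close>] less.prems M] lj by simp
  qed
qed

lemma noncrossing_matching_matching:
  assumes "kreweras_word n w" "x \<noteq> A"
  shows "noncrossing_matching w x (matching w x)"
proof -
  have le: "count_list (take k w) x \<le> count_list (take k w) A" if "k \<le> length w" for k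
    using assms that by (cases x) (auto simp: kreweras_word_def)
  obtain M S where MS: "partial_matching w x (length w) M S"
    using partial_matching_exists[OF assms(2) le] by blast
  have "count_list w x = count_list w A" using assms by (cases x) (auto simp: kreweras_word_def)
  then have "card S = 0" using MS by (simp add: partial_matching_def)
  moreover have "finite S" using MS unfolding partial_matching_def by (metis (no_types, lifting) finite_atLeastAtMost finite_subset mem_Collect_eq subsetI)
  ultimately have "S = {}" by simp
  then have "noncrossing_matching w x M" using MS by (simp add: partial_matching_def noncrossing_matching_def)
  then have "\<exists>!M. noncrossing_matching w x M"
    using noncrossing_matching_subset[OF assms(2)] by (metis subrelI subset_antisym)
  then show ?thesis unfolding matching_def by (rule theI')
qed

section \<open>The order of the meeting points along an arc\<close>

definition label :: "letter list \<Rightarrow> arc \<Rightarrow> letter" where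
  "label w \<alpha> = letter_at w (snd \<alpha>)"

definition touches :: "arc \<Rightarrow> arc \<Rightarrow> bool" where
  "touches \<alpha> \<beta> \<longleftrightarrow> crosses \<alpha> \<beta> \<or> crosses \<beta> \<alpha>"

definition meet :: "arc \<Rightarrow> arc \<Rightarrow> complex" where
  "meet \<alpha> \<beta> = (THE z. z \<in> curve \<alpha> \<inter> curve \<beta>)"

text \<open>The endpoint of \<open>\<beta>\<close> that lies under \<open>\<alpha>\<close>: it orders the meeting points along \<open>\<alpha>\<close>.\<close>

definition key :: "arc \<Rightarrow> arc \<Rightarrow> nat" where
  "key \<alpha> \<beta> = (if fst \<beta> < fst \<alpha> then snd \<beta> else fst \<beta>)"

lemma touches_sym: "touches \<alpha> \<beta> \<longleftrightarrow> touches \<beta> \<alpha>" by (auto simp: touches_def)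

lemma meet_sym: "meet \<alpha> \<beta> = meet \<beta> \<alpha>" by (simp add: meet_def Int_commute)

lemma key_bounds: "touches \<alpha> \<beta> \<Longrightarrow> fst \<alpha> \<le> key \<alpha> \<beta> \<and> key \<alpha> \<beta> < snd \<alpha>"
  by (auto simp: touches_def crosses_def key_def)

lemma curve_eq:
  assumes "fst \<alpha> < snd \<alpha>" "z \<in> curve \<alpha>"
  shows "(Re z)\<^sup>2 + (Im z)\<^sup>2 = (real (fst \<alpha>) + real (snd \<alpha>)) * Re z - real (fst \<alpha>) * real (snd \<alpha>)" "0 \<le> Im z"
  using assms curve_iff[of "fst \<alpha>" "snd \<alpha>" z] by simp_all

lemma curve_height:
  assumes "fst \<alpha> < snd \<alpha>" "z \<in> curve \<alpha>"
  shows "(Re z - real (fst \<alpha>)) * (real (snd \<alpha>) - Re z) = (Im z)\<^sup>2"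
  using curve_eq(1)[OF assms] by (simp add: power2_eq_square algebra_simps)

lemma curve_bounds:
  assumes "fst \<alpha> < snd \<alpha>" "z \<in> curve \<alpha>"
  shows "real (fst \<alpha>) \<le> Re z" "Re z \<le> real (snd \<alpha>)"
proof -
  have "(Re z - real (fst \<alpha>)) * (real (snd \<alpha>) - Re z) \<ge> 0" using curve_height[OF assms] by simp
  then show "real (fst \<alpha>) \<le> Re z" "Re z \<le> real (snd \<alpha>)" using assms(1) by (auto simp: zero_le_mult_iff)
qed

lemma curve_endpoints:
  assumes "fst \<alpha> < snd \<alpha>"
  shows "of_nat (fst \<alpha>) \<in> curve \<alpha>" "of_nat (snd \<alpha>) \<in> curve \<alpha>"
  using assms curve_iff[of "fst \<alpha>" "snd \<alpha>"] by (simp_all add: power2_eq_square algebra_simps)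

lemma curve_eqI:
  assumes "fst \<alpha> < snd \<alpha>" "z \<in> curve \<alpha>" "z' \<in> curve \<alpha>" "Re z = Re z'"
  shows "z = z'"
proof -
  have "(Im z)\<^sup>2 = (Im z')\<^sup>2" using curve_height[OF assms(1,2)] curve_height[OF assms(1,3)] assms(4) by simp
  then have "Im z = Im z'"
    by (rule power2_eq_imp_eq[OF _ curve_eq(2)[OF assms(1,2)] curve_eq(2)[OF assms(1,3)]])
  with assms(4) show ?thesis by (simp add: complex_eq_iff)
qed

lemma curve_Im_0:
  assumes "fst \<alpha> < snd \<alpha>" "z \<in> curve \<alpha>"
  shows "Im z = 0 \<longleftrightarrow> Re z = real (fst \<alpha>) \<or> Re z = real (snd \<alpha>)"
  using curve_height[OF assms] by (auto simp: power2_eq_square)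

lemma curve_of_nat:
  assumes "fst \<alpha> < snd \<alpha>" "of_nat p \<in> curve \<alpha>"
  shows "p = fst \<alpha> \<or> p = snd \<alpha>"
  using curve_Im_0[OF assms] by simp

text \<open>A point of a semicircle lies strictly inside every semicircle that encloses it.\<close>

lemma curve_inside:
  assumes "fst \<beta> < fst \<alpha>" "fst \<alpha> < snd \<alpha>" "snd \<alpha> < snd \<beta>" "z \<in> curve \<alpha>"
  shows "(Re z)\<^sup>2 + (Im z)\<^sup>2 < (real (fst \<beta>) + real (snd \<beta>)) * Re z - real (fst \<beta>) * real (snd \<beta>)"
proof -
  note b = curve_bounds[OF assms(2,4)]
  have "(Im z)\<^sup>2 = (Re z - real (fst \<alpha>)) * (real (snd \<alpha>) - Re z)" using curve_height[OF assms(2,4)] by simp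
  also have "\<dots> \<le> (Re z - real (fst \<alpha>)) * (real (snd \<beta>) - Re z)"
    using b assms by (intro mult_left_mono) auto
  also have "\<dots> < (Re z - real (fst \<beta>)) * (real (snd \<beta>) - Re z)"
    using b assms by (intro mult_strict_right_mono) auto
  finally show ?thesis by (simp add: power2_eq_square algebra_simps)
qed

locale bump_diagram =
  fixes n :: nat and w :: "letter list"
  assumes kreweras: "kreweras_word n w"
begin

lemma matching: "x \<noteq> A \<Longrightarrow> noncrossing_matching w x (matching w x)"
  using noncrossing_matching_matching kreweras by blast

lemmas matching_arc = noncrossing_matchingD(1)[OF matching]
lemmas matching_cover = noncrossing_matchingD(2)[OF matching]

lemma arcs_iff: "\<alpha> \<in> arcs w \<longleftrightarrow> label w \<alpha> \<noteq> A \<and> \<alpha> \<in> matching w (label w \<alpha>)"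
  using matching_arc[of B "fst \<alpha>" "snd \<alpha>"] matching_arc[of C "fst \<alpha>" "snd \<alpha>"]
  by (cases "label w \<alpha>") (auto simp: arcs_def label_def)

lemma arc:
  assumes "\<alpha> \<in> arcs w"
  shows "1 \<le> fst \<alpha>" "fst \<alpha> < snd \<alpha>" "snd \<alpha> \<le> length w" "letter_at w (fst \<alpha>) = A"
    "letter_at w (snd \<alpha>) = label w \<alpha>" "label w \<alpha> \<noteq> A"
  using assms matching_arc[of "label w \<alpha>" "fst \<alpha>" "snd \<alpha>"] unfolding arcs_iff by (auto simp: label_def)

lemma matching_in_arcs: "x \<noteq> A \<Longrightarrow> \<alpha> \<in> matching w x \<Longrightarrow> \<alpha> \<in> arcs w \<and> label w \<alpha> = x"
  using matching_arc[of x "fst \<alpha>" "snd \<alpha>"] by (simp add: arcs_iff label_def)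

lemma arc_from:
  assumes "x \<noteq> A" "1 \<le> a" "a \<le> length w" "letter_at w a = A"
  obtains \<alpha> where "\<alpha> \<in> arcs w" "fst \<alpha> = a" "label w \<alpha> = x"
proof -
  obtain m where m: "m \<in> matching w x" "a = fst m \<or> a = snd m" using matching_cover[OF assms(1-3)] assms(4) by blast
  note h = matching_in_arcs[OF assms(1) m(1)]
  then have "a \<noteq> snd m" using arc(5,6)[of m] assms(4) by auto
  then show ?thesis using that h m(2) by blast
qed

lemma arc_to:
  assumes "1 \<le> b" "b \<le> length w" "letter_at w b \<noteq> A"
  obtains \<alpha> where "\<alpha> \<in> arcs w" "snd \<alpha> = b"
proof -
  obtain m where m: "m \<in> matching w (letter_at w b)" "b = fst m \<or> b = snd m"
    using matching_cover[OF assms(3,1,2)] by blast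
  note h = matching_in_arcs[OF assms(3) m(1)]
  then have "b \<noteq> fst m" using arc(4)[of m] assms(3) by auto
  then show ?thesis using that h m(2) by blast
qed

lemma arc_eq_fst:
  assumes "\<alpha> \<in> arcs w" "\<beta> \<in> arcs w" "label w \<alpha> = label w \<beta>" "fst \<alpha> = fst \<beta>"
  shows "\<alpha> = \<beta>"
proof -
  have "fst \<alpha> \<le> length w" using arc[OF assms(1)] by linarith
  with matching_cover[OF arc(6)[OF assms(1)] arc(1)[OF assms(1)]] arc(4)[OF assms(1)]
  show ?thesis using assms unfolding arcs_iff by metis
qed

lemma arc_eq_snd:
  assumes "\<alpha> \<in> arcs w" "\<beta> \<in> arcs w" "snd \<alpha> = snd \<beta>"
  shows "\<alpha> = \<beta>"
proof -
  have l: "label w \<alpha> = label w \<beta>" using assms by (simp add: label_def)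
  have "1 \<le> snd \<alpha>" using arc[OF assms(1)] by linarith
  with matching_cover[OF arc(6)[OF assms(1)] _ arc(3)[OF assms(1)]] arc(5)[OF assms(1)]
  show ?thesis using assms l unfolding arcs_iff by metis
qed

lemma fst_neq_snd: "\<alpha> \<in> arcs w \<Longrightarrow> \<beta> \<in> arcs w \<Longrightarrow> fst \<alpha> \<noteq> snd \<beta>"
  using arc(4)[of \<alpha>] arc(5,6)[of \<beta>] by auto

lemma same_label_noncrossing:
  assumes "\<alpha> \<in> arcs w" "\<beta> \<in> arcs w" "label w \<alpha> = label w \<beta>"
  shows "\<not> crosses \<alpha> \<beta>"
proof
  assume c: "crosses \<alpha> \<beta>"
  have "\<alpha> \<in> matching w (label w \<alpha>)" "\<beta> \<in> matching w (label w \<alpha>)" using assms unfolding arcs_iff by auto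
  then have "\<not> (fst \<alpha> < fst \<beta> \<and> fst \<beta> < snd \<alpha> \<and> snd \<alpha> < snd \<beta>)"
    using noncrossing_matchingD(3)[OF matching[OF arc(6)[OF assms(1)]]] by (metis prod.collapse)
  then have "fst \<alpha> = fst \<beta>" using c by (auto simp: crosses_def)
  then have "\<alpha> = \<beta>" using arc_eq_fst assms by blast
  then show False using c by (simp add: crosses_def)
qed

lemma touches_label:
  assumes "\<alpha> \<in> arcs w" "\<beta> \<in> arcs w" "touches \<alpha> \<beta>"
  shows "label w \<beta> = opp (label w \<alpha>)"
proof (rule neq_opp)
  show "label w \<beta> \<noteq> label w \<alpha>"
    using same_label_noncrossing[of \<alpha> \<beta>] same_label_noncrossing[of \<beta> \<alpha>] assms by (auto simp: touches_def)
qed (use arc(6) assms in auto)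

lemma curves_touch:
  assumes "\<alpha> \<in> arcs w" "\<beta> \<in> arcs w" "\<alpha> \<noteq> \<beta>"
  shows "(\<exists>z. z \<in> curve \<alpha> \<inter> curve \<beta>) \<longleftrightarrow> touches \<alpha> \<beta>"
    and "z \<in> curve \<alpha> \<inter> curve \<beta> \<Longrightarrow> z' \<in> curve \<alpha> \<inter> curve \<beta> \<Longrightarrow> z = z'"
proof -
  have "snd \<alpha> \<noteq> snd \<beta>" using arc_eq_snd assms by blast
  note h = arc(2)[OF assms(1)] arc(2)[OF assms(2)] fst_neq_snd[OF assms(2,1), symmetric]
    fst_neq_snd[OF assms(1,2), symmetric] this
  show "(\<exists>z. z \<in> curve \<alpha> \<inter> curve \<beta>) \<longleftrightarrow> touches \<alpha> \<beta>" using curves_meet(1)[OF h] by (simp add: touches_def)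
  show "z \<in> curve \<alpha> \<inter> curve \<beta> \<Longrightarrow> z' \<in> curve \<alpha> \<inter> curve \<beta> \<Longrightarrow> z = z'" by (rule curves_meet(2)[OF h])
qed

lemma touches_irrefl: "\<not> touches \<alpha> \<alpha>" by (simp add: touches_def crosses_def)

lemma meet_in:
  assumes "\<alpha> \<in> arcs w" "\<beta> \<in> arcs w" "touches \<alpha> \<beta>"
  shows "meet \<alpha> \<beta> \<in> curve \<alpha>" "meet \<alpha> \<beta> \<in> curve \<beta>"
proof -
  have ne: "\<alpha> \<noteq> \<beta>" using assms(3) touches_irrefl by blast
  then obtain z where "z \<in> curve \<alpha> \<inter> curve \<beta>" using curves_touch(1)[OF assms(1,2)] assms(3) by blast
  then have "meet \<alpha> \<beta> \<in> curve \<alpha> \<inter> curve \<beta>"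
    unfolding meet_def by (rule theI) (use curves_touch(2)[OF assms(1,2) ne] \<open>z \<in> _\<close> in blast)
  then show "meet \<alpha> \<beta> \<in> curve \<alpha>" "meet \<alpha> \<beta> \<in> curve \<beta>" by auto
qed

lemma meet_eqI:
  assumes "\<alpha> \<in> arcs w" "\<beta> \<in> arcs w" "\<alpha> \<noteq> \<beta>" "z \<in> curve \<alpha>" "z \<in> curve \<beta>"
  shows "touches \<alpha> \<beta>" "z = meet \<alpha> \<beta>"
proof -
  show t: "touches \<alpha> \<beta>" using curves_touch(1)[OF assms(1-3)] assms by blast
  show "z = meet \<alpha> \<beta>" using curves_touch(2)[OF assms(1-3)] meet_in[OF assms(1,2) t] assms by blast
qed

text \<open>Touching arcs have different labels, and there are only two labels for three
  arcs.\<close>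

lemma no_triple_point:
  assumes "\<alpha> \<in> arcs w" "\<beta> \<in> arcs w" "\<gamma> \<in> arcs w" "z \<in> curve \<alpha>" "z \<in> curve \<beta>" "z \<in> curve \<gamma>" "\<alpha> \<noteq> \<beta>"
  shows "\<gamma> = \<alpha> \<or> \<gamma> = \<beta>"
proof (rule ccontr)
  assume "\<not> ?thesis"
  then have "touches \<alpha> \<beta>" "touches \<alpha> \<gamma>" "touches \<beta> \<gamma>" using meet_eqI(1) assms by metis+
  then have "label w \<beta> = opp (label w \<alpha>)" "label w \<gamma> = opp (label w \<alpha>)" "label w \<gamma> = opp (label w \<beta>)"
    using touches_label assms by blast+
  then show False using arc(6)[OF assms(1)] by simp
qed

lemma meetings_eq: "meetings w = {meet \<alpha> \<beta> |\<alpha> \<beta>. \<alpha> \<in> arcs w \<and> \<beta> \<in> arcs w \<and> crosses \<alpha> \<beta>}"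
proof (intro set_eqI iffI)
  fix z assume "z \<in> meetings w"
  then obtain \<alpha> \<beta> where *: "\<alpha> \<in> arcs w" "\<beta> \<in> arcs w" "crosses \<alpha> \<beta>" "z \<in> curve \<alpha>" "z \<in> curve \<beta>"
    unfolding meetings_def by blast
  then have "\<alpha> \<noteq> \<beta>" by (auto simp: crosses_def)
  then have "z = meet \<alpha> \<beta>" using meet_eqI(2) * by blast
  then show "z \<in> {meet \<alpha> \<beta> |\<alpha> \<beta>. \<alpha> \<in> arcs w \<and> \<beta> \<in> arcs w \<and> crosses \<alpha> \<beta>}" using * by blast
next
  fix z assume "z \<in> {meet \<alpha> \<beta> |\<alpha> \<beta>. \<alpha> \<in> arcs w \<and> \<beta> \<in> arcs w \<and> crosses \<alpha> \<beta>}"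
  then obtain \<alpha> \<beta> where *: "\<alpha> \<in> arcs w" "\<beta> \<in> arcs w" "crosses \<alpha> \<beta>" "z = meet \<alpha> \<beta>" by blast
  then have "touches \<alpha> \<beta>" by (simp add: touches_def)
  then have "z \<in> curve \<alpha> \<inter> curve \<beta>" using meet_in * by blast
  then show "z \<in> meetings w" using * unfolding meetings_def by blast
qed

lemma meet_in_meetings: "\<alpha> \<in> arcs w \<Longrightarrow> \<beta> \<in> arcs w \<Longrightarrow> touches \<alpha> \<beta> \<Longrightarrow> meet \<alpha> \<beta> \<in> meetings w"
  unfolding meetings_eq touches_def using meet_sym by blast

lemma meet_same_fst:
  assumes "\<alpha> \<in> arcs w" "\<beta> \<in> arcs w" "\<alpha> \<noteq> \<beta>" "fst \<alpha> = fst \<beta>"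
  shows "meet \<alpha> \<beta> = of_nat (fst \<alpha>)" "touches \<alpha> \<beta>"
  using meet_eqI[OF assms(1-3)] curve_endpoints(1)[OF arc(2)[OF assms(1)]]
    curve_endpoints(1)[OF arc(2)[OF assms(2)]] assms(4) by auto

lemma meet_of_nat:
  assumes "\<alpha> \<in> arcs w" "\<beta> \<in> arcs w" "touches \<alpha> \<beta>" "meet \<alpha> \<beta> = of_nat p"
  shows "p = fst \<alpha> \<and> p = fst \<beta>"
proof -
  have "p = fst \<alpha> \<or> p = snd \<alpha>" "p = fst \<beta> \<or> p = snd \<beta>"
    using curve_of_nat meet_in[OF assms(1-3)] arc(2) assms by metis+
  moreover have "snd \<alpha> \<noteq> snd \<beta>" using arc_eq_snd[OF assms(1,2)] assms(3) touches_irrefl by metis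
  ultimately show ?thesis using fst_neq_snd assms(1,2) by metis
qed

lemma meet_Re_endpoint:
  assumes "\<alpha> \<in> arcs w" "\<beta> \<in> arcs w" "touches \<alpha> \<beta>" "Re (meet \<alpha> \<beta>) = real (fst \<alpha>) \<or> Re (meet \<alpha> \<beta>) = real (snd \<alpha>)"
  shows "fst \<alpha> = fst \<beta> \<and> meet \<alpha> \<beta> = of_nat (fst \<alpha>)"
proof -
  have "Im (meet \<alpha> \<beta>) = 0" using curve_Im_0[OF arc(2)[OF assms(1)] meet_in(1)[OF assms(1-3)]] assms(4) by simp
  then have "meet \<alpha> \<beta> = of_nat (fst \<alpha>) \<or> meet \<alpha> \<beta> = of_nat (snd \<alpha>)" using assms(4) by (auto simp: complex_eq_iff)
  then show ?thesis using meet_of_nat[OF assms(1-3)] arc(2)[OF assms(1)] by fastforce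
qed

lemma meet_before_end:
  assumes "\<alpha> \<in> arcs w" "\<beta> \<in> arcs w" "touches \<alpha> \<beta>"
  shows "Re (meet \<alpha> \<beta>) < real (snd \<alpha>)"
proof -
  have "Re (meet \<alpha> \<beta>) \<noteq> real (snd \<alpha>)" 
  proof
    assume *: "Re (meet \<alpha> \<beta>) = real (snd \<alpha>)"
    then have "meet \<alpha> \<beta> = of_nat (fst \<alpha>)" using meet_Re_endpoint[OF assms] by blast
    then show False using * arc(2)[OF assms(1)] by simp
  qed
  then show ?thesis using curve_bounds(2)[OF arc(2)[OF assms(1)] meet_in(1)[OF assms]] by simp
qed

text \<open>Arcs touching \<open>\<alpha>\<close> all carry the opposite label, and two arcs of one
  label cannot share an endpoint.\<close>

lemma key_inj:
  assumes "\<alpha> \<in> arcs w" "\<beta> \<in> arcs w" "\<gamma> \<in> arcs w" "touches \<alpha> \<beta>" "touches \<alpha> \<gamma>" "key \<alpha> \<beta> = key \<alpha> \<gamma>"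
  shows "\<beta> = \<gamma>"
  using assms(6) touches_label[OF assms(1,2,4)] touches_label[OF assms(1,3,5)]
    arc_eq_fst[OF assms(2,3)] arc_eq_snd[OF assms(2,3)] fst_neq_snd[OF assms(2,3)] fst_neq_snd[OF assms(3,2)]
  by (auto simp: key_def split: if_splits)

text \<open>Both arcs have the label opposite to that of \<open>\<alpha>\<close>, so they do not
  cross. As \<open>\<beta>\<close> ends under \<open>\<alpha>\<close> and \<open>\<gamma>\<close>
  reaches beyond it, \<open>\<beta>\<close> must end before \<open>\<gamma>\<close> starts.\<close>

lemma left_key_less:
  assumes "\<alpha> \<in> arcs w" "\<beta> \<in> arcs w" "\<gamma> \<in> arcs w" "touches \<alpha> \<beta>" "touches \<alpha> \<gamma>" "fst \<beta> \<le> fst \<alpha>" "fst \<alpha> < fst \<gamma>"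
  shows "key \<alpha> \<beta> < key \<alpha> \<gamma>"
proof (cases "fst \<beta> = fst \<alpha>")
  case True
  then show ?thesis using assms(7) by (simp add: key_def)
next
  case False
  have "\<not> crosses \<beta> \<gamma>"
    using same_label_noncrossing[OF assms(2,3)] touches_label[OF assms(1,2,4)] touches_label[OF assms(1,3,5)] by simp
  then show ?thesis using False assms(4-7) fst_neq_snd[OF assms(3,2)]
    by (auto simp: key_def touches_def crosses_def)
qed

text \<open>On \<open>\<alpha>\<close> the quadratic terms can be eliminated, so that lying inside
  another semicircle becomes a linear condition on the real part. If \<open>\<beta>\<close> and
  \<open>\<gamma>\<close> start on the same side of the left end of \<open>\<alpha>\<close>, one
  encloses the other because they do not cross; the meeting point on the inner one lies inside the
  outer one, and the sign of the slope orders the two points.\<close>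

lemma order:
  assumes "\<alpha> \<in> arcs w" "\<beta> \<in> arcs w" "\<gamma> \<in> arcs w" "touches \<alpha> \<beta>" "touches \<alpha> \<gamma>" "key \<alpha> \<beta> < key \<alpha> \<gamma>"
  shows "Re (meet \<alpha> \<beta>) < Re (meet \<alpha> \<gamma>)"
proof -
  have lab: "label w \<beta> = label w \<gamma>" using touches_label assms by metis
  note nc = same_label_noncrossing[OF assms(2,3) lab] same_label_noncrossing[OF assms(3,2) lab[symmetric]]
  have ne: "\<beta> \<noteq> \<gamma>" using assms(6) by auto
  then have ne': "fst \<beta> \<noteq> fst \<gamma>" "snd \<beta> \<noteq> snd \<gamma>"
    using arc_eq_fst[OF assms(2,3) lab] arc_eq_snd[OF assms(2,3)] by auto
  note l = arc(2)[OF assms(1)] arc(2)[OF assms(2)] arc(2)[OF assms(3)]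
  note z1 = meet_in[OF assms(1,2,4)] and z2 = meet_in[OF assms(1,3,5)]
  consider "fst \<beta> = fst \<alpha>" | "fst \<beta> < fst \<alpha>" "fst \<gamma> < fst \<alpha>" | "fst \<beta> < fst \<alpha>" "fst \<alpha> \<le> fst \<gamma>"
    | "fst \<alpha> < fst \<beta>" "fst \<gamma> \<le> fst \<alpha>" | "fst \<alpha> < fst \<beta>" "fst \<alpha> < fst \<gamma>" by linarith
  then show ?thesis
  proof cases
    case 1
    have "\<alpha> \<noteq> \<beta>" using assms(4) touches_irrefl by blast
    then have "Re (meet \<alpha> \<beta>) = real (fst \<alpha>)" using meet_same_fst(1)[OF assms(1,2)] 1 by simp
    moreover have "Re (meet \<alpha> \<gamma>) \<noteq> real (fst \<alpha>)" using meet_Re_endpoint[OF assms(1,3,5)] ne' 1 by auto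
    ultimately show ?thesis using curve_bounds(1)[OF l(1) z2(1)] by simp
  next
    case 2
    have c: "crosses \<beta> \<alpha>" "crosses \<gamma> \<alpha>" using 2 assms(4,5) unfolding touches_def crosses_def by linarith+
    have "snd \<beta> < snd \<gamma>" using assms(6) 2 by (simp add: key_def)
    moreover from this have "fst \<gamma> < fst \<beta>" using nc(1) c 2 ne'(1) unfolding crosses_def by linarith
    moreover have "snd \<gamma> < snd \<alpha>" using c unfolding crosses_def by simp
    ultimately have in\<gamma>: "(Re (meet \<alpha> \<beta>))\<^sup>2 + (Im (meet \<alpha> \<beta>))\<^sup>2 <
        (real (fst \<gamma>) + real (snd \<gamma>)) * Re (meet \<alpha> \<beta>) - real (fst \<gamma>) * real (snd \<gamma>)"
      using curve_inside[OF _ l(2) _ z1(2)] by blast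
    \<comment> \<open>The circle equation of \<open>\<alpha>\<close> is subtracted from the
      inequality for the outer arc \<open>\<gamma>\<close> at one point and from its equation at the
      other. The slope is negative, since \<open>\<gamma>\<close> starts and ends before
      \<open>\<alpha>\<close> does.\<close>
    have "(real (fst \<gamma>) + real (snd \<gamma>) - real (fst \<alpha>) - real (snd \<alpha>)) * Re (meet \<alpha> \<gamma>) <
        (real (fst \<gamma>) + real (snd \<gamma>) - real (fst \<alpha>) - real (snd \<alpha>)) * Re (meet \<alpha> \<beta>)"
      using in\<gamma> curve_eq(1)[OF l(1) z1(1)] curve_eq(1)[OF l(1) z2(1)] curve_eq(1)[OF l(3) z2(2)]
      by (simp add: algebra_simps)
    moreover have "real (fst \<gamma>) + real (snd \<gamma>) - real (fst \<alpha>) - real (snd \<alpha>) < 0"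
      using 2 c(2) by (simp add: crosses_def)
    ultimately show ?thesis by (simp add: mult_less_cancel_left)
  next
    case 3
    then have "snd \<beta> < fst \<gamma>" using assms(6) by (simp add: key_def)
    then show ?thesis using curve_bounds(2)[OF l(2) z1(2)] curve_bounds(1)[OF l(3) z2(2)] by simp
  next
    case 4
    then show ?thesis using left_key_less[OF assms(1,3,2,5,4)] assms(6) by simp
  next
    case 5
    have c: "crosses \<alpha> \<beta>" "crosses \<alpha> \<gamma>" using 5 assms(4,5) unfolding touches_def crosses_def by linarith+
    have "fst \<beta> < fst \<gamma>" using assms(6) 5 by (simp add: key_def)
    moreover from this have "snd \<gamma> < snd \<beta>" using nc(1) c ne'(2) unfolding crosses_def by linarith
    moreover have "snd \<alpha> < snd \<beta>" using c unfolding crosses_def by simp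
    ultimately have in\<beta>: "(Re (meet \<alpha> \<gamma>))\<^sup>2 + (Im (meet \<alpha> \<gamma>))\<^sup>2 <
        (real (fst \<beta>) + real (snd \<beta>)) * Re (meet \<alpha> \<gamma>) - real (fst \<beta>) * real (snd \<beta>)"
      using curve_inside[OF _ l(3) _ z2(2)] by blast
    have "(real (fst \<beta>) + real (snd \<beta>) - real (fst \<alpha>) - real (snd \<alpha>)) * Re (meet \<alpha> \<beta>) <
        (real (fst \<beta>) + real (snd \<beta>) - real (fst \<alpha>) - real (snd \<alpha>)) * Re (meet \<alpha> \<gamma>)"
      using in\<beta> curve_eq(1)[OF l(1) z2(1)] curve_eq(1)[OF l(1) z1(1)] curve_eq(1)[OF l(2) z1(2)]
      by (simp add: algebra_simps)
    moreover have "real (fst \<beta>) + real (snd \<beta>) - real (fst \<alpha>) - real (snd \<alpha>) > 0"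
      using 5 c(1) by (simp add: crosses_def)
    ultimately show ?thesis by (simp add: mult_less_cancel_left)
  qed
qed

end

section \<open>Segments\<close>

lemma ex_max:
  fixes f :: "'a \<Rightarrow> 'b::linorder"
  assumes "finite S" "S \<noteq> {}"
  shows "\<exists>m \<in> S. \<forall>x \<in> S. f x \<le> f m"
proof -
  have "Max (f ` S) \<in> f ` S" using assms by simp
  then obtain m where "m \<in> S" "f m = Max (f ` S)" by auto
  then show ?thesis using assms(1) by (intro bexI[of _ m]) auto
qed

context bump_diagram begin

lemma finite_arcs: "finite (arcs w)"
proof (rule finite_subset)
  show "arcs w \<subseteq> {1..length w} \<times> {1..length w}"
  proof
    fix \<alpha> assume "\<alpha> \<in> arcs w"
    then show "\<alpha> \<in> {1..length w} \<times> {1..length w}" using arc(1-3)[of \<alpha>] by (cases \<alpha>) auto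
  qed
qed simp

lemma twin:
  assumes "\<alpha> \<in> arcs w"
  obtains \<beta> where "\<beta> \<in> arcs w" "\<beta> \<noteq> \<alpha>" "fst \<beta> = fst \<alpha>" "touches \<alpha> \<beta>"
proof -
  note a = arc[OF assms]
  obtain \<beta> where b: "\<beta> \<in> arcs w" "fst \<beta> = fst \<alpha>" "label w \<beta> = opp (label w \<alpha>)"
    by (rule arc_from[of "opp (label w \<alpha>)" "fst \<alpha>"]) (use a in auto)
  have "\<beta> \<noteq> \<alpha>" using b(3) a(6) by auto
  moreover from this have "touches \<alpha> \<beta>" using meet_same_fst(2)[OF assms b(1)] b(2) by simp
  ultimately show ?thesis using that b by blast
qed

lemma of_nat_in_meetings:
  assumes "1 \<le> i" "i \<le> length w"
  shows "of_nat i \<in> meetings w \<longleftrightarrow> letter_at w i = A"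
proof
  assume "of_nat i \<in> meetings w"
  then obtain \<alpha> \<beta> where *: "of_nat i = meet \<alpha> \<beta>" "\<alpha> \<in> arcs w" "\<beta> \<in> arcs w" "crosses \<alpha> \<beta>"
    unfolding meetings_eq by blast
  then have "i = fst \<alpha>" using meet_of_nat[of \<alpha> \<beta> i] by (simp add: touches_def)
  then show "letter_at w i = A" using arc(4) * by blast
next
  assume A: "letter_at w i = A"
  obtain \<alpha> where \<alpha>: "\<alpha> \<in> arcs w" "fst \<alpha> = i" by (rule arc_from[of B i]) (use assms A in auto)
  obtain \<beta> where \<beta>: "\<beta> \<in> arcs w" "\<beta> \<noteq> \<alpha>" "fst \<beta> = fst \<alpha>" "touches \<alpha> \<beta>" by (rule twin[OF \<alpha>(1)])
  have "meet \<alpha> \<beta> = of_nat i" using meet_same_fst(1)[OF \<alpha>(1) \<beta>(1)] \<alpha> \<beta> by simp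
  then show "of_nat i \<in> meetings w" using meet_in_meetings[OF \<alpha>(1) \<beta>(1,4)] by simp
qed

text \<open>The right end is the only mark that is not a meeting with another arc; the left end is
  the meeting with the second arc starting there.\<close>

lemma marks_eq:
  assumes "\<alpha> \<in> arcs w"
  shows "marks w \<alpha> = {meet \<alpha> \<beta> |\<beta>. \<beta> \<in> arcs w \<and> touches \<alpha> \<beta>} \<union> {of_nat (snd \<alpha>)}" (is "_ = ?R")
proof (intro set_eqI iffI)
  fix z assume z: "z \<in> marks w \<alpha>"
  then have zc: "z \<in> curve \<alpha>" by (simp add: marks_def)
  from z consider "z \<in> meetings w" | "z \<in> positions w" by (auto simp: marks_def)
  then show "z \<in> ?R"
  proof cases
    case 1
    then obtain \<beta> \<gamma> where *: "z = meet \<beta> \<gamma>" "\<beta> \<in> arcs w" "\<gamma> \<in> arcs w" "crosses \<beta> \<gamma>"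
      unfolding meetings_eq by blast
    then have t: "touches \<beta> \<gamma>" by (simp add: touches_def)
    then have "\<beta> \<noteq> \<gamma>" using touches_irrefl by blast
    then have "\<alpha> = \<beta> \<or> \<alpha> = \<gamma>" using no_triple_point[OF *(2,3) assms] meet_in[OF *(2,3) t] *(1) zc by blast
    then show ?thesis using * t touches_sym meet_sym by blast
  next
    case 2
    then obtain p where p: "z = of_nat p" by (auto simp: positions_def)
    then consider "p = fst \<alpha>" | "p = snd \<alpha>" using curve_of_nat[OF arc(2)[OF assms]] zc by blast
    then show ?thesis
    proof cases
      case 1
      obtain \<beta> where \<beta>: "\<beta> \<in> arcs w" "\<beta> \<noteq> \<alpha>" "fst \<beta> = fst \<alpha>" "touches \<alpha> \<beta>" by (rule twin[OF assms])
      then have "z = meet \<alpha> \<beta>" using meet_same_fst(1)[OF assms \<beta>(1)] p 1 by simp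
      then show ?thesis using \<beta> by blast
    qed (use p in simp)
  qed
next
  fix z assume "z \<in> ?R"
  then consider \<beta> where "z = meet \<alpha> \<beta>" "\<beta> \<in> arcs w" "touches \<alpha> \<beta>" | "z = of_nat (snd \<alpha>)" by blast
  then show "z \<in> marks w \<alpha>"
  proof cases
    case 1
    then show ?thesis using meet_in(1)[OF assms] meet_in_meetings[OF assms] by (simp add: marks_def)
  next
    case 2
    then show ?thesis using curve_endpoints(2)[OF arc(2)[OF assms]] arc[OF assms] by (auto simp: marks_def positions_def)
  qed
qed

lemma order_iff:
  assumes "\<alpha> \<in> arcs w" "\<beta> \<in> arcs w" "\<gamma> \<in> arcs w" "touches \<alpha> \<beta>" "touches \<alpha> \<gamma>"
  shows "Re (meet \<alpha> \<beta>) < Re (meet \<alpha> \<gamma>) \<longleftrightarrow> key \<alpha> \<beta> < key \<alpha> \<gamma>"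
proof -
  consider "key \<alpha> \<beta> < key \<alpha> \<gamma>" | "key \<alpha> \<gamma> < key \<alpha> \<beta>" | "\<beta> = \<gamma>" using key_inj[OF assms] by linarith
  then show ?thesis using order[OF assms] order[OF assms(1,3,2,5,4)] by cases auto
qed

lemma segment_unique:
  assumes "segment w \<alpha> y z" "segment w \<alpha> y' z'"
  shows "y = y' \<longleftrightarrow> z = z'"
proof -
  have \<alpha>: "fst \<alpha> < snd \<alpha>" using assms arc(2) by (simp add: segment_def)
  have c: "y \<in> curve \<alpha>" "y' \<in> curve \<alpha>" "z \<in> curve \<alpha>" "z' \<in> curve \<alpha>" using assms by (auto simp: segment_def marks_def)
  have "Re y = Re y' \<longleftrightarrow> Re z = Re z'"
    using assms unfolding segment_def by (metis linorder_neqE_linordered_idom)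
  then show ?thesis using curve_eqI[OF \<alpha>] c by blast
qed

text \<open>Neighbours along the arc are neighbours with respect to \<open>key\<close>; with this
  criterion segments are recognised from endpoints alone, without coordinates.\<close>

lemma segment_to_meet:
  assumes "\<alpha> \<in> arcs w" "\<beta> \<in> arcs w" "\<gamma> \<in> arcs w" "touches \<alpha> \<beta>" "touches \<alpha> \<gamma>" "key \<alpha> \<beta> < key \<alpha> \<gamma>"
    "\<And>\<delta>. \<delta> \<in> arcs w \<Longrightarrow> touches \<alpha> \<delta> \<Longrightarrow> key \<alpha> \<beta> < key \<alpha> \<delta> \<Longrightarrow> key \<alpha> \<delta> < key \<alpha> \<gamma> \<Longrightarrow> False"
  shows "segment w \<alpha> (meet \<alpha> \<beta>) (meet \<alpha> \<gamma>)"
  unfolding segment_def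
proof (intro conjI notI)
  show "\<alpha> \<in> arcs w" by fact
  show "meet \<alpha> \<beta> \<in> marks w \<alpha>" "meet \<alpha> \<gamma> \<in> marks w \<alpha>" unfolding marks_eq[OF assms(1)] using assms by blast+
  show "Re (meet \<alpha> \<beta>) < Re (meet \<alpha> \<gamma>)" using order assms by blast
  assume "\<exists>x \<in> marks w \<alpha>. Re (meet \<alpha> \<beta>) < Re x \<and> Re x < Re (meet \<alpha> \<gamma>)"
  then obtain x where x: "x \<in> marks w \<alpha>" "Re (meet \<alpha> \<beta>) < Re x" "Re x < Re (meet \<alpha> \<gamma>)" by blast
  have "x \<noteq> of_nat (snd \<alpha>)" using meet_before_end[OF assms(1,3,5)] x(3) by auto
  then obtain \<delta> where \<delta>: "\<delta> \<in> arcs w" "touches \<alpha> \<delta>" "x = meet \<alpha> \<delta>" using x(1) unfolding marks_eq[OF assms(1)] by blast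
  show False
    by (rule assms(7)[OF \<delta>(1,2)]) (use x \<delta> order_iff[OF assms(1,2) \<delta>(1) assms(4) \<delta>(2)]
      order_iff[OF assms(1) \<delta>(1) assms(3) \<delta>(2) assms(5)] in auto)
qed

lemma segment_to_end:
  assumes "\<alpha> \<in> arcs w" "\<beta> \<in> arcs w" "touches \<alpha> \<beta>"
    "\<And>\<delta>. \<delta> \<in> arcs w \<Longrightarrow> touches \<alpha> \<delta> \<Longrightarrow> key \<alpha> \<delta> \<le> key \<alpha> \<beta>"
  shows "segment w \<alpha> (meet \<alpha> \<beta>) (of_nat (snd \<alpha>))"
  unfolding segment_def
proof (intro conjI notI)
  show "\<alpha> \<in> arcs w" by fact
  show "meet \<alpha> \<beta> \<in> marks w \<alpha>" "of_nat (snd \<alpha>) \<in> marks w \<alpha>" unfolding marks_eq[OF assms(1)] using assms by blast+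
  show "Re (meet \<alpha> \<beta>) < Re (of_nat (snd \<alpha>))" using meet_before_end[OF assms(1-3)] by simp
  assume "\<exists>x \<in> marks w \<alpha>. Re (meet \<alpha> \<beta>) < Re x \<and> Re x < Re (of_nat (snd \<alpha>))"
  then obtain x where x: "x \<in> marks w \<alpha>" "Re (meet \<alpha> \<beta>) < Re x" "Re x < Re (of_nat (snd \<alpha>))" by blast
  then have "x \<noteq> of_nat (snd \<alpha>)" by auto
  then obtain \<delta> where \<delta>: "\<delta> \<in> arcs w" "touches \<alpha> \<delta>" "x = meet \<alpha> \<delta>" using x(1) unfolding marks_eq[OF assms(1)] by blast
  then show False using assms(4)[OF \<delta>(1,2)] order_iff[OF assms(1,2) \<delta>(1) assms(3) \<delta>(2)] x by auto
qed

lemma segment_start: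
  assumes "segment w \<alpha> y z"
  obtains \<beta> where "\<alpha> \<in> arcs w" "\<beta> \<in> arcs w" "touches \<alpha> \<beta>" "y = meet \<alpha> \<beta>"
proof -
  have \<alpha>: "\<alpha> \<in> arcs w" and "z \<in> curve \<alpha>" "Re y < Re z" "y \<in> marks w \<alpha>"
    using assms by (auto simp: segment_def marks_def)
  then have "y \<noteq> of_nat (snd \<alpha>)" using curve_bounds(2)[OF arc(2)[OF \<alpha>], of z] by auto
  then show ?thesis using that \<open>y \<in> marks w \<alpha>\<close> \<alpha> unfolding marks_eq[OF \<alpha>] by blast
qed

lemma finite_marks:
  assumes "\<alpha> \<in> arcs w"
  shows "finite (marks w \<alpha>)"
proof (rule finite_subset)
  show "marks w \<alpha> \<subseteq> insert (of_nat (snd \<alpha>)) (meet \<alpha> ` arcs w)" using marks_eq[OF assms] by blast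
qed (simp add: finite_arcs)

lemma segment_end_exists:
  assumes "\<alpha> \<in> arcs w" "\<beta> \<in> arcs w" "touches \<alpha> \<beta>"
  shows "\<exists>z. segment w \<alpha> (meet \<alpha> \<beta>) z"
proof -
  define S where "S = {x \<in> marks w \<alpha>. Re (meet \<alpha> \<beta>) < Re x}"
  have "of_nat (snd \<alpha>) \<in> S" using meet_before_end[OF assms] marks_eq[OF assms(1)] by (simp add: S_def)
  then have "S \<noteq> {}" "finite S" using finite_marks[OF assms(1)] by (auto simp: S_def)
  then obtain z where z: "z \<in> S" "\<And>x. x \<in> S \<Longrightarrow> Re z \<le> Re x" using ex_max[of S "\<lambda>x. - Re x"] by auto
  moreover have "meet \<alpha> \<beta> \<in> marks w \<alpha>" using marks_eq[OF assms(1)] assms by blast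
  ultimately have "segment w \<alpha> (meet \<alpha> \<beta>) z" using assms(1) unfolding segment_def S_def by fastforce
  then show ?thesis ..
qed

lemma segment_start_exists:
  assumes "\<alpha> \<in> arcs w" "z \<in> marks w \<alpha>" "z \<noteq> of_nat (fst \<alpha>)"
  shows "\<exists>y. segment w \<alpha> y z"
proof -
  define S where "S = {x \<in> marks w \<alpha>. Re x < Re z}"
  note a = arc[OF assms(1)]
  have z: "z \<in> curve \<alpha>" using assms(2) by (simp add: marks_def)
  have "Re z \<noteq> real (fst \<alpha>)" using curve_eqI[OF a(2) z curve_endpoints(1)[OF a(2)]] assms(3) by auto
  moreover have "of_nat (fst \<alpha>) \<in> marks w \<alpha>"
    using curve_endpoints(1)[OF a(2)] a(1-3) by (simp add: marks_def positions_def)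
  ultimately have "of_nat (fst \<alpha>) \<in> S" using curve_bounds(1)[OF a(2) z] by (simp add: S_def)
  then have "S \<noteq> {}" "finite S" using finite_marks[OF assms(1)] by (auto simp: S_def)
  then obtain y where y: "y \<in> S" "\<And>x. x \<in> S \<Longrightarrow> Re x \<le> Re y" using ex_max[of S Re] by auto
  then have "segment w \<alpha> y z" using assms unfolding segment_def S_def by fastforce
  then show ?thesis ..
qed

lemma key_twin: "fst \<beta> = fst \<alpha> \<Longrightarrow> key \<alpha> \<beta> = fst \<alpha>" by (simp add: key_def)

section \<open>The edges at a vertex, in particular at the boundary\<close>

lemma incid_White:
  "(White z, e) \<in> web_incid w \<longleftrightarrow> z \<in> meetings w \<and> e = Join z \<or> (\<exists>\<alpha> y. segment w \<alpha> y z \<and> e = Seg \<alpha> y)"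
  by (auto elim: web_incid.cases intro: web_incid.intros)

lemma incid_Black:
  "(Black y, e) \<in> web_incid w \<longleftrightarrow> y \<in> meetings w \<and> e = Join y \<or> (\<exists>\<alpha> z. segment w \<alpha> y z \<and> e = Seg \<alpha> y)"
  by (auto elim: web_incid.cases intro: web_incid.intros)

lemma segment_end_of_nat:
  assumes "segment w \<alpha> y (of_nat i)"
  shows "i = snd \<alpha>"
proof -
  have \<alpha>: "\<alpha> \<in> arcs w" and y: "y \<in> curve \<alpha>" and i: "of_nat i \<in> curve \<alpha>" and lt: "Re y < real i"
    using assms by (auto simp: segment_def marks_def)
  have "i = fst \<alpha> \<or> i = snd \<alpha>" using curve_of_nat[OF arc(2)[OF \<alpha>] i] .
  moreover have "real (fst \<alpha>) \<le> Re y" using curve_bounds(1)[OF arc(2)[OF \<alpha>] y] .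
  ultimately show ?thesis using lt by auto
qed

lemma incid_rim_A:
  assumes "1 \<le> i" "i \<le> length w" "letter_at w i = A"
  shows "(White (of_nat i), e) \<in> web_incid w \<longleftrightarrow> e = Join (of_nat i)"
proof -
  have "\<not> segment w \<alpha> y (of_nat i)" for \<alpha> y
  proof
    assume s: "segment w \<alpha> y (of_nat i)"
    then have "\<alpha> \<in> arcs w" by (simp add: segment_def)
    then show False using segment_end_of_nat[OF s] arc(5,6)[of \<alpha>] assms by auto
  qed
  then show ?thesis using of_nat_in_meetings[OF assms(1,2)] assms(3) by (simp add: incid_White)
qed

lemma incid_rim_close:
  assumes "\<alpha> \<in> arcs w" "segment w \<alpha> y (of_nat (snd \<alpha>))"
  shows "(White (of_nat (snd \<alpha>)), e) \<in> web_incid w \<longleftrightarrow> e = Seg \<alpha> y"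
proof -
  have "of_nat (snd \<alpha>) \<notin> meetings w"
    using of_nat_in_meetings[of "snd \<alpha>"] arc[OF assms(1)] by auto
  moreover have "\<alpha>' = \<alpha> \<and> y' = y" if s: "segment w \<alpha>' y' (of_nat (snd \<alpha>))" for \<alpha>' y'
  proof -
    have "\<alpha>' \<in> arcs w" using s by (simp add: segment_def)
    then have "\<alpha>' = \<alpha>" using segment_end_of_nat[OF s] arc_eq_snd assms(1) by metis
    then show ?thesis using segment_unique s assms(2) by blast
  qed
  ultimately show ?thesis using assms(2) unfolding incid_White by blast
qed

lemma rim_edge_exists:
  assumes "1 \<le> i" "i \<le> length w"
  shows "\<exists>!e. (White (of_nat i), e) \<in> web_incid w"
proof (cases "letter_at w i = A")
  case True
  then show ?thesis using incid_rim_A[OF assms] by simp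
next
  case False
  obtain \<alpha> where \<alpha>: "\<alpha> \<in> arcs w" "snd \<alpha> = i" by (rule arc_to[OF assms False])
  have "of_nat (snd \<alpha>) \<noteq> (of_nat (fst \<alpha>) :: complex)" using arc(2)[OF \<alpha>(1)] by simp
  then obtain y where "segment w \<alpha> y (of_nat (snd \<alpha>))"
    using segment_start_exists[OF \<alpha>(1)] marks_eq[OF \<alpha>(1)] by blast
  then show ?thesis using incid_rim_close[OF \<alpha>(1)] \<alpha>(2) by simp
qed

text \<open>At a letter \<open>A\<close> this is the stem of the fork, at \<open>B\<close> or
  \<open>C\<close> the last segment of the arc that ends there.\<close>

definition rim_edge :: "nat \<Rightarrow> web_edge" where
  "rim_edge i = (THE e. (White (of_nat i), e) \<in> web_incid w)"

lemma rim_edge: "1 \<le> i \<Longrightarrow> i \<le> length w \<Longrightarrow> (White (of_nat i), e) \<in> web_incid w \<longleftrightarrow> e = rim_edge i"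
  unfolding rim_edge_def using theI'[OF rim_edge_exists] rim_edge_exists by metis

end

section \<open>The diagram of a prefix\<close>

fun trip :: "arc \<times> arc \<Rightarrow> web_edge \<times> web_edge \<times> web_edge" where
  "trip (\<alpha>, \<beta>) = (Join (meet \<alpha> \<beta>), Seg \<alpha> (meet \<alpha> \<beta>), Seg \<beta> (meet \<alpha> \<beta>))"

fun black_rel :: "arc \<times> arc \<Rightarrow> (web_edge \<times> web_edge) set" where
  "black_rel (\<alpha>, \<beta>) = cyc (Join (meet \<alpha> \<beta>)) (Seg \<alpha> (meet \<alpha> \<beta>)) (Seg \<beta> (meet \<alpha> \<beta>))"

text \<open>A union over at most one cycle, since the segments ending at a meeting point are unique
  on their arcs. It is empty for a fork, whose white end is a boundary vertex and has its loop
  recorded through \<open>rim_edge\<close>.\<close>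

fun white_rel :: "letter list \<Rightarrow> arc \<times> arc \<Rightarrow> (web_edge \<times> web_edge) set" where
  "white_rel w (\<alpha>, \<beta>) = \<Union> {cyc (Seg \<alpha> x) (Seg \<beta> y) (Join (meet \<alpha> \<beta>)) |x y.
     fst \<alpha> < fst \<beta> \<and> segment w \<alpha> x (meet \<alpha> \<beta>) \<and> segment w \<beta> y (meet \<alpha> \<beta>)}"

context bump_diagram begin

text \<open>The crossings drawn by the time the first \<open>k\<close> letters have been processed.\<close>

definition crossings :: "nat \<Rightarrow> (arc \<times> arc) set" where
  "crossings k = {(\<alpha>, \<beta>). \<alpha> \<in> arcs w \<and> \<beta> \<in> arcs w \<and> crosses \<alpha> \<beta> \<and>
     (if fst \<alpha> = fst \<beta> then fst \<alpha> else snd \<alpha>) \<le> k}"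

text \<open>For an open strand these are the arcs already met in the drawing: the second arc from
  the same point, and the arcs from further left that have ended by now. Arcs starting under
  \<open>\<alpha>\<close> are excluded because their crossings with \<open>\<alpha>\<close> are
  drawn only when \<open>\<alpha>\<close> itself closes.\<close>

definition prevs :: "nat \<Rightarrow> arc \<Rightarrow> arc set" where
  "prevs k \<alpha> = {\<beta> \<in> arcs w. touches \<alpha> \<beta> \<and> fst \<beta> \<le> fst \<alpha> \<and> key \<alpha> \<beta> \<le> k}"

definition last_mark :: "nat \<Rightarrow> arc \<Rightarrow> complex" where
  "last_mark k \<alpha> = (THE y. \<exists>\<beta> \<in> prevs k \<alpha>. y = meet \<alpha> \<beta> \<and> (\<forall>\<gamma> \<in> prevs k \<alpha>. key \<alpha> \<gamma> \<le> key \<alpha> \<beta>))"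

definition last_seg :: "nat \<Rightarrow> arc \<Rightarrow> web_edge" where
  "last_seg k \<alpha> = Seg \<alpha> (last_mark k \<alpha>)"

lemma last_mark_eqI:
  assumes "\<alpha> \<in> arcs w" "\<beta> \<in> prevs k \<alpha>" "\<And>\<gamma>. \<gamma> \<in> prevs k \<alpha> \<Longrightarrow> key \<alpha> \<gamma> \<le> key \<alpha> \<beta>"
  shows "last_mark k \<alpha> = meet \<alpha> \<beta>"
  unfolding last_mark_def
proof (rule the_equality)
  fix y assume "\<exists>\<beta> \<in> prevs k \<alpha>. y = meet \<alpha> \<beta> \<and> (\<forall>\<gamma> \<in> prevs k \<alpha>. key \<alpha> \<gamma> \<le> key \<alpha> \<beta>)"
  then obtain \<gamma> where \<gamma>: "\<gamma> \<in> prevs k \<alpha>" "y = meet \<alpha> \<gamma>" "\<forall>\<delta> \<in> prevs k \<alpha>. key \<alpha> \<delta> \<le> key \<alpha> \<gamma>" by blast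
  then have "key \<alpha> \<beta> = key \<alpha> \<gamma>" using assms(2,3) by (simp add: antisym)
  then have "\<beta> = \<gamma>" using key_inj[OF assms(1)] \<gamma>(1) assms(2) unfolding prevs_def by blast
  then show "y = meet \<alpha> \<beta>" using \<gamma>(2) by simp
qed (use assms in blast)

lemma last_mark_exists:
  assumes "\<alpha> \<in> arcs w" "fst \<alpha> \<le> k"
  obtains \<beta> where "\<beta> \<in> prevs k \<alpha>" "last_mark k \<alpha> = meet \<alpha> \<beta>" "\<And>\<gamma>. \<gamma> \<in> prevs k \<alpha> \<Longrightarrow> key \<alpha> \<gamma> \<le> key \<alpha> \<beta>"
proof -
  obtain \<tau> where \<tau>: "\<tau> \<in> arcs w" "\<tau> \<noteq> \<alpha>" "fst \<tau> = fst \<alpha>" "touches \<alpha> \<tau>" by (rule twin[OF assms(1)])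
  then have "\<tau> \<in> prevs k \<alpha>" using assms(2) key_twin[OF \<tau>(3)] by (simp add: prevs_def)
  moreover have "finite (prevs k \<alpha>)" using finite_arcs by (simp add: prevs_def)
  ultimately obtain \<beta> where \<beta>: "\<beta> \<in> prevs k \<alpha>" "\<forall>\<gamma> \<in> prevs k \<alpha>. key \<alpha> \<gamma> \<le> key \<alpha> \<beta>"
    using ex_max[of "prevs k \<alpha>" "key \<alpha>"] by blast
  then show ?thesis using that[of \<beta>] last_mark_eqI[OF assms(1)] by blast
qed

text \<open>An open strand gains a mark only when an arc from further left ends and crosses
  it.\<close>

lemma last_seg_Suc:
  assumes "\<alpha> \<in> arcs w" "fst \<alpha> \<noteq> Suc k" "\<And>\<beta>. \<beta> \<in> arcs w \<Longrightarrow> snd \<beta> = Suc k \<Longrightarrow> fst \<alpha> \<le> fst \<beta>"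
  shows "last_seg (Suc k) \<alpha> = last_seg k \<alpha>"
proof -
  have "prevs (Suc k) \<alpha> = prevs k \<alpha>"
    using assms(2,3) unfolding prevs_def key_def by (fastforce simp: le_Suc_eq)
  then show ?thesis by (simp add: last_seg_def last_mark_def)
qed

text \<open>The two arcs at an \<open>A\<close> are distinguished by the order in which they end,
  not by label: the one ending first is the lower strand of the pair.\<close>

definition low :: "nat \<Rightarrow> arc" where
  "low a = (THE \<alpha>. \<alpha> \<in> arcs w \<and> fst \<alpha> = a \<and> (\<exists>\<beta> \<in> arcs w. fst \<beta> = a \<and> snd \<alpha> < snd \<beta>))"

definition high :: "nat \<Rightarrow> arc" where
  "high a = (THE \<alpha>. \<alpha> \<in> arcs w \<and> fst \<alpha> = a \<and> (\<exists>\<beta> \<in> arcs w. fst \<beta> = a \<and> snd \<beta> < snd \<alpha>))"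

lemma low_high:
  assumes "1 \<le> a" "a \<le> length w" "letter_at w a = A"
  shows "low a \<in> arcs w" "high a \<in> arcs w" "fst (low a) = a" "fst (high a) = a" "snd (low a) < snd (high a)"
    "label w (high a) = opp (label w (low a))" "\<And>\<gamma>. \<gamma> \<in> arcs w \<Longrightarrow> fst \<gamma> = a \<Longrightarrow> \<gamma> = low a \<or> \<gamma> = high a"
proof -
  obtain \<alpha> where \<alpha>: "\<alpha> \<in> arcs w" "fst \<alpha> = a" by (rule arc_from[of B a]) (use assms in auto)
  obtain \<beta> where \<beta>: "\<beta> \<in> arcs w" "\<beta> \<noteq> \<alpha>" "fst \<beta> = fst \<alpha>" "touches \<alpha> \<beta>" by (rule twin[OF \<alpha>(1)])
  have all: "\<gamma> = \<alpha> \<or> \<gamma> = \<beta>" if "\<gamma> \<in> arcs w" "fst \<gamma> = a" for \<gamma>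
  proof -
    have "label w \<gamma> = label w \<alpha> \<or> label w \<gamma> = label w \<beta>"
      using touches_label[OF \<alpha>(1) \<beta>(1,4)] neq_opp[of "label w \<alpha>" "label w \<gamma>"] arc(6)[OF \<alpha>(1)] arc(6)[OF that(1)] by auto
    then show ?thesis using arc_eq_fst that \<alpha> \<beta>(1,3) by metis
  qed
  have *: "low a = x \<and> high a = y" if x: "x \<in> arcs w" "fst x = a" and y: "y \<in> arcs w" "fst y = a"
    and lt: "snd x < snd y" and xy: "\<And>\<gamma>. \<gamma> \<in> arcs w \<Longrightarrow> fst \<gamma> = a \<Longrightarrow> \<gamma> = x \<or> \<gamma> = y" for x y
  proof
    show "low a = x" unfolding low_def
    proof (rule the_equality)
      show "x \<in> arcs w \<and> fst x = a \<and> (\<exists>\<beta> \<in> arcs w. fst \<beta> = a \<and> snd x < snd \<beta>)" using x y lt by blast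
      fix z assume "z \<in> arcs w \<and> fst z = a \<and> (\<exists>\<beta> \<in> arcs w. fst \<beta> = a \<and> snd z < snd \<beta>)"
      then show "z = x" using xy lt by (metis less_asym less_irrefl)
    qed
    show "high a = y" unfolding high_def
    proof (rule the_equality)
      show "y \<in> arcs w \<and> fst y = a \<and> (\<exists>\<beta> \<in> arcs w. fst \<beta> = a \<and> snd \<beta> < snd y)" using x y lt by blast
      fix z assume "z \<in> arcs w \<and> fst z = a \<and> (\<exists>\<beta> \<in> arcs w. fst \<beta> = a \<and> snd \<beta> < snd z)"
      then show "z = y" using xy lt by (metis less_asym less_irrefl)
    qed
  qed
  have "snd \<alpha> \<noteq> snd \<beta>" using arc_eq_snd[OF \<alpha>(1) \<beta>(1)] \<beta>(2) by blast
  then consider "low a = \<alpha>" "high a = \<beta>" "snd \<alpha> < snd \<beta>" | "low a = \<beta>" "high a = \<alpha>" "snd \<beta> < snd \<alpha>"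
    using *[of \<alpha> \<beta>] *[of \<beta> \<alpha>] \<alpha> \<beta>(1,3) all by (metis nat_neq_iff)
  then show "low a \<in> arcs w" "high a \<in> arcs w" "fst (low a) = a" "fst (high a) = a" "snd (low a) < snd (high a)"
    "label w (high a) = opp (label w (low a))" "\<And>\<gamma>. \<gamma> \<in> arcs w \<Longrightarrow> fst \<gamma> = a \<Longrightarrow> \<gamma> = low a \<or> \<gamma> = high a"
    using \<alpha> \<beta> all touches_label[OF \<alpha>(1) \<beta>(1,4)] by (cases; simp; blast)+
qed

definition entry :: "nat \<Rightarrow> nat \<Rightarrow> web_edge strand list" where
  "entry k a = (if letter_at w a \<noteq> A then []
     else if k < snd (low a) then [Two (last_seg k (low a)) (last_seg k (high a))]
     else if k < snd (high a) then [One (label w (high a)) (last_seg k (high a))] else [])"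

text \<open>Strands from later positions run below those from earlier ones, hence the reversed list
  of positions. A crossing of arcs with different starts enters when the arc starting further left
  ends, not at the abscissa where the semicircles meet.\<close>

definition drawn :: "nat \<Rightarrow> web_edge diagram" where
  "drawn k = (\<Union> (black_rel ` crossings k),
     \<Union> (white_rel w ` crossings k) \<union> (\<lambda>i. (rim_edge i, rim_edge i)) ` {1..k},
     map rim_edge [1..<Suc k],
     concat (map (entry k) (rev [1..<Suc k])))"

lemma entry_Suc:
  assumes "1 \<le> a" "a \<le> k" "k < length w" "\<And>\<beta>. \<beta> \<in> arcs w \<Longrightarrow> snd \<beta> = Suc k \<Longrightarrow> a < fst \<beta>"
  shows "entry (Suc k) a = entry k a"
proof (cases "letter_at w a = A")
  case True
  note lh = low_high[OF assms(1) _ True]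
  have l: "a \<le> length w" using assms by simp
  have s: "last_seg (Suc k) \<alpha> = last_seg k \<alpha> \<and> snd \<alpha> \<noteq> Suc k" if \<alpha>: "\<alpha> \<in> arcs w" "fst \<alpha> = a" for \<alpha>
  proof
    show "last_seg (Suc k) \<alpha> = last_seg k \<alpha>"
      by (rule last_seg_Suc[OF \<alpha>(1)]) (use \<alpha>(2) assms(2,4) less_imp_le in auto)
    show "snd \<alpha> \<noteq> Suc k" using assms(4)[OF \<alpha>(1)] \<alpha>(2) by auto
  qed
  have "snd (low a) \<noteq> Suc k" "snd (high a) \<noteq> Suc k" "last_seg (Suc k) (low a) = last_seg k (low a)"
    "last_seg (Suc k) (high a) = last_seg k (high a)"
    using s[OF lh(1)[OF l] lh(3)[OF l]] s[OF lh(2)[OF l] lh(4)[OF l]] by auto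
  then show ?thesis unfolding entry_def by auto
qed (simp add: entry_def)

text \<open>The arcs that \<open>\<alpha>\<close> crosses while its strand descends to the bottom.\<close>

definition passed :: "arc \<Rightarrow> arc set" where
  "passed \<alpha> = {\<beta> \<in> arcs w. crosses \<alpha> \<beta> \<and> fst \<alpha> < fst \<beta>}"

lemma crossings_Suc:
  "(\<beta>, \<gamma>) \<in> crossings (Suc k) \<longleftrightarrow> (\<beta>, \<gamma>) \<in> crossings k \<or>
    \<beta> \<in> arcs w \<and> \<gamma> \<in> arcs w \<and> crosses \<beta> \<gamma> \<and> (if fst \<beta> = fst \<gamma> then fst \<beta> else snd \<beta>) = Suc k"
  by (auto simp: crossings_def)

text \<open>Pairs with a common left end are counted at that end, so a closing letter adds only the
  crossings of its arc with arcs starting under it.\<close>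

lemma crossings_close:
  assumes "\<alpha> \<in> arcs w" "snd \<alpha> = Suc k"
  shows "crossings (Suc k) = crossings k \<union> {\<alpha>} \<times> passed \<alpha>"
proof -
  have "(\<beta> \<in> arcs w \<and> \<gamma> \<in> arcs w \<and> crosses \<beta> \<gamma> \<and> (if fst \<beta> = fst \<gamma> then fst \<beta> else snd \<beta>) = Suc k) \<longleftrightarrow>
      \<beta> = \<alpha> \<and> \<gamma> \<in> passed \<alpha>" for \<beta> \<gamma>
    using assms fst_neq_snd[of \<beta> \<alpha>] arc_eq_snd[of \<beta> \<alpha>] by (auto simp: passed_def crosses_def split: if_splits)
  then have "(\<beta>, \<gamma>) \<in> crossings (Suc k) \<longleftrightarrow> (\<beta>, \<gamma>) \<in> crossings k \<union> {\<alpha>} \<times> passed \<alpha>" for \<beta> \<gamma>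
    unfolding crossings_Suc by blast
  then show ?thesis by (intro equalityI subrelI) blast+
qed

lemma crossings_fork:
  assumes "k < length w" "letter_at w (Suc k) = A"
  shows "crossings (Suc k) = insert (low (Suc k), high (Suc k)) (crossings k)"
    "(low (Suc k), high (Suc k)) \<notin> crossings k"
proof -
  note lh = low_high[of "Suc k", simplified, OF Suc_leI[OF assms(1)] assms(2)]
  show "(low (Suc k), high (Suc k)) \<notin> crossings k" using lh by (simp add: crossings_def)
  have "(\<beta> \<in> arcs w \<and> \<gamma> \<in> arcs w \<and> crosses \<beta> \<gamma> \<and> (if fst \<beta> = fst \<gamma> then fst \<beta> else snd \<beta>) = Suc k) \<longleftrightarrow>
      \<beta> = low (Suc k) \<and> \<gamma> = high (Suc k)" for \<beta> \<gamma>
  proof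
    assume *: "\<beta> \<in> arcs w \<and> \<gamma> \<in> arcs w \<and> crosses \<beta> \<gamma> \<and> (if fst \<beta> = fst \<gamma> then fst \<beta> else snd \<beta>) = Suc k"
    then have "snd \<beta> \<noteq> Suc k" using arc(5,6)[of \<beta>] assms(2) by auto
    then have "fst \<beta> = Suc k" "fst \<gamma> = Suc k" "snd \<beta> < snd \<gamma>" using * by (auto simp: crosses_def split: if_splits)
    then show "\<beta> = low (Suc k) \<and> \<gamma> = high (Suc k)" using lh(7)[of \<beta>] lh(7)[of \<gamma>] lh(5) * by auto
  qed (use lh arc(2)[OF lh(1)] in \<open>auto simp: crosses_def\<close>)
  then have "(\<beta>, \<gamma>) \<in> crossings (Suc k) \<longleftrightarrow> (\<beta>, \<gamma>) \<in> insert (low (Suc k), high (Suc k)) (crossings k)" for \<beta> \<gamma>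
    unfolding crossings_Suc by blast
  then show "crossings (Suc k) = insert (low (Suc k), high (Suc k)) (crossings k)"
    by (intro equalityI subrelI) blast+
qed

lemma drawn_fork:
  assumes "k < length w" "letter_at w (Suc k) = A"
  shows "step A [trip (low (Suc k), high (Suc k))] (drawn k) (drawn (Suc k))"
proof -
  define \<alpha> \<beta> where "\<alpha> = low (Suc k)" and "\<beta> = high (Suc k)"
  note lh = low_high[of "Suc k", simplified, OF Suc_leI[OF assms(1)] assms(2), folded \<alpha>_def \<beta>_def]
  note cf = crossings_fork[OF assms, folded \<alpha>_def \<beta>_def]
  have ne: "\<alpha> \<noteq> \<beta>" using lh(5) by auto
  have m: "meet \<alpha> \<beta> = of_nat (Suc k)" "touches \<alpha> \<beta>" using meet_same_fst[OF lh(1,2) ne] lh(3,4) by simp_all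
  \<comment> \<open>A key lies between the start \<open>Suc k\<close> of the arc and the current
    stage \<open>Suc k\<close>, so the fork is the only mark drawn on either strand.\<close>
  have last: "last_seg (Suc k) \<gamma> = Seg \<gamma> (meet \<alpha> \<beta>)" if \<gamma>: "\<gamma> \<in> {\<alpha>, \<beta>}" for \<gamma>
  proof -
    have \<gamma>': "\<gamma> \<in> arcs w" "fst \<gamma> = Suc k" using \<gamma> lh by auto
    obtain \<delta> where \<delta>: "\<delta> \<in> prevs (Suc k) \<gamma>" "last_mark (Suc k) \<gamma> = meet \<gamma> \<delta>"
      using last_mark_exists[OF \<gamma>'(1), of "Suc k"] \<gamma>'(2) by (metis order_refl)
    have d: "\<delta> \<in> arcs w" "touches \<gamma> \<delta>" "fst \<delta> \<le> fst \<gamma>" "key \<gamma> \<delta> \<le> Suc k" using \<delta>(1) by (auto simp: prevs_def)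
    have "key \<gamma> \<delta> = Suc k" using key_bounds[OF d(2)] d(4) \<gamma>'(2) by simp
    then have "fst \<delta> = fst \<gamma>" using d(3) \<gamma>'(2) fst_neq_snd[OF \<gamma>'(1) d(1)] by (auto simp: key_def split: if_splits)
    moreover have "\<gamma> \<noteq> \<delta>" using d(2) touches_irrefl by blast
    ultimately have "meet \<gamma> \<delta> = of_nat (Suc k)" using meet_same_fst(1)[OF \<gamma>'(1) d(1)] \<gamma>'(2) by simp
    then show ?thesis using \<delta>(2) m by (simp add: last_seg_def)
  qed
  have rim: "rim_edge (Suc k) = Join (meet \<alpha> \<beta>)"
    using rim_edge[of "Suc k" "Join (of_nat (Suc k))"] incid_rim_A[of "Suc k"] assms m(1) by simp
  have e: "entry (Suc k) (Suc k) = [Two (Seg \<alpha> (meet \<alpha> \<beta>)) (Seg \<beta> (meet \<alpha> \<beta>))]"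
    using last[of \<alpha>] last[of \<beta>] assms(2) arc(2)[OF lh(1)] lh(3) by (simp add: entry_def \<alpha>_def \<beta>_def)
  have es: "entry (Suc k) a = entry k a" if "a \<in> {1..<Suc k}" for a
    by (rule entry_Suc) (use that assms arc(5,6) in auto)
  have "white_rel w (\<alpha>, \<beta>) = {}" using lh by simp
  then have "step A [(Join (meet \<alpha> \<beta>), Seg \<alpha> (meet \<alpha> \<beta>), Seg \<beta> (meet \<alpha> \<beta>))] (drawn k) (drawn (Suc k))"
    unfolding drawn_def
  proof (intro step_forkI)
    show "concat (map (entry (Suc k)) (rev [1..<Suc (Suc k)])) = Two (Seg \<alpha> (meet \<alpha> \<beta>)) (Seg \<beta> (meet \<alpha> \<beta>)) #
        concat (map (entry k) (rev [1..<Suc k]))"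
    proof -
      have m: "map (entry (Suc k)) (rev [1..<Suc k]) = map (entry k) (rev [1..<Suc k])" using es by (intro map_cong) auto
      have u: "[1..<Suc (Suc k)] = [1..<Suc k] @ [Suc k]" by (intro upt_Suc_append) simp
      have "concat (map (entry (Suc k)) (rev ([1..<Suc k] @ [Suc k]))) =
          entry (Suc k) (Suc k) @ concat (map (entry (Suc k)) (rev [1..<Suc k]))" by (simp del: upt_Suc)
      then show ?thesis unfolding u m e by simp
    qed
  qed (auto simp: cf(1) rim atLeastAtMostSuc_conv)
  then show ?thesis by (simp add: \<alpha>_def \<beta>_def)
qed

end

lemma concat_map_filter:
  assumes "\<And>x. x \<in> set xs \<Longrightarrow> g x = (if P x then [f x] else [])"
  shows "concat (map g xs) = map f (filter P xs)"
  using assms by (induction xs) auto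

context bump_diagram begin

text \<open>Arcs starting at or left of \<open>\<alpha>\<close> have smaller keys than those
  starting under it. The last mark before the descent is thus the neighbour of the first crossing of
  the descent, the one with the leftmost arc passed.\<close>

lemma prev_segment:
  assumes "\<alpha> \<in> arcs w" "snd \<alpha> = Suc k" "\<beta> \<in> passed \<alpha>" "\<And>\<gamma>. \<gamma> \<in> passed \<alpha> \<Longrightarrow> fst \<beta> \<le> fst \<gamma>"
  shows "segment w \<alpha> (last_mark k \<alpha>) (meet \<alpha> \<beta>)"
proof -
  have b: "\<beta> \<in> arcs w" "touches \<alpha> \<beta>" "fst \<alpha> < fst \<beta>" using assms(3) by (auto simp: passed_def touches_def)
  have "fst \<alpha> \<le> k" using arc(2)[OF assms(1)] assms(2) by simp
  then obtain \<gamma> where \<gamma>: "\<gamma> \<in> prevs k \<alpha>" "last_mark k \<alpha> = meet \<alpha> \<gamma>"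
    "\<And>\<delta>. \<delta> \<in> prevs k \<alpha> \<Longrightarrow> key \<alpha> \<delta> \<le> key \<alpha> \<gamma>" using last_mark_exists[OF assms(1)] by blast
  have g: "\<gamma> \<in> arcs w" "touches \<alpha> \<gamma>" "fst \<gamma> \<le> fst \<alpha>" using \<gamma>(1) by (auto simp: prevs_def)
  show ?thesis unfolding \<gamma>(2)
  proof (rule segment_to_meet[OF assms(1) g(1) b(1) g(2) b(2) left_key_less[OF assms(1) g(1) b(1) g(2) b(2) g(3) b(3)]])
    fix \<delta> assume \<delta>: "\<delta> \<in> arcs w" "touches \<alpha> \<delta>" "key \<alpha> \<gamma> < key \<alpha> \<delta>" "key \<alpha> \<delta> < key \<alpha> \<beta>"
    show False
    proof (cases "fst \<delta> \<le> fst \<alpha>")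
      case True
      have "key \<alpha> \<delta> \<le> k" using key_bounds[OF \<delta>(2)] assms(2) by simp
      then show False using \<gamma>(3)[of \<delta>] \<delta> True by (simp add: prevs_def)
    next
      case False
      then have "\<delta> \<in> passed \<alpha>" using \<delta>(1,2) by (auto simp: passed_def touches_def crosses_def)
      then show False using assms(4) False \<delta>(4) b(3) by (fastforce simp: key_def)
    qed
  qed
qed

lemma next_segment:
  assumes "\<alpha> \<in> arcs w" "\<beta> \<in> passed \<alpha>" "\<gamma> \<in> passed \<alpha>" "fst \<gamma> < fst \<beta>"
    "\<And>\<delta>. \<delta> \<in> passed \<alpha> \<Longrightarrow> fst \<delta> < fst \<beta> \<Longrightarrow> fst \<delta> \<le> fst \<gamma>"
  shows "segment w \<alpha> (meet \<alpha> \<gamma>) (meet \<alpha> \<beta>)"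
proof -
  have b: "\<beta> \<in> arcs w" "touches \<alpha> \<beta>" and c: "\<gamma> \<in> arcs w" "touches \<alpha> \<gamma>" "fst \<alpha> < fst \<gamma>"
    using assms(2,3) by (auto simp: passed_def touches_def)
  have lt: "key \<alpha> \<gamma> < key \<alpha> \<beta>" using assms(4) c(3) by (simp add: key_def)
  show ?thesis
  proof (rule segment_to_meet[OF assms(1) c(1) b(1) c(2) b(2) lt])
    fix \<delta> assume \<delta>: "\<delta> \<in> arcs w" "touches \<alpha> \<delta>" "key \<alpha> \<gamma> < key \<alpha> \<delta>" "key \<alpha> \<delta> < key \<alpha> \<beta>"
    show False
    proof (cases "fst \<delta> \<le> fst \<alpha>")
      case True
      then show False using left_key_less[OF assms(1) \<delta>(1) c(1) \<delta>(2) c(2) True c(3)] \<delta>(3) by simp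
    next
      case False
      then have "\<delta> \<in> passed \<alpha>" using \<delta>(1,2) by (auto simp: passed_def touches_def crosses_def)
      then show False using assms(5)[of \<delta>] False \<delta>(3,4) assms(4) c(3) by (simp add: key_def)
    qed
  qed
qed

text \<open>Seen from \<open>\<beta>\<close>, the closing arc comes from the left and has key
  \<open>Suc k\<close>, larger than every key drawn so far on \<open>\<beta>\<close>, while arcs
  starting under \<open>\<beta>\<close> have still larger keys.\<close>

lemma lower_segment:
  assumes "\<alpha> \<in> arcs w" "snd \<alpha> = Suc k" "\<beta> \<in> passed \<alpha>"
  shows "segment w \<beta> (last_mark k \<beta>) (meet \<alpha> \<beta>)" "last_seg (Suc k) \<beta> = Seg \<beta> (meet \<alpha> \<beta>)"
proof -
  have b: "\<beta> \<in> arcs w" "crosses \<alpha> \<beta>" "fst \<alpha> < fst \<beta>" using assms(3) by (auto simp: passed_def)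
  then have t: "touches \<beta> \<alpha>" by (simp add: touches_def)
  have k: "key \<beta> \<alpha> = Suc k" using assms(2) b(3) by (simp add: key_def)
  have "fst \<beta> \<le> k" using assms(2) b(2) by (simp add: crosses_def)
  then obtain \<gamma> where \<gamma>: "\<gamma> \<in> prevs k \<beta>" "last_mark k \<beta> = meet \<beta> \<gamma>"
    "\<And>\<delta>. \<delta> \<in> prevs k \<beta> \<Longrightarrow> key \<beta> \<delta> \<le> key \<beta> \<gamma>" using last_mark_exists[OF b(1)] by blast
  have g: "\<gamma> \<in> arcs w" "touches \<beta> \<gamma>" "key \<beta> \<gamma> < key \<beta> \<alpha>" using \<gamma>(1) k by (auto simp: prevs_def)
  have "segment w \<beta> (meet \<beta> \<gamma>) (meet \<beta> \<alpha>)"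
  proof (rule segment_to_meet[OF b(1) g(1) assms(1) g(2) t g(3)])
    fix \<delta> assume \<delta>: "\<delta> \<in> arcs w" "touches \<beta> \<delta>" "key \<beta> \<gamma> < key \<beta> \<delta>" "key \<beta> \<delta> < key \<beta> \<alpha>"
    show False
    proof (cases "fst \<delta> \<le> fst \<beta>")
      case True
      then show False using \<gamma>(3)[of \<delta>] \<delta> k by (simp add: prevs_def)
    next
      case False
      then show False using left_key_less[OF b(1) assms(1) \<delta>(1) t \<delta>(2)] \<delta>(4) b(3) by simp
    qed
  qed
  then show "segment w \<beta> (last_mark k \<beta>) (meet \<alpha> \<beta>)" using \<gamma>(2) meet_sym by metis
  have "last_mark (Suc k) \<beta> = meet \<beta> \<alpha>"
    by (rule last_mark_eqI[OF b(1)]) (use assms b t k in \<open>auto simp: prevs_def\<close>)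
  then show "last_seg (Suc k) \<beta> = Seg \<beta> (meet \<alpha> \<beta>)" using meet_sym by (metis last_seg_def)
qed

lemma white_rel_eq:
  assumes "fst \<alpha> < fst \<beta>" "segment w \<alpha> x (meet \<alpha> \<beta>)" "segment w \<beta> y (meet \<alpha> \<beta>)"
  shows "white_rel w (\<alpha>, \<beta>) = cyc (Seg \<alpha> x) (Seg \<beta> y) (Join (meet \<alpha> \<beta>))"
proof -
  have "x' = x" if "segment w \<alpha> x' (meet \<alpha> \<beta>)" for x' using segment_unique[OF that assms(2)] by simp
  moreover have "y' = y" if "segment w \<beta> y' (meet \<alpha> \<beta>)" for y' using segment_unique[OF that assms(3)] by simp
  ultimately have "{cyc (Seg \<alpha> x) (Seg \<beta> y) (Join (meet \<alpha> \<beta>)) |x y. fst \<alpha> < fst \<beta> \<and>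
      segment w \<alpha> x (meet \<alpha> \<beta>) \<and> segment w \<beta> y (meet \<alpha> \<beta>)} = {cyc (Seg \<alpha> x) (Seg \<beta> y) (Join (meet \<alpha> \<beta>))}"
    using assms by blast
  then show ?thesis by simp
qed

text \<open>From bottom to top the starts decrease, so the descent crosses the last element of
  \<open>bs\<close> first. The closure condition puts every arc crossed before the head into the
  tail, so that neighbours in \<open>bs\<close> are joined by a single segment of
  \<open>\<alpha>\<close>.\<close>

lemma desc_crossings:
  assumes "\<alpha> \<in> arcs w" "snd \<alpha> = Suc k"
    "sorted_wrt (\<lambda>\<beta> \<gamma>. fst \<gamma> < fst \<beta>) bs"
    "set bs \<subseteq> passed \<alpha>"
    "\<And>\<beta> \<gamma>. \<beta> \<in> set bs \<Longrightarrow> \<gamma> \<in> passed \<alpha> \<Longrightarrow> fst \<gamma> < fst \<beta> \<Longrightarrow> \<gamma> \<in> set bs"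
  shows "desc (map (last_seg k) bs) (map (\<lambda>\<beta>. trip (\<alpha>, \<beta>)) bs) (last_seg k \<alpha>)
    (Seg \<alpha> (if bs = [] then last_mark k \<alpha> else meet \<alpha> (hd bs))) (map (\<lambda>\<beta>. Seg \<beta> (meet \<alpha> \<beta>)) bs)
    (\<Union>\<beta> \<in> set bs. black_rel (\<alpha>, \<beta>)) (\<Union>\<beta> \<in> set bs. white_rel w (\<alpha>, \<beta>))"
  using assms(3-5)
proof (induction bs)
  case Nil
  show ?case by (simp add: last_seg_def desc_Nil)
next
  case (Cons \<beta> bs)
  define y where "y = (if bs = [] then last_mark k \<alpha> else meet \<alpha> (hd bs))"
  have less: "fst \<gamma> < fst \<beta>" if "\<gamma> \<in> set bs" for \<gamma> using Cons.prems(1) that by auto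
  have IH: "desc (map (last_seg k) bs) (map (\<lambda>\<beta>. trip (\<alpha>, \<beta>)) bs) (last_seg k \<alpha>) (Seg \<alpha> y)
    (map (\<lambda>\<beta>. Seg \<beta> (meet \<alpha> \<beta>)) bs) (\<Union>\<beta> \<in> set bs. black_rel (\<alpha>, \<beta>)) (\<Union>\<beta> \<in> set bs. white_rel w (\<alpha>, \<beta>))"
    unfolding y_def
  proof (rule Cons.IH)
    show "sorted_wrt (\<lambda>\<beta> \<gamma>. fst \<gamma> < fst \<beta>) bs" using Cons.prems(1) by simp
    show "set bs \<subseteq> passed \<alpha>" using Cons.prems(2) by simp
    show "\<delta> \<in> set bs" if d: "\<gamma> \<in> set bs" "\<delta> \<in> passed \<alpha>" "fst \<delta> < fst \<gamma>" for \<gamma> \<delta>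
    proof -
      have "\<delta> \<in> set (\<beta> # bs)" by (rule Cons.prems(3)[of \<gamma>]) (use d in auto)
      moreover have "\<delta> \<noteq> \<beta>" using less[OF d(1)] d(3) by auto
      ultimately show ?thesis by simp
    qed
  qed
  have \<beta>: "\<beta> \<in> passed \<alpha>" using Cons.prems(2) by simp
  then have lt: "fst \<alpha> < fst \<beta>" by (simp add: passed_def)
  have seg: "segment w \<alpha> y (meet \<alpha> \<beta>)"
  proof (cases bs)
    case Nil
    show ?thesis unfolding y_def if_P[OF Nil]
    proof (rule prev_segment[OF assms(1,2) \<beta>])
      fix \<gamma> assume "\<gamma> \<in> passed \<alpha>"
      then have "fst \<gamma> < fst \<beta> \<Longrightarrow> \<gamma> = \<beta>" using Cons.prems(3)[of \<beta> \<gamma>] Nil by simp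
      then show "fst \<beta> \<le> fst \<gamma>" by (cases "fst \<gamma> < fst \<beta>") auto
    qed
  next
    case (Cons \<gamma> bs')
    have g: "\<gamma> \<in> set bs" using Cons by simp
    have "segment w \<alpha> (meet \<alpha> \<gamma>) (meet \<alpha> \<beta>)"
    proof (rule next_segment[OF assms(1) \<beta> _ less[OF g]])
      show "\<gamma> \<in> passed \<alpha>" using Cons.prems(2) g by auto
      fix \<delta> assume d: "\<delta> \<in> passed \<alpha>" "fst \<delta> < fst \<beta>"
      then have "\<delta> \<in> set (\<beta> # bs)" using Cons.prems(3)[of \<beta> \<delta>] by simp
      then have "\<delta> \<in> set bs" using d(2) by auto
      then show "fst \<delta> \<le> fst \<gamma>" using Cons.prems(1) Cons by auto
    qed
    then show ?thesis using Cons by (simp add: y_def)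
  qed
  have w: "white_rel w (\<alpha>, \<beta>) = cyc (Seg \<alpha> y) (last_seg k \<beta>) (Join (meet \<alpha> \<beta>))"
    unfolding last_seg_def by (rule white_rel_eq[OF lt seg lower_segment(1)[OF assms(1,2) \<beta>]])
  from desc_Cons[OF IH, of "last_seg k \<beta>" "Join (meet \<alpha> \<beta>)" "Seg \<alpha> (meet \<alpha> \<beta>)" "Seg \<beta> (meet \<alpha> \<beta>)", folded w]
  show ?case by (simp add: Un_commute)
qed

text \<open>A letter \<open>A\<close> strictly between the start of \<open>\<alpha>\<close> and
  position \<open>Suc k\<close> has already closed its arc labelled \<open>x\<close>, for otherwise
  that arc and \<open>\<alpha>\<close> would cross with equal labels. It contributes at most one
  open strand, labelled \<open>opp x\<close>, and this is the stack that a closing letter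
  requires.\<close>

lemma drawn_close:
  assumes "k < length w" "letter_at w (Suc k) \<noteq> A"
  shows "\<exists>ps. distinct ps \<and> set ps = crossings (Suc k) - crossings k \<and>
    step (letter_at w (Suc k)) (map trip ps) (drawn k) (drawn (Suc k))"
proof -
  obtain \<alpha> where \<alpha>: "\<alpha> \<in> arcs w" "snd \<alpha> = Suc k" by (rule arc_to[of "Suc k"]) (use assms in auto)
  define a where "a = fst \<alpha>"
  define x where "x = letter_at w (Suc k)"
  have x: "label w \<alpha> = x" "x \<noteq> A" using \<alpha> assms by (auto simp: label_def x_def)
  have a: "1 \<le> a" "a \<le> k" "letter_at w a = A" "a \<le> length w" using arc[OF \<alpha>(1)] \<alpha>(2) by (auto simp: a_def)
  have only: "\<beta> = \<alpha>" if "\<beta> \<in> arcs w" "snd \<beta> = Suc k" for \<beta> using arc_eq_snd that \<alpha> by metis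
  define P where "P c \<longleftrightarrow> letter_at w c = A \<and> k < snd (high c)" for c
  have inner: "entry k c = (if P c then [One (opp x) (last_seg k (high c))] else [])"
      "entry (Suc k) c = (if P c then [One (opp x) (last_seg (Suc k) (high c))] else [])"
      "P c \<Longrightarrow> high c \<in> passed \<alpha>" "\<beta> \<in> passed \<alpha> \<Longrightarrow> fst \<beta> = c \<Longrightarrow> \<beta> = high c \<and> P c"
    if c: "c \<in> {Suc a..k}" for c \<beta>
  proof -
    have c': "1 \<le> c" "c \<le> length w" "a < c" "c \<le> k" using c a assms(1) by auto
    have main: "\<not> k < snd (low c) \<and> (k < snd (high c) \<longrightarrow> label w (high c) = opp x) \<and> snd (high c) \<noteq> Suc k"
      if A: "letter_at w c = A"
    proof -
      note lh = low_high[OF c'(1,2) A]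
      obtain \<gamma> where \<gamma>: "\<gamma> \<in> arcs w" "fst \<gamma> = c" "label w \<gamma> = x" by (rule arc_from[OF x(2) c'(1,2) A])
      have "\<gamma> \<noteq> \<alpha>" using \<gamma>(2) c'(3) by (auto simp: a_def)
      then have "snd \<gamma> \<noteq> Suc k" using only \<gamma>(1) by blast
      moreover have "\<not> crosses \<alpha> \<gamma>" using same_label_noncrossing[OF \<alpha>(1) \<gamma>(1)] \<gamma>(3) x(1) by simp
      ultimately have closed: "snd \<gamma> \<le> k" using \<gamma>(2) c' \<alpha>(2) by (auto simp: crosses_def a_def)
      have 1: "\<not> k < snd (low c)" using lh(7)[OF \<gamma>(1,2)] lh(5) closed by auto
      have 2: "label w (high c) = opp x" if "k < snd (high c)"
      proof -
        have "\<gamma> = low c" using lh(7)[OF \<gamma>(1,2)] closed that by auto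
        then show ?thesis using lh(6) \<gamma>(3) by simp
      qed
      have "high c \<noteq> \<alpha>" using lh(4) c'(3) by (auto simp: a_def)
      then show ?thesis using 1 2 only[OF lh(2)] by blast
    qed
    show "entry k c = (if P c then [One (opp x) (last_seg k (high c))] else [])"
      using main by (auto simp: entry_def P_def)
    show "entry (Suc k) c = (if P c then [One (opp x) (last_seg (Suc k) (high c))] else [])"
      using main by (auto simp: entry_def P_def)
    show "high c \<in> passed \<alpha>" if "P c"
      using that low_high[OF c'(1,2)] main c' \<alpha>(2) by (auto simp: P_def passed_def crosses_def a_def)
    show "\<beta> = high c \<and> P c" if \<beta>: "\<beta> \<in> passed \<alpha>" "fst \<beta> = c"
    proof -
      have \<beta>': "\<beta> \<in> arcs w" "Suc k < snd \<beta>" using \<beta> \<alpha>(2) by (auto simp: passed_def crosses_def)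
      have A: "letter_at w c = A" using arc(4)[OF \<beta>'(1)] \<beta>(2) by simp
      then have "\<beta> = high c" using low_high(7)[OF c'(1,2) A \<beta>'(1) \<beta>(2)] main[OF A] \<beta>'(2) by auto
      then show ?thesis using A \<beta>'(2) by (simp add: P_def)
    qed
  qed
  define cs where "cs = filter P (rev [Suc a..<Suc k])"
  define bs where "bs = map high cs"
  have set_cs: "set cs = {c \<in> {Suc a..k}. P c}" by (auto simp: cs_def)
  have fst_high: "fst (high c) = c" if "c \<in> set cs" for c
    using that a low_high(4)[of c] assms(1) by (auto simp: set_cs P_def)
  have set_bs: "set bs = passed \<alpha>"
  proof (intro set_eqI iffI)
    fix \<beta> assume "\<beta> \<in> set bs" then show "\<beta> \<in> passed \<alpha>" using inner(3) by (auto simp: bs_def set_cs)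
  next
    fix \<beta> assume b: "\<beta> \<in> passed \<alpha>"
    then have "fst \<beta> \<in> {Suc a..k}" using \<alpha>(2) by (auto simp: passed_def crosses_def a_def)
    then show "\<beta> \<in> set bs" using inner(4)[OF _ b refl] unfolding bs_def set_map set_cs by blast
  qed
  have sorted_cs: "sorted_wrt (\<lambda>b c. c < b) cs"
    unfolding cs_def by (intro sorted_wrt_filter) (simp add: sorted_wrt_rev del: upt_Suc)
  have sorted_bs: "sorted_wrt (\<lambda>\<beta> \<gamma>. fst \<gamma> < fst \<beta>) bs"
    unfolding bs_def sorted_wrt_map
    by (rule sorted_wrt_mono_rel[OF _ sorted_cs]) (simp add: fst_high)
  have "inj_on high (set cs)" using fst_high by (metis inj_onI)
  then have distinct_bs: "distinct bs" by (simp add: bs_def distinct_map cs_def del: upt_Suc)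
  define y where "y = (if bs = [] then last_mark k \<alpha> else meet \<alpha> (hd bs))"
  have desc: "desc (map (last_seg k) bs) (map (\<lambda>\<beta>. trip (\<alpha>, \<beta>)) bs) (last_seg k \<alpha>) (Seg \<alpha> y)
    (map (\<lambda>\<beta>. Seg \<beta> (meet \<alpha> \<beta>)) bs) (\<Union>\<beta> \<in> set bs. black_rel (\<alpha>, \<beta>)) (\<Union>\<beta> \<in> set bs. white_rel w (\<alpha>, \<beta>))"
    unfolding y_def by (rule desc_crossings[OF \<alpha> sorted_bs]) (auto simp: set_bs)
  have last_bs: "map (\<lambda>\<beta>. Seg \<beta> (meet \<alpha> \<beta>)) bs = map (last_seg (Suc k)) bs"
    by (rule map_cong[OF refl]) (use lower_segment(2)[OF \<alpha>] set_bs in auto)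
  \<comment> \<open>The last mark before the right end is the lowest crossing of the descent, or, if
    nothing is passed, the last mark drawn before.\<close>
  have seg_y: "segment w \<alpha> y (of_nat (snd \<alpha>))"
  proof -
    have D_le: "fst \<delta> \<le> fst (hd bs)" if "\<delta> \<in> passed \<alpha>" for \<delta>
      using sorted_bs that set_bs[symmetric] by (cases bs) auto
    have touch_D: "\<delta> \<in> passed \<alpha>" if "\<delta> \<in> arcs w" "touches \<alpha> \<delta>" "fst \<alpha> < fst \<delta>" for \<delta>
      using that by (auto simp: passed_def touches_def crosses_def)
    show ?thesis
    proof (cases "bs = []")
      case True
      then have D: "passed \<alpha> = {}" using set_bs by simp
      obtain \<gamma> where \<gamma>: "\<gamma> \<in> prevs k \<alpha>" "last_mark k \<alpha> = meet \<alpha> \<gamma>"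
        "\<And>\<delta>. \<delta> \<in> prevs k \<alpha> \<Longrightarrow> key \<alpha> \<delta> \<le> key \<alpha> \<gamma>" using last_mark_exists[OF \<alpha>(1)] a(2) a_def by blast
      have "segment w \<alpha> (meet \<alpha> \<gamma>) (of_nat (snd \<alpha>))"
      proof (rule segment_to_end[OF \<alpha>(1)])
        show "\<gamma> \<in> arcs w" "touches \<alpha> \<gamma>" using \<gamma>(1) by (auto simp: prevs_def)
        fix \<delta> assume \<delta>: "\<delta> \<in> arcs w" "touches \<alpha> \<delta>"
        then have "fst \<delta> \<le> fst \<alpha>" using touch_D[OF \<delta>] D by (cases "fst \<alpha> < fst \<delta>") auto
        moreover have "key \<alpha> \<delta> \<le> k" using key_bounds[OF \<delta>(2)] \<alpha>(2) by simp
        ultimately show "key \<alpha> \<delta> \<le> key \<alpha> \<gamma>" using \<gamma>(3) \<delta> by (simp add: prevs_def)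
      qed
      then show ?thesis using True \<gamma>(2) by (simp add: y_def)
    next
      case False
      then have h: "hd bs \<in> arcs w" "touches \<alpha> (hd bs)" "fst \<alpha> < fst (hd bs)"
        using set_bs hd_in_set[OF False] by (auto simp: passed_def touches_def)
      have "segment w \<alpha> (meet \<alpha> (hd bs)) (of_nat (snd \<alpha>))"
      proof (rule segment_to_end[OF \<alpha>(1) h(1,2)])
        fix \<delta> assume \<delta>: "\<delta> \<in> arcs w" "touches \<alpha> \<delta>"
        show "key \<alpha> \<delta> \<le> key \<alpha> (hd bs)"
        proof (cases "fst \<delta> \<le> fst \<alpha>")
          case True
          then show ?thesis using left_key_less[OF \<alpha>(1) \<delta>(1) h(1) \<delta>(2) h(2) True h(3)] by simp
        next
          case False
          then show ?thesis using D_le[OF touch_D[OF \<delta>]] h(3) by (simp add: key_def)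
        qed
      qed
      then show ?thesis using False by (simp add: y_def)
    qed
  qed
  have rim: "rim_edge (Suc k) = Seg \<alpha> y"
    using rim_edge[of "Suc k" "Seg \<alpha> y"] incid_rim_close[OF \<alpha>(1) seg_y] \<alpha>(2) assms(1) by simp
  note lh = low_high[OF a(1,4,3)]
  have last_high: "last_seg (Suc k) (high a) = last_seg k (high a)"
    by (rule last_seg_Suc[OF lh(2)]) (use lh(4) a(2) only a_def in auto)
  \<comment> \<open>Either \<open>\<alpha>\<close> is the first of its pair to close and leaves the
    other strand with the opposite label, or it is the strand that was left.\<close>
  have "\<exists>t t'. entry k a = [t] \<and> entry (Suc k) a = t' \<and> takes x t (last_seg k \<alpha>) t'"
  proof (cases "\<alpha> = low a")
    case True
    then have s: "snd (low a) = Suc k" "Suc k < snd (high a)" "label w (high a) = opp x"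
      using \<alpha>(2) x(1) lh(5,6) by auto
    have "entry k a = [Two (last_seg k \<alpha>) (last_seg k (high a))]" unfolding entry_def True using s a(3) by simp
    moreover have "entry (Suc k) a = [One (opp x) (last_seg k (high a))]"
      unfolding entry_def using s a(3) last_high by simp
    ultimately show ?thesis using takes_Two[of x "last_seg k \<alpha>" "last_seg k (high a)"] by auto
  next
    case False
    then have h: "\<alpha> = high a" using lh(7)[OF \<alpha>(1)] a_def by blast
    then have s: "snd (high a) = Suc k" "label w (high a) = x" "\<not> k < snd (low a)" "\<not> Suc k < snd (low a)"
      using \<alpha>(2) x(1) lh(5) by auto
    have "entry k a = [One x (last_seg k \<alpha>)]" unfolding entry_def using s a(3) h by simp
    moreover have "entry (Suc k) a = []" unfolding entry_def using s a(3) by simp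
    ultimately show ?thesis using takes_One[of x "last_seg k \<alpha>"] by auto
  qed
  then obtain t t' where t: "entry k a = [t]" "entry (Suc k) a = t'" "takes x t (last_seg k \<alpha>) t'" by blast
  define rest where "rest = concat (map (entry k) (rev [1..<a]))"
  have rest': "concat (map (entry (Suc k)) (rev [1..<a])) = rest"
  proof -
    have "map (entry (Suc k)) (rev [1..<a]) = map (entry k) (rev [1..<a])"
    proof (rule map_cong[OF refl])
      fix c assume "c \<in> set (rev [1..<a])"
      then have c: "1 \<le> c" "c \<le> k" "c < a" using a(2) by auto
      show "entry (Suc k) c = entry k c"
      proof (rule entry_Suc[OF c(1,2) assms(1)])
        fix \<beta> assume "\<beta> \<in> arcs w" "snd \<beta> = Suc k"
        then have "\<beta> = \<alpha>" by (rule only)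
        then show "c < fst \<beta>" using c(3) a_def by simp
      qed
    qed
    then show ?thesis unfolding rest_def by (rule arg_cong)
  qed
  have split: "[1..<Suc k] = [1..<a] @ a # [Suc a..<Suc k]"
    using a(1,2) upt_add_eq_append[of 1 a "Suc k - a"] upt_conv_Cons[of a "Suc k"] by (simp del: upt_Suc)
  have inner1: "concat (map (entry k) (rev [Suc a..<Suc k])) = map (One (opp x)) (map (last_seg k) bs)"
    using concat_map_filter[of "rev [Suc a..<Suc k]" "entry k" P "\<lambda>c. One (opp x) (last_seg k (high c))"] inner(1)
    by (simp add: bs_def cs_def comp_def del: upt_Suc)
  have inner2: "concat (map (entry (Suc k)) (rev [Suc a..<Suc k])) = map (One (opp x)) (map (last_seg (Suc k)) bs)"
    using concat_map_filter[of "rev [Suc a..<Suc k]" "entry (Suc k)" P "\<lambda>c. One (opp x) (last_seg (Suc k) (high c))"] inner(2)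
    by (simp add: bs_def cs_def comp_def del: upt_Suc)
  have ss: "concat (map (entry k) (rev [1..<Suc k])) = map (One (opp x)) (map (last_seg k) bs) @ t # rest"
    unfolding split rest_def rev_append rev.simps map_append concat_append inner1 using t(1) by simp
  have e: "entry (Suc k) (Suc k) = []" using assms(2) by (simp add: entry_def)
  have "concat (map (entry (Suc k)) (rev [1..<Suc k])) = map (One (opp x)) (map (last_seg (Suc k)) bs) @ t' @ rest"
    unfolding split rev_append rev.simps map_append concat_append inner2 rest' using t(2) by simp
  moreover have u: "[1..<Suc (Suc k)] = [1..<Suc k] @ [Suc k]" by (intro upt_Suc_append) simp
  ultimately have ss': "concat (map (entry (Suc k)) (rev [1..<Suc (Suc k)])) =
      map (One (opp x)) (map (\<lambda>\<beta>. Seg \<beta> (meet \<alpha> \<beta>)) bs) @ t' @ rest"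
    unfolding u last_bs rev_append map_append concat_append using e by simp
  have cr: "crossings (Suc k) = crossings k \<union> {\<alpha>} \<times> passed \<alpha>" by (rule crossings_close[OF \<alpha>])
  have disj: "crossings k \<inter> {\<alpha>} \<times> passed \<alpha> = {}" using \<alpha>(2) by (auto simp: crossings_def passed_def)
  have "step x (map (\<lambda>\<beta>. trip (\<alpha>, \<beta>)) bs) (drawn k) (drawn (Suc k))"
    unfolding drawn_def
  proof (rule step_closeI[OF x(2) desc t(3) ss _ _ _ ss'])
    show "\<Union> (black_rel ` crossings (Suc k)) = \<Union> (black_rel ` crossings k) \<union> (\<Union>\<beta> \<in> set bs. black_rel (\<alpha>, \<beta>))"
      unfolding cr set_bs by blast
    show "\<Union> (white_rel w ` crossings (Suc k)) \<union> (\<lambda>i. (rim_edge i, rim_edge i)) ` {1..Suc k} =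
        \<Union> (white_rel w ` crossings k) \<union> (\<lambda>i. (rim_edge i, rim_edge i)) ` {1..k} \<union>
        (\<Union>\<beta> \<in> set bs. white_rel w (\<alpha>, \<beta>)) \<union> {(Seg \<alpha> y, Seg \<alpha> y)}"
    proof -
      have "{1..Suc k} = insert (Suc k) {1..k}" by auto
      then show ?thesis unfolding cr set_bs by (simp only: image_insert rim) blast
    qed
    show "map rim_edge [1..<Suc (Suc k)] = map rim_edge [1..<Suc k] @ [Seg \<alpha> y]" unfolding u using rim by simp
  qed
  moreover have "map (\<lambda>\<beta>. trip (\<alpha>, \<beta>)) bs = map trip (map (Pair \<alpha>) bs)" by simp
  moreover have "distinct (map (Pair \<alpha>) bs)" using distinct_bs by (simp add: distinct_map inj_on_def)
  moreover have "set (map (Pair \<alpha>) bs) = crossings (Suc k) - crossings k" using set_bs cr disj by auto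
  ultimately show ?thesis unfolding x_def by metis
qed

end

section \<open>Recovering a web from its edges\<close>

definition black_succ :: "('v, 'e) web \<Rightarrow> ('e \<times> 'e) set" where
  "black_succ W = {(e, f). \<exists>v \<in> blacks W. (v, e, f) \<in> ccw W}"

definition white_succ :: "('v, 'e) web \<Rightarrow> ('e \<times> 'e) set" where
  "white_succ W = {(e, f). \<exists>v \<in> whites W. (v, e, f) \<in> ccw W}"

text \<open>Vertices have degree at most three, so that any two edges at a vertex are adjacent in its
  cyclic order; hence the vertices can be recovered from the two successor relations on edges.\<close>

definition well_formed :: "('v, 'e) web \<Rightarrow> bool" where
  "well_formed W \<longleftrightarrow> whites W \<inter> blacks W = {} \<and>
     (\<forall>e \<in> edges W. \<exists>!v. v \<in> whites W \<and> (v, e) \<in> incid W) \<and>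
     (\<forall>e \<in> edges W. \<exists>!v. v \<in> blacks W \<and> (v, e) \<in> incid W) \<and>
     (\<forall>v \<in> whites W \<union> blacks W. \<exists>e \<in> edges W. (v, e) \<in> incid W) \<and>
     (\<forall>v e. (v, e) \<in> incid W \<longrightarrow> e \<in> edges W) \<and>
     (\<forall>v e f. (v, e, f) \<in> ccw W \<longrightarrow> (v, e) \<in> incid W \<and> (v, f) \<in> incid W) \<and>
     (\<forall>v e f. (v, e) \<in> incid W \<longrightarrow> (v, f) \<in> incid W \<longrightarrow> e = f \<or> (v, e, f) \<in> ccw W \<or> (v, f, e) \<in> ccw W) \<and>
     (\<forall>i \<in> {1..rim_size W}. rim W i \<in> whites W)"

lemma well_formedD:
  assumes "well_formed W"
  shows "whites W \<inter> blacks W = {}"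
    "e \<in> edges W \<Longrightarrow> \<exists>!v. v \<in> whites W \<and> (v, e) \<in> incid W"
    "e \<in> edges W \<Longrightarrow> \<exists>!v. v \<in> blacks W \<and> (v, e) \<in> incid W"
    "v \<in> whites W \<Longrightarrow> \<exists>e \<in> edges W. (v, e) \<in> incid W"
    "v \<in> blacks W \<Longrightarrow> \<exists>e \<in> edges W. (v, e) \<in> incid W"
    "(v, e, f) \<in> ccw W \<Longrightarrow> (v, e) \<in> incid W \<and> (v, f) \<in> incid W"
    "(v, e) \<in> incid W \<Longrightarrow> (v, f) \<in> incid W \<Longrightarrow> e = f \<or> (v, e, f) \<in> ccw W \<or> (v, f, e) \<in> ccw W"
    "i \<in> {1..rim_size W} \<Longrightarrow> rim W i \<in> whites W"
    "(v, e) \<in> incid W \<Longrightarrow> e \<in> edges W"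
  using assms unfolding well_formed_def by (elim conjE; (simp; fail | blast))+

text \<open>A vertex amounts to the set of edges ending in it. By \<open>adj\<close> two edges meet
  in \<open>V\<close> iff they are equal or neighbours in the cyclic order, and \<open>succ\<close>
  transports this along \<open>\<psi>\<close>. One colour is treated at a time, since an edge has
  one end of each colour.\<close>

lemma vertex_bijection:
  fixes \<psi> :: "'e \<Rightarrow> 'f" and V :: "'v set" and V' :: "'u set"
  assumes ends: "\<And>e. e \<in> E \<Longrightarrow> \<exists>!v. v \<in> V \<and> (v, e) \<in> I"
      "\<And>e. e \<in> E' \<Longrightarrow> \<exists>!v. v \<in> V' \<and> (v, e) \<in> I'"
    and inc: "\<And>v. v \<in> V \<Longrightarrow> \<exists>e \<in> E. (v, e) \<in> I" "\<And>v. v \<in> V' \<Longrightarrow> \<exists>e \<in> E'. (v, e) \<in> I'"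
    and ccw: "\<And>v e f. (v, e, f) \<in> c \<Longrightarrow> (v, e) \<in> I \<and> (v, f) \<in> I"
      "\<And>v e f. (v, e, f) \<in> c' \<Longrightarrow> (v, e) \<in> I' \<and> (v, f) \<in> I'"
    and adj: "\<And>v e f. (v, e) \<in> I \<Longrightarrow> (v, f) \<in> I \<Longrightarrow> e = f \<or> (v, e, f) \<in> c \<or> (v, f, e) \<in> c"
      "\<And>v e f. (v, e) \<in> I' \<Longrightarrow> (v, f) \<in> I' \<Longrightarrow> e = f \<or> (v, e, f) \<in> c' \<or> (v, f, e) \<in> c'"
    and bij: "bij_betw \<psi> E E'"
    and succ: "\<And>e f. e \<in> E \<Longrightarrow> f \<in> E \<Longrightarrow> (\<exists>v \<in> V. (v, e, f) \<in> c) \<longleftrightarrow> (\<exists>v \<in> V'. (v, \<psi> e, \<psi> f) \<in> c')"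
  obtains \<phi> where "bij_betw \<phi> V V'"
    "\<And>v e. v \<in> V \<Longrightarrow> e \<in> E \<Longrightarrow> (v, e) \<in> I \<longleftrightarrow> (\<phi> v, \<psi> e) \<in> I'"
    "\<And>v e f. v \<in> V \<Longrightarrow> e \<in> E \<Longrightarrow> f \<in> E \<Longrightarrow> (v, e, f) \<in> c \<longleftrightarrow> (\<phi> v, \<psi> e, \<psi> f) \<in> c'"
proof -
  define vx where "vx e = (THE v. v \<in> V \<and> (v, e) \<in> I)" for e
  define vx' where "vx' e = (THE v. v \<in> V' \<and> (v, e) \<in> I')" for e
  have vx_in: "vx e \<in> V" "(vx e, e) \<in> I" if "e \<in> E" for e
    unfolding vx_def using theI'[OF ends(1)[OF that]] by blast+
  have vx'_in: "vx' e \<in> V'" "(vx' e, e) \<in> I'" if "e \<in> E'" for e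
    unfolding vx'_def using theI'[OF ends(2)[OF that]] by blast+
  have vx_iff: "(v, e) \<in> I \<longleftrightarrow> vx e = v" if "v \<in> V" "e \<in> E" for v e
    using ends(1)[OF that(2)] vx_in[OF that(2)] that by blast
  have vx'_iff: "(v, e) \<in> I' \<longleftrightarrow> vx' e = v" if "v \<in> V'" "e \<in> E'" for v e
    using ends(2)[OF that(2)] vx'_in[OF that(2)] that by blast
  have \<psi>: "\<psi> e \<in> E'" if "e \<in> E" for e using bij that by (auto simp: bij_betw_def)
  have \<psi>_inj: "\<psi> e = \<psi> f \<longleftrightarrow> e = f" if "e \<in> E" "f \<in> E" for e f
    using bij that by (auto simp: bij_betw_def inj_on_def)
  have ccw_vx: "vx e = v \<and> vx f = v" if "v \<in> V" "e \<in> E" "f \<in> E" "(v, e, f) \<in> c" for v e f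
    using ccw(1)[OF that(4)] vx_iff that by blast
  have ccw'_vx: "vx' e = v \<and> vx' f = v" if "v \<in> V'" "e \<in> E'" "f \<in> E'" "(v, e, f) \<in> c'" for v e f
    using ccw(2)[OF that(4)] vx'_iff that by blast
  have same: "vx e = vx f \<longleftrightarrow> vx' (\<psi> e) = vx' (\<psi> f)" if e: "e \<in> E" and f: "f \<in> E" for e f
  proof
    assume "vx e = vx f"
    then have "e = f \<or> (vx e, e, f) \<in> c \<or> (vx e, f, e) \<in> c" using adj(1) vx_in e f by metis
    then consider "e = f" | "\<exists>v \<in> V'. (v, \<psi> e, \<psi> f) \<in> c'" | "\<exists>v \<in> V'. (v, \<psi> f, \<psi> e) \<in> c'"
      using succ[OF e f] succ[OF f e] vx_in(1)[OF e] by blast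
    then show "vx' (\<psi> e) = vx' (\<psi> f)" using ccw'_vx \<psi> e f by cases metis+
  next
    assume "vx' (\<psi> e) = vx' (\<psi> f)"
    then have "\<psi> e = \<psi> f \<or> (vx' (\<psi> e), \<psi> e, \<psi> f) \<in> c' \<or> (vx' (\<psi> e), \<psi> f, \<psi> e) \<in> c'"
      using adj(2) vx'_in \<psi> e f by metis
    then consider "e = f" | "\<exists>v \<in> V. (v, e, f) \<in> c" | "\<exists>v \<in> V. (v, f, e) \<in> c"
      using succ[OF e f] succ[OF f e] vx'_in(1)[OF \<psi>[OF e]] \<psi>_inj[OF e f] by blast
    then show "vx e = vx f" using ccw_vx e f by cases metis+
  qed
  \<comment> \<open>Any edge at \<open>v\<close> may be chosen; by \<open>same\<close> the resulting
    vertex does not depend on the choice.\<close>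
  define \<phi> where "\<phi> v = vx' (\<psi> (SOME e. e \<in> E \<and> (v, e) \<in> I))" for v
  have \<phi>: "\<phi> (vx e) = vx' (\<psi> e)" if "e \<in> E" for e
  proof -
    have "\<exists>f. f \<in> E \<and> (vx e, f) \<in> I" using vx_in(2)[OF that] that by blast
    then have *: "(SOME f. f \<in> E \<and> (vx e, f) \<in> I) \<in> E \<and> (vx e, SOME f. f \<in> E \<and> (vx e, f) \<in> I) \<in> I"
      by (rule someI_ex)
    then have "vx (SOME f. f \<in> E \<and> (vx e, f) \<in> I) = vx e" using vx_iff vx_in(1)[OF that] by blast
    then show ?thesis unfolding \<phi>_def using same * that by blast
  qed
  have vertex: "\<exists>e \<in> E. v = vx e" if "v \<in> V" for v using inc(1)[OF that] vx_iff[OF that] by metis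
  have vertex': "\<exists>e \<in> E. v = vx' (\<psi> e)" if v: "v \<in> V'" for v
  proof -
    obtain e' where "e' \<in> E'" "vx' e' = v" using inc(2)[OF v] vx'_iff[OF v] by blast
    then show ?thesis using bij unfolding bij_betw_def by blast
  qed
  have bij\<phi>: "bij_betw \<phi> V V'"
    unfolding bij_betw_def
  proof
    show "inj_on \<phi> V"
    proof (rule inj_onI)
      fix u v assume uv: "u \<in> V" "v \<in> V" "\<phi> u = \<phi> v"
      obtain e f where "e \<in> E" "f \<in> E" "u = vx e" "v = vx f" using vertex uv by blast
      then show "u = v" using same \<phi> uv(3) by metis
    qed
    show "\<phi> ` V = V'"
    proof (intro set_eqI iffI)
      fix v assume "v \<in> \<phi> ` V"
      then obtain e where "e \<in> E" "v = vx' (\<psi> e)" using vertex \<phi> by (metis imageE)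
      then show "v \<in> V'" using vx'_in(1) \<psi> by blast
    next
      fix v assume "v \<in> V'"
      then obtain e where "e \<in> E" "v = vx' (\<psi> e)" using vertex' by blast
      then show "v \<in> \<phi> ` V" using \<phi> vx_in(1) by (metis imageI)
    qed
  qed
  then have \<phi>_in: "\<phi> v \<in> V'" if "v \<in> V" for v using that by (auto simp: bij_betw_def)
  have incid: "(v, e) \<in> I \<longleftrightarrow> (\<phi> v, \<psi> e) \<in> I'" if v: "v \<in> V" and e: "e \<in> E" for v e
  proof -
    obtain f where f: "f \<in> E" "v = vx f" using vertex[OF v] by blast
    have "(\<phi> v, \<psi> e) \<in> I' \<longleftrightarrow> vx' (\<psi> e) = vx' (\<psi> f)" using vx'_iff[OF \<phi>_in[OF v] \<psi>[OF e]] \<phi> f by simp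
    then show ?thesis using same[OF e f(1)] vx_iff[OF v e] f(2) by simp
  qed
  have "(v, e, f) \<in> c \<longleftrightarrow> (\<phi> v, \<psi> e, \<psi> f) \<in> c'" if v: "v \<in> V" and e: "e \<in> E" and f: "f \<in> E" for v e f
  proof
    assume vc: "(v, e, f) \<in> c"
    then obtain v' where v': "v' \<in> V'" "(v', \<psi> e, \<psi> f) \<in> c'" using succ[OF e f] v by blast
    have "v' = vx' (\<psi> e)" using ccw'_vx[OF v'(1) \<psi>[OF e] \<psi>[OF f] v'(2)] by simp
    also have "\<dots> = \<phi> v" using ccw_vx[OF v e f vc] \<phi>[OF e] by simp
    finally show "(\<phi> v, \<psi> e, \<psi> f) \<in> c'" using v'(2) by simp
  next
    assume vc: "(\<phi> v, \<psi> e, \<psi> f) \<in> c'"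
    then obtain u where u: "u \<in> V" "(u, e, f) \<in> c" using succ[OF e f] \<phi>_in[OF v] by blast
    have "(\<phi> v, \<psi> e) \<in> I'" using ccw(2)[OF vc] by simp
    then have "vx e = v" using incid[OF v e] vx_iff[OF v e] by simp
    then show "(v, e, f) \<in> c" using ccw_vx[OF u(1) e f u(2)] u(2) by simp
  qed
  then show ?thesis using that[OF bij\<phi>] incid by blast
qed

lemma web_isotopicI:
  assumes W: "well_formed W" and W': "well_formed W'" and bij: "bij_betw \<psi> (edges W) (edges W')"
    and succ: "\<And>e f. e \<in> edges W \<Longrightarrow> f \<in> edges W \<Longrightarrow> (e, f) \<in> black_succ W \<longleftrightarrow> (\<psi> e, \<psi> f) \<in> black_succ W'"
      "\<And>e f. e \<in> edges W \<Longrightarrow> f \<in> edges W \<Longrightarrow> (e, f) \<in> white_succ W \<longleftrightarrow> (\<psi> e, \<psi> f) \<in> white_succ W'"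
    and size: "rim_size W = rim_size W'"
    and rim: "\<And>i e. i \<in> {1..rim_size W} \<Longrightarrow> e \<in> edges W \<Longrightarrow> (rim W i, e) \<in> incid W \<longleftrightarrow> (rim W' i, \<psi> e) \<in> incid W'"
  shows "W \<simeq> W'"
proof -
  note D = well_formedD[OF W] and D' = well_formedD[OF W']
  obtain \<phi> where \<phi>: "bij_betw \<phi> (whites W) (whites W')"
    "\<And>v e. v \<in> whites W \<Longrightarrow> e \<in> edges W \<Longrightarrow> (v, e) \<in> incid W \<longleftrightarrow> (\<phi> v, \<psi> e) \<in> incid W'"
    "\<And>v e f. v \<in> whites W \<Longrightarrow> e \<in> edges W \<Longrightarrow> f \<in> edges W \<Longrightarrow> (v, e, f) \<in> ccw W \<longleftrightarrow> (\<phi> v, \<psi> e, \<psi> f) \<in> ccw W'"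
    by (rule vertex_bijection[OF D(2) D'(2) D(4) D'(4) D(6) D'(6) D(7) D'(7) bij])
      (use succ(2) in \<open>auto simp: white_succ_def\<close>)
  obtain \<chi> where \<chi>: "bij_betw \<chi> (blacks W) (blacks W')"
    "\<And>v e. v \<in> blacks W \<Longrightarrow> e \<in> edges W \<Longrightarrow> (v, e) \<in> incid W \<longleftrightarrow> (\<chi> v, \<psi> e) \<in> incid W'"
    "\<And>v e f. v \<in> blacks W \<Longrightarrow> e \<in> edges W \<Longrightarrow> f \<in> edges W \<Longrightarrow> (v, e, f) \<in> ccw W \<longleftrightarrow> (\<chi> v, \<psi> e, \<psi> f) \<in> ccw W'"
    by (rule vertex_bijection[OF D(3) D'(3) D(5) D'(5) D(6) D'(6) D(7) D'(7) bij])
      (use succ(1) in \<open>auto simp: black_succ_def\<close>)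
  define \<xi> where "\<xi> v = (if v \<in> whites W then \<phi> v else \<chi> v)" for v
  have \<xi>w: "\<xi> v = \<phi> v" if "v \<in> whites W" for v using that by (simp add: \<xi>_def)
  have \<xi>b: "\<xi> v = \<chi> v" if "v \<in> blacks W" for v using that D(1) by (auto simp: \<xi>_def)
  have bw: "bij_betw \<xi> (whites W) (whites W')" using \<phi>(1) \<xi>w by (simp cong: bij_betw_cong)
  have bb: "bij_betw \<xi> (blacks W) (blacks W')" using \<chi>(1) \<xi>b by (simp cong: bij_betw_cong)
  have rim_eq: "\<xi> (rim W i) = rim W' i" if i: "i \<in> {1..rim_size W}" for i
  proof -
    have r: "rim W i \<in> whites W" "rim W' i \<in> whites W'" using D(8) D'(8) i size by auto
    obtain e where e: "e \<in> edges W" "(rim W i, e) \<in> incid W" using D(4)[OF r(1)] by blast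
    then have "(\<xi> (rim W i), \<psi> e) \<in> incid W'" "(rim W' i, \<psi> e) \<in> incid W'"
      using \<phi>(2)[OF r(1) e(1)] \<xi>w[OF r(1)] rim[OF i e(1)] by auto
    moreover have "\<psi> e \<in> edges W'" using bij e(1) by (auto simp: bij_betw_def)
    moreover have "\<xi> (rim W i) \<in> whites W'" using bw r(1) by (auto simp: bij_betw_def)
    ultimately show ?thesis using D'(2) r(2) by blast
  qed
  show ?thesis
    unfolding web_isotopic_def
  proof (intro exI[of _ \<xi>] exI[of _ \<psi>] conjI ballI)
    show "bij_betw \<xi> (whites W \<union> blacks W) (whites W' \<union> blacks W')" by (rule bij_betw_combine[OF bw bb D'(1)])
    show "\<xi> ` whites W = whites W'" "\<xi> ` blacks W = blacks W'" using bw bb by (auto simp: bij_betw_def)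
    show "bij_betw \<psi> (edges W) (edges W')" by fact
    show "rim_size W = rim_size W'" by fact
    show "\<xi> (rim W i) = rim W' i" if "i \<in> {1..rim_size W}" for i by (rule rim_eq[OF that])
    fix v e assume v: "v \<in> whites W \<union> blacks W" and e: "e \<in> edges W"
    show "(v, e) \<in> incid W \<longleftrightarrow> (\<xi> v, \<psi> e) \<in> incid W'"
      using v \<phi>(2)[OF _ e, of v] \<chi>(2)[OF _ e, of v] \<xi>w[of v] \<xi>b[of v] by auto
    fix f assume f: "f \<in> edges W"
    show "(v, e, f) \<in> ccw W \<longleftrightarrow> (\<xi> v, \<psi> e, \<psi> f) \<in> ccw W'"
      using v \<phi>(3)[OF _ e f, of v] \<chi>(3)[OF _ e f, of v] \<xi>w[of v] \<xi>b[of v] by auto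
  qed
qed

lemma well_formed_rot: "well_formed W \<Longrightarrow> well_formed (rot W)"
  unfolding well_formed_def rot_def by auto

lemma well_formed_flip:
  assumes "well_formed W"
  shows "well_formed (flip W)"
proof -
  have "rim W (Suc (rim_size W) - i) \<in> whites W" if "Suc 0 \<le> i" "i \<le> rim_size W" for i
  proof (rule well_formedD(8)[OF assms])
    show "Suc (rim_size W) - i \<in> {1..rim_size W}" using that unfolding atLeastAtMost_iff by linarith
  qed
  then show ?thesis using assms unfolding well_formed_def flip_def by auto blast
qed

text \<open>The names of the run are the edges of the web itself. As \<open>rot\<close> and
  \<open>flip\<close> keep the edges, their effect becomes an equality of relations and lists,
  without any isomorphism.\<close>

definition built_by :: "letter list \<Rightarrow> ('v, 'e) web \<Rightarrow> ('e \<times> 'e \<times> 'e) list \<Rightarrow> 'e list \<Rightarrow> bool" where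
  "built_by w W ts rs \<longleftrightarrow> runs w ts blank (black_succ W, white_succ W, rs, []) \<and>
     distinct (names ts) \<and> set (names ts) = edges W \<and> length rs = rim_size W \<and>
     (\<forall>i \<in> {1..rim_size W}. \<forall>e \<in> edges W. (rim W i, e) \<in> incid W \<longleftrightarrow> e = rs ! (i - 1))"

lemma built_byD:
  assumes "built_by w W ts rs"
  shows "runs w ts blank (black_succ W, white_succ W, rs, [])"
    "distinct (names ts)" "set (names ts) = edges W" "length rs = rim_size W"
    "\<And>i e. i \<in> {1..rim_size W} \<Longrightarrow> e \<in> edges W \<Longrightarrow> (rim W i, e) \<in> incid W \<longleftrightarrow> e = rs ! (i - 1)"
  using assms unfolding built_by_def by blast+

definition built :: "letter list \<Rightarrow> ('v, 'e) web \<Rightarrow> bool" where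
  "built w W \<longleftrightarrow> well_formed W \<and> (\<exists>ts rs. built_by w W ts rs)"

text \<open>Both runs have distinct names, so they differ by a renaming, and a bijection of edges
  that respects both successor relations and the boundary induces the one of vertices.\<close>

lemma built_isotopic:
  fixes W :: "('v, 'e) web" and W' :: "('u, 'f) web"
  assumes "built w W" "built w W'"
  shows "W \<simeq> W'"
proof -
  from assms(1) obtain ts rs where 1: "built_by w W ts rs" unfolding built_def by blast
  note 1 = built_byD[OF 1]
  from assms(2) obtain ts' rs' where 2: "built_by w W' ts' rs'" unfolding built_def by blast
  note 2 = built_byD[OF 2]
  have wf: "well_formed W" "well_formed W'" using assms by (auto simp: built_def)
  obtain f where f: "bij_betw f (edges W) (edges W')"
    "black_succ W' = map_prod f f ` black_succ W" "white_succ W' = map_prod f f ` white_succ W" "rs' = map f rs"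
    using runs_rename[OF 1(1) 2(1) 1(2) 2(2)] 1(3) 2(3) by auto
  have inj: "f e = f e' \<longleftrightarrow> e = e'" if "e \<in> edges W" "e' \<in> edges W" for e e'
    using f(1) that by (auto simp: bij_betw_def inj_on_def)
  have succ_edges: "e \<in> edges W \<and> e' \<in> edges W" if "(e, e') \<in> black_succ W \<union> white_succ W" for e e'
    using that well_formedD(6,9)[OF wf(1)] unfolding black_succ_def white_succ_def by blast
  have image: "(e, e') \<in> S \<longleftrightarrow> (f e, f e') \<in> map_prod f f ` S"
    if S: "S \<subseteq> black_succ W \<union> white_succ W" and e: "e \<in> edges W" "e' \<in> edges W" for S e e'
  proof
    assume "(f e, f e') \<in> map_prod f f ` S"
    then obtain a b where ab: "(a, b) \<in> S" "f e = f a" "f e' = f b" by auto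
    then have "a \<in> edges W" "b \<in> edges W" using succ_edges S by blast+
    then show "(e, e') \<in> S" using ab inj e by metis
  qed auto
  have size: "rim_size W = rim_size W'" using 1(4) 2(4) f(4) by simp
  show ?thesis
  proof (rule web_isotopicI[OF wf f(1) _ _ size])
    fix e e' assume e: "e \<in> edges W" "e' \<in> edges W"
    show "(e, e') \<in> black_succ W \<longleftrightarrow> (f e, f e') \<in> black_succ W'" unfolding f(2) by (rule image) (use e in auto)
    show "(e, e') \<in> white_succ W \<longleftrightarrow> (f e, f e') \<in> white_succ W'" unfolding f(3) by (rule image) (use e in auto)
  next
    fix i e assume i: "i \<in> {1..rim_size W}" and e: "e \<in> edges W"
    obtain e0 where e0: "e0 \<in> edges W" "(rim W i, e0) \<in> incid W"
      using well_formedD(4)[OF wf(1) well_formedD(8)[OF wf(1) i]] by blast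
    then have rs: "rs ! (i - 1) = e0" using 1(5)[OF i] by blast
    have "i - 1 < length rs" using i unfolding 1(4) atLeastAtMost_iff by linarith
    then have "rs' ! (i - 1) = f e0" unfolding f(4) using rs by simp
    moreover have "f e \<in> edges W'" using f(1) e by (auto simp: bij_betw_def)
    ultimately have "(rim W' i, f e) \<in> incid W' \<longleftrightarrow> f e = f e0" using 2(5)[of i "f e"] i size by simp
    then show "(rim W i, e) \<in> incid W \<longleftrightarrow> (rim W' i, f e) \<in> incid W'"
      using 1(5)[OF i e] rs inj[OF e e0(1)] by simp
  qed
qed

text \<open>Relabelling leaves both successor relations as they are and moves the first boundary
  edge to the end, which is the outcome of running the promoted word on the same edges.\<close>

lemma built_rot:
  assumes "built (a # xs) W" "slide [] A xs = (p, v)"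
  shows "built (p @ [v]) (rot W)"
proof -
  from assms(1) obtain ts rs where 1: "built_by (a # xs) W ts rs" unfolding built_def by blast
  note 1 = built_byD[OF 1]
  obtain ts' r rs' where 2: "rs = r # rs'" "runs (p @ [v]) ts' blank (black_succ W, white_succ W, rs' @ [r], [])"
    "mset (names ts') = mset (names ts)" using runs_promote[OF 1(1) assms(2)] by blast
  have succ: "black_succ (rot W) = black_succ W" "white_succ (rot W) = white_succ W"
    by (simp_all add: black_succ_def white_succ_def rot_def)
  have rim: "(rim (rot W) i, e) \<in> incid W \<longleftrightarrow> e = (rs' @ [r]) ! (i - 1)"
    if i: "i \<in> {1..rim_size W}" and e: "e \<in> edges W" for i e
  proof (cases "i = rim_size W")
    case True
    have "(rim W 1, e) \<in> incid W \<longleftrightarrow> e = rs ! 0" using 1(5)[of 1 e] i e by simp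
    moreover have "i - 1 = length rs'" using True 2(1) 1(4) by simp
    then have "(rs' @ [r]) ! (i - 1) = r" by simp
    ultimately show ?thesis using True 2(1) by (simp add: rot_def)
  next
    case False
    then have "(rim W (i + 1), e) \<in> incid W \<longleftrightarrow> e = rs ! i" using 1(5)[of "i + 1" e] i e by simp
    moreover have "(rs' @ [r]) ! (i - 1) = rs ! i" using False 2(1) 1(4) i by (cases i) (auto simp: nth_append)
    ultimately show ?thesis using False by (simp add: rot_def)
  qed
  have "distinct (names ts')" "set (names ts') = edges W"
    using 1(2,3) 2(3) by (metis mset_eq_imp_distinct_iff, metis mset_eq_setD)
  moreover have "well_formed (rot W)" using assms(1) well_formed_rot by (auto simp: built_def)
  moreover have "rim_size (rot W) = rim_size W" "edges (rot W) = edges W" "incid (rot W) = incid W"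
    by (simp_all add: rot_def)
  moreover have "length (rs' @ [r]) = rim_size W" using 1(4) 2(1) by simp
  ultimately show ?thesis unfolding built_def built_by_def succ using 2(2) rim by metis
qed

text \<open>Reversed cyclic orders give converse relations and reversed labels the reversed boundary
  list, so flipping the web is mirroring its diagram.\<close>

lemma built_flip:
  assumes "built w W"
  shows "built (evacuate w) (flip W)"
proof -
  from assms(1) obtain ts rs where 1: "built_by w W ts rs" unfolding built_def by blast
  note 1 = built_byD[OF 1]
  have succ: "black_succ (flip W) = (black_succ W)\<inverse>" "white_succ (flip W) = (white_succ W)\<inverse>"
    by (auto simp: black_succ_def white_succ_def flip_def)
  obtain ts' where 2: "runs (evacuate w) ts' blank (black_succ (flip W), white_succ (flip W), rev rs, [])"
    "mset (names ts') = mset (names ts)" using runs_evacuate[OF 1(1)] unfolding succ by auto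
  have rim: "(rim (flip W) i, e) \<in> incid W \<longleftrightarrow> e = rev rs ! (i - 1)"
    if i: "i \<in> {1..rim_size W}" and e: "e \<in> edges W" for i e
  proof -
    have "(rim W (rim_size W + 1 - i), e) \<in> incid W \<longleftrightarrow> e = rs ! (rim_size W + 1 - i - 1)"
    proof (rule 1(5)[OF _ e])
      show "rim_size W + 1 - i \<in> {1..rim_size W}" using i unfolding atLeastAtMost_iff by linarith
    qed
    moreover have "rev rs ! (i - 1) = rs ! (rim_size W + 1 - i - 1)"
      using i 1(4) by (subst rev_nth) auto
    ultimately show ?thesis by (simp add: flip_def)
  qed
  have "distinct (names ts')" "set (names ts') = edges W"
    using 1(2,3) 2(2) by (metis mset_eq_imp_distinct_iff, metis mset_eq_setD)
  moreover have "well_formed (flip W)" using assms(1) well_formed_flip by (auto simp: built_def)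
  moreover have "rim_size (flip W) = rim_size W" "edges (flip W) = edges W" "incid (flip W) = incid W"
    by (simp_all add: flip_def)
  moreover have "length (rev rs) = rim_size W" using 1(4) by simp
  ultimately show ?thesis unfolding built_def built_by_def using 2(1) rim by metis
qed

context bump_diagram begin

lemma run_prefix:
  "k \<le> length w \<Longrightarrow> \<exists>ps. distinct ps \<and> set ps = crossings k \<and>
    runs (take k w) (map trip ps) blank (drawn k)"
proof (induction k)
  case 0
  have "0 < fst \<alpha> \<and> 0 < snd \<alpha>" if "\<alpha> \<in> arcs w" for \<alpha> using arc(1,2)[OF that] by linarith
  then have "crossings 0 = {}" by (auto simp: crossings_def)
  then have "drawn 0 = blank" by (simp add: drawn_def)
  then show ?case using runs_Nil \<open>crossings 0 = {}\<close> by (intro exI[of _ "[]"]) simp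
next
  case (Suc k)
  then obtain ps where ps: "distinct ps" "set ps = crossings k"
    "runs (take k w) (map trip ps) blank (drawn k)" by auto
  have k: "k < length w" using Suc.prems by simp
  obtain qs where qs: "distinct qs" "set qs = crossings (Suc k) - crossings k"
    "step (letter_at w (Suc k)) (map trip qs) (drawn k) (drawn (Suc k))"
  proof (cases "letter_at w (Suc k) = A")
    case True
    show ?thesis
    proof (rule that[of "[(low (Suc k), high (Suc k))]"])
      show "set [(low (Suc k), high (Suc k))] = crossings (Suc k) - crossings k"
        using crossings_fork[OF k True] by auto
      show "step (letter_at w (Suc k)) (map trip [(low (Suc k), high (Suc k))]) (drawn k) (drawn (Suc k))"
        using drawn_fork[OF k True] True by simp
    qed simp
  next
    case False
    then show ?thesis using drawn_close[OF k] that by blast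
  qed
  have "crossings k \<subseteq> crossings (Suc k)" by (auto simp: crossings_def)
  then have "distinct (ps @ qs)" "set (ps @ qs) = crossings (Suc k)" using ps qs by auto
  moreover have "runs (take (Suc k) w) (map trip (ps @ qs)) blank (drawn (Suc k))"
    using runs_snoc[OF ps(3) qs(3)] by (simp add: take_Suc_letter_at[OF k])
  ultimately show ?case by blast
qed

section \<open>The finished drawing has the edges and relations of the web\<close>

lemma all_crossings: "crossings (length w) = {(\<alpha>, \<beta>). \<alpha> \<in> arcs w \<and> \<beta> \<in> arcs w \<and> crosses \<alpha> \<beta>}"
proof -
  have "fst \<alpha> \<le> length w \<and> snd \<alpha> \<le> length w" if "\<alpha> \<in> arcs w" for \<alpha> using arc(2,3)[OF that] by simp
  then show ?thesis by (auto simp: crossings_def)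
qed

text \<open>No third arc passes through a meeting point, so the point determines the two arcs, and
  \<open>crosses\<close> is asymmetric.\<close>

lemma crossing_inj:
  assumes "(\<alpha>, \<beta>) \<in> crossings k" "(\<gamma>, \<delta>) \<in> crossings k'" "meet \<alpha> \<beta> = meet \<gamma> \<delta>"
  shows "\<gamma> = \<alpha> \<and> \<delta> = \<beta>"
proof -
  have 1: "\<alpha> \<in> arcs w" "\<beta> \<in> arcs w" "crosses \<alpha> \<beta>" "\<gamma> \<in> arcs w" "\<delta> \<in> arcs w" "crosses \<gamma> \<delta>"
    using assms by (auto simp: crossings_def)
  then have t: "touches \<alpha> \<beta>" "touches \<gamma> \<delta>" by (simp_all add: touches_def)
  then have "\<alpha> \<noteq> \<beta>" using touches_irrefl by blast
  then have "\<gamma> = \<alpha> \<or> \<gamma> = \<beta>" "\<delta> = \<alpha> \<or> \<delta> = \<beta>"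
    using no_triple_point[OF 1(1,2,4)] no_triple_point[OF 1(1,2,5)] meet_in[OF 1(1,2) t(1)] meet_in[OF 1(4,5) t(2)]
      assms(3) by auto
  then show ?thesis using 1(3,6) by (auto simp: crosses_def)
qed

lemma trip_names:
  "e \<in> set (names (map trip ps)) \<longleftrightarrow> (\<exists>\<alpha> \<beta>. (\<alpha>, \<beta>) \<in> set ps \<and>
    (e = Join (meet \<alpha> \<beta>) \<or> e = Seg \<alpha> (meet \<alpha> \<beta>) \<or> e = Seg \<beta> (meet \<alpha> \<beta>)))"
proof -
  have "e \<in> set (names (map trip ps)) \<longleftrightarrow> (\<exists>p \<in> set ps. e \<in> set (names [trip p]))"
    by (simp add: names_def)
  also have "\<dots> \<longleftrightarrow> (\<exists>\<alpha> \<beta>. (\<alpha>, \<beta>) \<in> set ps \<and> e \<in> set (names [trip (\<alpha>, \<beta>)]))"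
    by (metis surj_pair)
  finally show ?thesis by simp
qed

lemma distinct_trip_names:
  "distinct ps \<Longrightarrow> set ps \<subseteq> crossings k \<Longrightarrow> distinct (names (map trip ps))"
proof (induction ps)
  case (Cons p ps)
  obtain \<alpha> \<beta> where p: "p = (\<alpha>, \<beta>)" by (metis surj_pair)
  \<comment> \<open>Every name in the triple of a crossing contains the meeting point, and this
    point identifies the crossing.\<close>
  define pt where "pt e = (case e of Join z \<Rightarrow> z | Seg _ z \<Rightarrow> z)" for e
  have pt: "\<exists>\<gamma> \<delta>. (\<gamma>, \<delta>) \<in> set qs \<and> pt e = meet \<gamma> \<delta>" if "e \<in> set (names (map trip qs))" for e qs
    using that unfolding trip_names pt_def by fastforce
  have "pt e \<noteq> meet \<alpha> \<beta>" if mem: "e \<in> set (names (map trip ps))" for e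
  proof
    assume e: "pt e = meet \<alpha> \<beta>"
    obtain \<gamma> \<delta> where g: "(\<gamma>, \<delta>) \<in> set ps" "pt e = meet \<gamma> \<delta>" using pt[OF mem] by blast
    then have "(\<gamma>, \<delta>) = (\<alpha>, \<beta>)" using crossing_inj[of \<alpha> \<beta> k \<gamma> \<delta> k] Cons.prems(2) p e by auto
    then show False using g(1) Cons.prems(1) p by simp
  qed
  then have "e \<notin> set (names (map trip ps))" if "pt e = meet \<alpha> \<beta>" for e using that by blast
  moreover have "\<alpha> \<noteq> \<beta>" using Cons.prems(2) p by (auto simp: crossings_def crosses_def)
  ultimately show ?case using Cons p by (simp add: pt_def)
qed simp

lemma edges_eq:
  assumes "set ps = crossings (length w)"
  shows "set (names (map trip ps)) = edges (kreweras_web w)"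
proof -
  have seg: "(\<exists>z. segment w \<alpha> y z) \<longleftrightarrow> (\<exists>\<beta>. \<alpha> \<in> arcs w \<and> \<beta> \<in> arcs w \<and> touches \<alpha> \<beta> \<and> y = meet \<alpha> \<beta>)" for \<alpha> y
    using segment_start segment_end_exists by metis
  have "e \<in> set (names (map trip ps)) \<longleftrightarrow> e \<in> Join ` meetings w \<union> {Seg \<alpha> y |\<alpha> y. \<exists>z. segment w \<alpha> y z}" for e
  proof
    assume "e \<in> set (names (map trip ps))"
    then obtain \<alpha> \<beta> where *: "\<alpha> \<in> arcs w" "\<beta> \<in> arcs w" "crosses \<alpha> \<beta>"
      "e = Join (meet \<alpha> \<beta>) \<or> e = Seg \<alpha> (meet \<alpha> \<beta>) \<or> e = Seg \<beta> (meet \<alpha> \<beta>)"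
      unfolding trip_names assms all_crossings by blast
    then have t: "touches \<alpha> \<beta>" "touches \<beta> \<alpha>" by (simp_all add: touches_def)
    have "\<exists>z. segment w \<alpha> (meet \<alpha> \<beta>) z" "\<exists>z. segment w \<beta> (meet \<alpha> \<beta>) z"
      unfolding seg using * t meet_sym by blast+
    then show "e \<in> Join ` meetings w \<union> {Seg \<alpha> y |\<alpha> y. \<exists>z. segment w \<alpha> y z}"
      using *(4) meet_in_meetings[OF *(1,2) t(1)] by blast
  next
    assume "e \<in> Join ` meetings w \<union> {Seg \<alpha> y |\<alpha> y. \<exists>z. segment w \<alpha> y z}"
    then consider z where "z \<in> meetings w" "e = Join z" | \<alpha> \<beta> where "\<alpha> \<in> arcs w" "\<beta> \<in> arcs w" "touches \<alpha> \<beta>"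
      "e = Seg \<alpha> (meet \<alpha> \<beta>)" unfolding seg by blast
    then show "e \<in> set (names (map trip ps))"
    proof cases
      case 1
      then show ?thesis unfolding trip_names assms all_crossings meetings_eq by blast
    next
      case 2
      then have "(\<alpha>, \<beta>) \<in> set ps \<or> (\<beta>, \<alpha>) \<in> set ps" unfolding assms all_crossings touches_def by blast
      then show ?thesis unfolding trip_names using 2(4) meet_sym by metis
    qed
  qed
  then show ?thesis by (auto simp: kreweras_web_def)
qed

lemma black_succ_eq: "black_succ (kreweras_web w) = \<Union> (black_rel ` crossings (length w))"
proof (intro set_eqI iffI; clarify)
  fix e f assume "(e, f) \<in> black_succ (kreweras_web w)"
  then obtain z where "(Black z, e, f) \<in> web_ccw w" by (auto simp: black_succ_def kreweras_web_def)
  then obtain \<alpha> \<beta> where *: "\<alpha> \<in> arcs w" "\<beta> \<in> arcs w" "crosses \<alpha> \<beta>" "z \<in> curve \<alpha>" "z \<in> curve \<beta>"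
    "(e, f) \<in> {(Join z, Seg \<alpha> z), (Seg \<alpha> z, Seg \<beta> z), (Seg \<beta> z, Join z)}"
    by (cases rule: web_ccw.cases) auto
  have "\<alpha> \<noteq> \<beta>" using *(3) by (auto simp: crosses_def)
  then have "z = meet \<alpha> \<beta>" using meet_eqI(2) * by blast
  then have "(e, f) \<in> black_rel (\<alpha>, \<beta>)" using *(6) by (auto simp: cyc_def)
  then show "(e, f) \<in> \<Union> (black_rel ` crossings (length w))" using * all_crossings by blast
next
  fix e f \<alpha> \<beta> assume c: "(\<alpha>, \<beta>) \<in> crossings (length w)" and ef: "(e, f) \<in> black_rel (\<alpha>, \<beta>)"
  have *: "\<alpha> \<in> arcs w" "\<beta> \<in> arcs w" "crosses \<alpha> \<beta>" using c all_crossings by auto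
  then have t: "touches \<alpha> \<beta>" by (simp add: touches_def)
  have "(Black (meet \<alpha> \<beta>), e, f) \<in> web_ccw w"
    by (rule web_ccw.intros(1)[OF *]) (use meet_in[OF *(1,2) t] ef in \<open>auto simp: cyc_def\<close>)
  then show "(e, f) \<in> black_succ (kreweras_web w)"
    using meet_in_meetings[OF *(1,2) t] by (auto simp: black_succ_def kreweras_web_def)
qed

lemma white_succ_eq:
  "white_succ (kreweras_web w) = \<Union> (white_rel w ` crossings (length w)) \<union> (\<lambda>i. (rim_edge i, rim_edge i)) ` {1..length w}"
proof (intro set_eqI iffI)
  fix p assume p: "p \<in> white_succ (kreweras_web w)"
  obtain e f where ef: "p = (e, f)" by (metis surj_pair)
  then obtain z where "(White z, e, f) \<in> web_ccw w" using p by (auto simp: white_succ_def kreweras_web_def)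
  then consider \<alpha> \<beta> x y where "crosses \<alpha> \<beta>" "fst \<alpha> < fst \<beta>" "z \<in> curve \<alpha>" "z \<in> curve \<beta>" "segment w \<alpha> x z" "segment w \<beta> y z"
      "(e, f) \<in> {(Seg \<alpha> x, Seg \<beta> y), (Seg \<beta> y, Join z), (Join z, Seg \<alpha> x)}"
    | "z \<in> positions w" "(White z, e) \<in> web_incid w" "f = e"
    by (cases rule: web_ccw.cases) auto
  then show "p \<in> \<Union> (white_rel w ` crossings (length w)) \<union> (\<lambda>i. (rim_edge i, rim_edge i)) ` {1..length w}"
  proof cases
    case 1
    have ab: "\<alpha> \<in> arcs w" "\<beta> \<in> arcs w" using 1 by (auto simp: segment_def)
    have "z = meet \<alpha> \<beta>" using meet_eqI(2)[OF ab] 1(2-4) by auto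
    then have "(e, f) \<in> white_rel w (\<alpha>, \<beta>)" using white_rel_eq[OF 1(2)] 1(5-7) by (auto simp: cyc_def simp del: white_rel.simps)
    moreover have "(\<alpha>, \<beta>) \<in> crossings (length w)" using all_crossings ab 1(1) by simp
    ultimately show ?thesis using ef by blast
  next
    case 2
    then obtain i where i: "z = of_nat i" "i \<in> {1..length w}" by (auto simp: positions_def)
    then have "e = rim_edge i" using rim_edge[of i e] 2(2) by simp
    then show ?thesis using ef 2(3) i(2) by blast
  qed
next
  fix p assume "p \<in> \<Union> (white_rel w ` crossings (length w)) \<union> (\<lambda>i. (rim_edge i, rim_edge i)) ` {1..length w}"
  then consider \<alpha> \<beta> where "(\<alpha>, \<beta>) \<in> crossings (length w)" "p \<in> white_rel w (\<alpha>, \<beta>)"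
    | i where "i \<in> {1..length w}" "p = (rim_edge i, rim_edge i)" by (auto simp del: white_rel.simps)
  then show "p \<in> white_succ (kreweras_web w)"
  proof cases
    case 1
    have *: "\<alpha> \<in> arcs w" "\<beta> \<in> arcs w" "crosses \<alpha> \<beta>" using 1(1) all_crossings by auto
    then have t: "touches \<alpha> \<beta>" by (simp add: touches_def)
    obtain x y where xy: "p \<in> cyc (Seg \<alpha> x) (Seg \<beta> y) (Join (meet \<alpha> \<beta>))" "fst \<alpha> < fst \<beta>"
      "segment w \<alpha> x (meet \<alpha> \<beta>)" "segment w \<beta> y (meet \<alpha> \<beta>)" using 1(2) by auto
    obtain e f where ef: "p = (e, f)" by (metis surj_pair)
    have "(White (meet \<alpha> \<beta>), e, f) \<in> web_ccw w"
      by (rule web_ccw.intros(2)[OF *(3) xy(2) _ xy(3,4)]) (use meet_in[OF *(1,2) t] ef xy(1) in \<open>auto simp: cyc_def\<close>)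
    then show ?thesis using meet_in_meetings[OF *(1,2) t] ef by (auto simp: white_succ_def kreweras_web_def)
  next
    case 2
    have z: "of_nat i \<in> positions w" using 2(1) by (auto simp: positions_def)
    have "(White (of_nat i), rim_edge i) \<in> web_incid w" using rim_edge[of i "rim_edge i"] 2(1) by simp
    then have "(White (of_nat i), rim_edge i, rim_edge i) \<in> web_ccw w" by (rule web_ccw.intros(3)[OF z])
    then show ?thesis using 2(2) z by (auto simp: white_succ_def kreweras_web_def)
  qed
qed

lemma well_formed_kreweras_web: "well_formed (kreweras_web w)"
proof -
  define W where "W = kreweras_web w"
  have W: "whites W = White ` (meetings w \<union> positions w)" "blacks W = Black ` meetings w"
    "edges W = Join ` meetings w \<union> {Seg \<alpha> y |\<alpha> y. \<exists>z. segment w \<alpha> y z}"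
    "incid W = web_incid w" "ccw W = web_ccw w" "rim_size W = length w" "rim W = (\<lambda>i. White (of_nat i))"
    by (simp_all add: W_def kreweras_web_def)
  have start: "y \<in> meetings w" if "segment w \<alpha> y z" for \<alpha> y z
    by (rule segment_start[OF that]) (use meet_in_meetings in simp)
  have fin: "z \<in> meetings w \<union> positions w" if "segment w \<alpha> y z" for \<alpha> y z
    using that by (auto simp: segment_def marks_def)
  have meet_segs: "\<alpha> = \<beta> \<or> \<alpha> = \<gamma>" if "\<beta> \<in> arcs w" "\<gamma> \<in> arcs w" "crosses \<beta> \<gamma>" "z = meet \<beta> \<gamma>"
      "\<alpha> \<in> arcs w" "z \<in> curve \<alpha>" for \<alpha> \<beta> \<gamma> z
  proof -
    have "touches \<beta> \<gamma>" using that(3) by (simp add: touches_def)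
    moreover have "\<beta> \<noteq> \<gamma>" using that(3) by (auto simp: crosses_def)
    ultimately show ?thesis using no_triple_point[OF that(1,2,5)] meet_in[OF that(1,2)] that(4,6) by blast
  qed
  have white: "\<exists>!v. v \<in> whites W \<and> (v, e) \<in> incid W" if e: "e \<in> edges W" for e
    unfolding W(1,4)
  proof (cases e)
    case (Join z)
    then have "z \<in> meetings w" using e W(3) by auto
    then show "\<exists>!v. v \<in> White ` (meetings w \<union> positions w) \<and> (v, e) \<in> web_incid w"
      unfolding Join by (intro ex1I[of _ "White z"]) (auto simp: incid_White)
  next
    case (Seg \<alpha> y)
    then obtain z where z: "segment w \<alpha> y z" using e W(3) by auto
    show "\<exists>!v. v \<in> White ` (meetings w \<union> positions w) \<and> (v, e) \<in> web_incid w"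
      unfolding Seg
    proof (rule ex1I[of _ "White z"])
      show "White z \<in> White ` (meetings w \<union> positions w) \<and> (White z, Seg \<alpha> y) \<in> web_incid w"
        using fin[OF z] z unfolding incid_White by blast
      fix v assume "v \<in> White ` (meetings w \<union> positions w) \<and> (v, Seg \<alpha> y) \<in> web_incid w"
      then obtain z' where v: "v = White z'" and "(White z', Seg \<alpha> y) \<in> web_incid w" by blast
      then have "segment w \<alpha> y z'" unfolding incid_White by blast
      then show "v = White z" using segment_unique[OF _ z] v by blast
    qed
  qed
  have black: "\<exists>!v. v \<in> blacks W \<and> (v, e) \<in> incid W" if e: "e \<in> edges W" for e
    unfolding W(2,4)
  proof (cases e)
    case (Join z)
    then have "z \<in> meetings w" using e W(3) by auto
    then show "\<exists>!v. v \<in> Black ` meetings w \<and> (v, e) \<in> web_incid w"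
      unfolding Join by (intro ex1I[of _ "Black z"]) (auto simp: incid_Black)
  next
    case (Seg \<alpha> y)
    then obtain z where z: "segment w \<alpha> y z" using e W(3) by auto
    show "\<exists>!v. v \<in> Black ` meetings w \<and> (v, e) \<in> web_incid w"
      unfolding Seg
    proof (rule ex1I[of _ "Black y"])
      show "Black y \<in> Black ` meetings w \<and> (Black y, Seg \<alpha> y) \<in> web_incid w"
        using start[OF z] z unfolding incid_Black by blast
      fix v assume "v \<in> Black ` meetings w \<and> (v, Seg \<alpha> y) \<in> web_incid w"
      then show "v = Black y" unfolding incid_Black by (auto simp: incid_Black)
    qed
  qed
  have in_edges: "e \<in> edges W" if "(v, e) \<in> web_incid w" for v e
    using that unfolding W(3) by (cases rule: web_incid.cases) blast+
  have inc: "\<exists>e \<in> edges W. (v, e) \<in> incid W" if v: "v \<in> whites W \<union> blacks W" for v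
  proof -
    from v consider z where "v = White z" "z \<in> meetings w" | i where "v = White (of_nat i)" "i \<in> {1..length w}"
      | z where "v = Black z" "z \<in> meetings w" unfolding W(1,2) positions_def by blast
    then have "\<exists>e. (v, e) \<in> web_incid w"
    proof cases
      case 2
      then show ?thesis using rim_edge[of i "rim_edge i"] by auto
    qed (use web_incid.intros in blast)+
    then show ?thesis using in_edges W(4) by auto
  qed
  have ccw: "(v, e) \<in> incid W \<and> (v, f) \<in> incid W" if "(v, e, f) \<in> ccw W" for v e f
    using that[unfolded W(5)]
  proof cases
    case (1 \<alpha> \<beta> z)
    have "\<alpha> \<noteq> \<beta>" using 1(4) by (auto simp: crosses_def)
    then have t: "touches \<alpha> \<beta>" "z = meet \<alpha> \<beta>" using meet_eqI[OF 1(2,3)] 1(5) by auto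
    have "z \<in> meetings w" using meet_in_meetings[OF 1(2,3) t(1)] t(2) by simp
    moreover have "\<exists>y. segment w \<alpha> z y" "\<exists>y. segment w \<beta> z y"
      using segment_end_exists[OF 1(2,3) t(1)] segment_end_exists[OF 1(3,2)] t touches_sym meet_sym by metis+
    moreover have "e = Join z \<and> f = Seg \<alpha> z \<or> e = Seg \<alpha> z \<and> f = Seg \<beta> z \<or> e = Seg \<beta> z \<and> f = Join z"
      using 1(6) by simp
    ultimately show ?thesis unfolding W(4) 1(1) incid_Black by blast
  next
    case (2 \<alpha> \<beta> z x y)
    have ab: "\<alpha> \<in> arcs w" "\<beta> \<in> arcs w" using 2 by (auto simp: segment_def)
    have "z \<in> meetings w" using ab 2(2,4) unfolding meetings_def by blast
    moreover have "e = Seg \<alpha> x \<and> f = Seg \<beta> y \<or> e = Seg \<beta> y \<and> f = Join z \<or> e = Join z \<and> f = Seg \<alpha> x"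
      using 2(7) by simp
    ultimately show ?thesis unfolding W(4) 2(1) incid_White using 2(5,6) by blast
  next
    case (3 z)
    then show ?thesis using W(4) by simp
  qed
  have adj: "e = f \<or> (v, e, f) \<in> ccw W \<or> (v, f, e) \<in> ccw W" if e: "(v, e) \<in> incid W" and f: "(v, f) \<in> incid W" for v e f
  proof (cases v)
    case (Black z)
    have z: "z \<in> meetings w" using e start unfolding W(4) Black incid_Black by blast
    then obtain \<beta> \<gamma> where bc: "\<beta> \<in> arcs w" "\<gamma> \<in> arcs w" "crosses \<beta> \<gamma>" "z \<in> curve \<beta> \<inter> curve \<gamma>"
      unfolding meetings_def by blast
    then have zm: "z = meet \<beta> \<gamma>" using meet_eqI(2)[OF bc(1,2)] by (auto simp: crosses_def)
    have cases: "g = Join z \<or> g = Seg \<beta> z \<or> g = Seg \<gamma> z" if g: "(Black z, g) \<in> web_incid w" for g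
    proof -
      from g consider "g = Join z" | \<alpha> z' where "segment w \<alpha> z z'" "g = Seg \<alpha> z" unfolding incid_Black by blast
      then show ?thesis
      proof cases
        case 2
        then have "\<alpha> = \<beta> \<or> \<alpha> = \<gamma>" using meet_segs[OF bc(1-3) zm] by (auto simp: segment_def marks_def)
        then show ?thesis using 2(2) by blast
      qed simp
    qed
    have c: "(Black z, Join z, Seg \<beta> z) \<in> web_ccw w" "(Black z, Seg \<beta> z, Seg \<gamma> z) \<in> web_ccw w"
      "(Black z, Seg \<gamma> z, Join z) \<in> web_ccw w" by (rule web_ccw.intros(1)[OF bc]; simp)+
    show ?thesis using cases[of e] cases[of f] e f c unfolding W(4,5) Black by blast
  next
    case (White z)
    show ?thesis
    proof (cases "z \<in> positions w")
      case True
      then obtain i where "z = of_nat i" "i \<in> {1..length w}" by (auto simp: positions_def)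
      then show ?thesis using rim_edge[of i e] rim_edge[of i f] e f unfolding W(4) White by auto
    next
      case False
      then have "z \<in> meetings w" using e fin unfolding W(4) White incid_White by blast
      then obtain \<beta> \<gamma> where bc: "\<beta> \<in> arcs w" "\<gamma> \<in> arcs w" "crosses \<beta> \<gamma>" "z \<in> curve \<beta> \<inter> curve \<gamma>"
        unfolding meetings_def by blast
      have ne: "\<beta> \<noteq> \<gamma>" using bc(3) by (auto simp: crosses_def)
      then have zm: "z = meet \<beta> \<gamma>" "touches \<beta> \<gamma>" using meet_eqI[OF bc(1,2)] bc(4) by auto
      have not_fst: "z \<noteq> of_nat (fst \<alpha>)" if "\<alpha> \<in> arcs w" for \<alpha>
      proof -
        have "of_nat (fst \<alpha>) \<in> positions w" using arc(1-3)[OF that] by (simp add: positions_def)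
        then show ?thesis using False by blast
      qed
      have "fst \<beta> \<noteq> fst \<gamma>" using meet_same_fst(1)[OF bc(1,2) ne] not_fst[OF bc(1)] zm(1) by auto
      then have lt: "fst \<beta> < fst \<gamma>" using bc(3) by (simp add: crosses_def)
      have "z \<in> marks w \<beta>" "z \<in> marks w \<gamma>" using bc \<open>z \<in> meetings w\<close> by (auto simp: marks_def)
      then obtain x y where xy: "segment w \<beta> x z" "segment w \<gamma> y z"
        using segment_start_exists bc(1,2) not_fst by meson
      have cases: "g = Join z \<or> g = Seg \<beta> x \<or> g = Seg \<gamma> y" if g: "(White z, g) \<in> web_incid w" for g
      proof -
        from g consider "g = Join z" | \<alpha> z' where "segment w \<alpha> z' z" "g = Seg \<alpha> z'" unfolding incid_White by blast
        then show ?thesis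
        proof cases
          case 2
          then have "\<alpha> = \<beta> \<or> \<alpha> = \<gamma>" using meet_segs[OF bc(1-3) zm(1)] by (auto simp: segment_def marks_def)
          then show ?thesis using 2 xy segment_unique by blast
        qed simp
      qed
      have c: "(White z, Seg \<beta> x, Seg \<gamma> y) \<in> web_ccw w" "(White z, Seg \<gamma> y, Join z) \<in> web_ccw w"
        "(White z, Join z, Seg \<beta> x) \<in> web_ccw w" by (rule web_ccw.intros(2)[OF bc(3) lt bc(4) xy]; simp)+
      show ?thesis using cases[of e] cases[of f] e f c unfolding W(4,5) White by blast
    qed
  qed
  have rim: "rim W i \<in> whites W" if "i \<in> {1..rim_size W}" for i
    using that unfolding W(1,6,7) positions_def by blast
  have disj: "whites W \<inter> blacks W = {}" unfolding W(1,2) by blast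
  have "well_formed W"
    unfolding well_formed_def using white black inc ccw adj rim disj in_edges W(4) by (intro conjI allI impI ballI) (simp; fail | blast)+
  then show ?thesis by (simp add: W_def)
qed

lemma built_kreweras_web: "built w (kreweras_web w)"
proof -
  obtain ps where ps: "distinct ps" "set ps = crossings (length w)"
    "runs w (map trip ps) blank (drawn (length w))" using run_prefix[of "length w"] by auto
  have "entry (length w) a = []" if "a \<in> {1..length w}" for a
  proof (cases "letter_at w a = A")
    case True
    have a: "1 \<le> a" "a \<le> length w" using that by auto
    show ?thesis using arc(3)[OF low_high(1)[OF a True]] arc(3)[OF low_high(2)[OF a True]] by (simp add: entry_def)
  qed (simp add: entry_def)
  then have "concat (map (entry (length w)) (rev [1..<Suc (length w)])) = []" by (auto simp del: upt_Suc)
  then have "drawn (length w) =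
      (black_succ (kreweras_web w), white_succ (kreweras_web w), map rim_edge [1..<Suc (length w)], [])"
    unfolding drawn_def black_succ_eq white_succ_eq by simp
  then have "runs w (map trip ps) blank
      (black_succ (kreweras_web w), white_succ (kreweras_web w), map rim_edge [1..<Suc (length w)], [])"
    using ps(3) by simp
  moreover have "distinct (names (map trip ps))" using distinct_trip_names[OF ps(1)] ps(2) by blast
  moreover note edges_eq[OF ps(2)]
  moreover have sz: "rim_size (kreweras_web w) = length w" "incid (kreweras_web w) = web_incid w"
    "rim (kreweras_web w) i = White (of_nat i)" for i by (simp_all add: kreweras_web_def)
  moreover have "length (map rim_edge [1..<Suc (length w)]) = length w" by (simp del: upt_Suc)
  moreover have "(White (of_nat i), e) \<in> web_incid w \<longleftrightarrow> e = map rim_edge [1..<Suc (length w)] ! (i - 1)"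
    if "i \<in> {1..length w}" for i e
  proof -
    have "i - 1 < length w" "1 + (i - 1) = i" using that unfolding atLeastAtMost_iff by linarith+
    then have "map rim_edge [1..<Suc (length w)] ! (i - 1) = rim_edge i" by (simp del: upt_Suc)
    then show ?thesis using rim_edge[of i e] that by simp
  qed
  ultimately show ?thesis unfolding built_def built_by_def using well_formed_kreweras_web by metis
qed

end

theorem theorem1p3:
  fixes n :: nat and w :: "letter list"
  assumes "1 \<le> n" and "kreweras_word n w"
  shows "kreweras_web (pro w) \<simeq> rot (kreweras_web w) \<and>
    kreweras_web (evac n w) \<simeq> flip (kreweras_web w)"
proof
  have built: "built u (kreweras_web u)" if "kreweras_word n u" for u
    using bump_diagram.built_kreweras_web[OF bump_diagram.intro[OF that]] .
  have len: "length w = 3 * n" using assms(2) by (simp add: kreweras_word_def)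
  then obtain a xs where w: "w = a # xs" using assms(1) by (cases w) auto
  obtain p v where pv: "slide [] A xs = (p, v)" by fastforce
  have pro: "pro w = p @ [v]" using pro_slide[OF assms(2)[unfolded w] pv] w by simp
  \<comment> \<open>A full sweep over the word yields the promoted word, and swaps that are carried
    out only when allowed preserve Kreweras words.\<close>
  have "kreweras_word n (p @ [v])" using tau_sweep_word(2)[of n a xs "[]" p v] assms(2) w pv by simp
  moreover have "built (p @ [v]) (rot (kreweras_web w))" using built_rot[OF built[OF assms(2), unfolded w] pv] w by simp
  ultimately show "kreweras_web (pro w) \<simeq> rot (kreweras_web w)" unfolding pro using built built_isotopic by blast
  have "length w = Suc (3 * n - 1)" using len assms(1) by simp
  then have "evac n w = evacuate w" "kreweras_word n (evacuate w)"
    using tau_sweeps_evacuate[of n w "[]" "3 * n - 1"] assms(2) by (simp_all add: evac_def)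
  then show "kreweras_web (evac n w) \<simeq> flip (kreweras_web w)"
    using built_isotopic built built_flip[OF built[OF assms(2)]] by metis
qed

end
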